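(* Let $(\mathcal X^+,\mathcal X^-)$ be the generalized projective geometry associated to a Jordan pair $(V^+,V^-)$ over $\mathbb K$, fix $a,b\in\mathcal X^-$ such that $\mathcal U_{a,b}:=\mathfrak v_a\cap\mathfrak v_b$ is non-empty, and let $p:\mathcal U_{a,b}\to\mathcal X^-$, $x\mapsto\Pi_{1/2}(a,x,b)$, be the midpoint map assigning to $x$ the midpoint of $a$ and $b$ in the affine space $\mathfrak v_x$. Then the set $\mathcal U_{a,b}$ becomes a symmetric space when equipped with the multiplication map $$\mu(x,y)=(-1)_{x,p(x)}(y)=\Pi_{-1}\bigl(x,\Pi_{1/2}(a,x,b),y\bigr).$$ In case $(V^+,V^-)=(J,J)$ comes from a unital Jordan algebra $J$, the map $p$ extends to a bijection, denoted again by $p:\mathcal X^+\to\mathcal X^-$; in this case the symmetric space $\mathcal U_{a,b}$ is the symmetric space associated to a polar geometry, and it is isomorphic to the quadratic prehomogeneous symmetric space $J^\times$.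
   Context: $\mathbb K$ is a commutative ring in which $2$ and $3$ are invertible. A (linear) Jordan pair is a pair of $\mathbb K$-modules $(V^+,V^-)$ with trilinear maps $T^\pm:V^\pm\times V^\mp\times V^\pm\to V^\pm$ such that $T^\pm(x,y,z)=T^\pm(z,y,x)$ and $T^\pm(u,v,T^\pm(x,y,z))=T^\pm(T^\pm(u,v,x),y,z)-T^\pm(x,T^\mp(v,u,y),z)+T^\pm(x,y,T^\pm(u,v,z))$. Associated geometry. Let $\mathfrak g=\mathfrak g_1\oplus\mathfrak g_0\oplus\mathfrak g_{-1}$ be the 3-graded Lie algebra with $\mathfrak g_{\pm1}=V^\pm$ abelian, $\mathfrak g_0\subset\mathrm{End}(V^+)\times\mathrm{End}(V^-)$ the Lie algebra spanned by $(\mathrm{id},-\mathrm{id})$ and all $D(x,y)=(T^+(x,y,\cdot),-T^-(y,x,\cdot))$, acting naturally on $V^\pm$, and $[x,y]=D(x,y)$ for $x\in V^+,y\in V^-$; thus $T^\pm(x,y,z)=[[x,y],z]$. For $x\in\mathfrak g_{\pm1}$, $\exp(x):=\exp(\mathrm{ad}\,x)\in\mathrm{Aut}(\mathfrak g)$ (a polynomial in $\mathrm{ad}\,x$). Let $U^\pm=\exp(\mathfrak g_{\pm1})$, $G=\langle U^+,U^-\rangle$, $H$ the subgroup of $G$ of elements preserving the 3-grading, $P^\pm=U^\pm H$, and $\mathcal X^+=G/P^-$, $\mathcal X^-=G/P^+$, with base point $o^+=eP^-$, $o^-=eP^+$. Elements $x\in\mathcal X^+$ and $a\in\mathcal X^-$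 are transversal, $x\top a$, if $(x,a)=(g.o^+,g.o^-)$ for some $g\in G$. For $a\in\mathcal X^-$, $\mathfrak v_a=\{x\in\mathcal X^+\mid x\top a\}$; for $x\in\mathcal X^+$, $\mathfrak v_x=\{a\in\mathcal X^-\mid x\top a\}$. Here $\mathfrak v_{o^-}=U^+.o^+\cong V^+$ is an affine space over $\mathbb K$, and $\mathfrak v_{g.o^-}=g.\mathfrak v_{o^-}$ carries the affine structure transported by $g$ (independent of choices); similarly for $\mathfrak v_x\subset\mathcal X^-$. For $r\in\mathbb K$ and $x,y\in\mathfrak v_a$, $\Pi_r(x,a,y)=r_{x,a}(y)$ is the element $r\cdot y$ in the $\mathbb K$-module $\mathfrak v_a$ with zero vector $x$ (i.e. $(1-r)x+ry$ in the affine space $\mathfrak v_a$); dually for $\Pi_r(a,x,b)$, $a,b\in\mathfrak v_x$. For invertible $r$, $r_{x,a}$ extends to a bijection of $\mathcal X^+$ which is the first component of the automorphism $(r_{x,a},r_{a,x}^{-1})$ of the geometry $(\mathcal X^+,\mathcal X^-)$ (automorphisms being pairs of bijections preserving transversality and the affine structures). Symmetric space: a set $M$ with $\mu(x,y)=\sigma_x(y)$ satisfying (S1) $\sigma_x(x)=x$, (S2) $\sigma_x^2=\mathrm{id}$, (S3) $\sigma_x\sigma_y\sigma_x=\sigma_{\sigma_x(y)}$ and (S4) the tangent map of $\sigma_x$ at $x$ is $-\mathrm{id}$, where (S4) is understood algebraically: in a natural affine chart around $x$ (here $\mathfrak v_{p(x)}$ with origin $x$), $\sigma_x$ is represented by $-\mathrm{id}$.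 Isomorphisms are bijections compatible with $\mu$. Polar geometry: a polarity is a bijection $q:\mathcal X^+\to\mathcal X^-$ such that $(q,q^{-1})$ is an isomorphism of $(\mathcal X^+,\mathcal X^-)$ onto the dual geometry $(\mathcal X^-,\mathcal X^+)$ and $x\top q(x)$ for some $x$; a (generalized) polar geometry is a generalized projective geometry together with a polarity $q$, and its associated symmetric space is $M^{(q)}=\{x\in\mathcal X^+\mid x\top q(x)\}$ with $\mu(x,y)=(-1)_{x,q(x)}(y)$. Unital Jordan algebra case: a Jordan algebra is a $\mathbb K$-module $J$ with commutative bilinear product $\bullet$ satisfying $x\bullet(x^2\bullet y)=x^2\bullet(x\bullet y)$. Its Jordan pair is $(J,J)$ with $T^\pm(x,y,z)=2((x\bullet y)\bullet z+x\bullet(y\bullet z)-y\bullet(x\bullet z))$. With $U_xy=2x\bullet(x\bullet y)-(x\bullet x)\bullet y$, $J^\times=\{x\mid U_x\in\mathrm{GL}(J)\}$, $x^{-1}=U_x^{-1}x$, the quadratic prehomogeneous symmetric space is $J^\times$ with product $\mu(x,y)=U_x(y^{-1})$.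
   Formalization: In the unital Jordan algebra case, a and b are also assumed to be in invertible position: for some x in U_{a,b}, b is an invertible element of v_x ≅ J with zero vector a. Without this the claim fails, e.g. for a = b and J ≠ 0, where p is constant. *)

theory Defs
  imports
    Complex_Main
    "HOL-Algebra.Bij"
    "HOL-Algebra.Generated_Groups"
    "HOL-Library.Function_Algebras"
    "HOL-Library.Product_Plus"
begin

definition unit_inv :: "'k::comm_ring_1 \<Rightarrow> 'k" where
  "unit_inv r = (THE s. r * s = 1)"


section \<open>Jordan pairs\<close>

record ('k, 'v, 'w) jpair =
  smult_p :: "'k \<Rightarrow> 'v \<Rightarrow> 'v"
  smult_m :: "'k \<Rightarrow> 'w \<Rightarrow> 'w"
  T_p :: "'v \<Rightarrow> 'w \<Rightarrow> 'v \<Rightarrow> 'v"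
  T_m :: "'w \<Rightarrow> 'v \<Rightarrow> 'w \<Rightarrow> 'w"

definition trilinear ::
  "('k::comm_ring_1 \<Rightarrow> 'v::ab_group_add \<Rightarrow> 'v) \<Rightarrow> ('k \<Rightarrow> 'w::ab_group_add \<Rightarrow> 'w) \<Rightarrow>
    ('v \<Rightarrow> 'w \<Rightarrow> 'v \<Rightarrow> 'v) \<Rightarrow> bool" where
  "trilinear s t T \<longleftrightarrow>
     (\<forall>y z. module_hom s s (\<lambda>x. T x y z)) \<and>
     (\<forall>x z. module_hom t s (\<lambda>y. T x y z)) \<and>
     (\<forall>x y. module_hom s s (\<lambda>z. T x y z))"

definition jordan_pair ::
  "('k::comm_ring_1, 'v::ab_group_add, 'w::ab_group_add) jpair \<Rightarrow> bool" where
  "jordan_pair V \<longleftrightarrow>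
     module (smult_p V) \<and> module (smult_m V) \<and>
     trilinear (smult_p V) (smult_m V) (T_p V) \<and>
     trilinear (smult_m V) (smult_p V) (T_m V) \<and>
     (\<forall>x y z. T_p V x y z = T_p V z y x) \<and>
     (\<forall>x y z. T_m V x y z = T_m V z y x) \<and>
     (\<forall>u v x y z. T_p V u v (T_p V x y z) =
        T_p V (T_p V u v x) y z - T_p V x (T_m V v u y) z + T_p V x y (T_p V u v z)) \<and>
     (\<forall>u v x y z. T_m V u v (T_m V x y z) =
        T_m V (T_m V u v x) y z - T_m V x (T_p V v u y) z + T_m V x y (T_m V u v z))"


section \<open>The 3-graded Lie algebra of a Jordan pair\<close>

text \<open>A triple \<open>(x, (A, B), y)\<close> stands for \<open>x + (A, B) + y\<close> in \<open>g\<^sub>1 \<oplus> g\<^sub>0 \<oplus> g\<^sub>-\<^sub>1\<close>; the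
  algebra itself is the subset \<open>tkk V\<close> of this type.\<close>

type_synonym ('v, 'w) tkk = "'v \<times> (('v \<Rightarrow> 'v) \<times> ('w \<Rightarrow> 'w)) \<times> 'w"

definition inner_D ::
  "('k::comm_ring_1, 'v::ab_group_add, 'w::ab_group_add) jpair \<Rightarrow> 'v \<Rightarrow> 'w \<Rightarrow>
    ('v \<Rightarrow> 'v) \<times> ('w \<Rightarrow> 'w)" where
  "inner_D V x y = (\<lambda>z. T_p V x y z, \<lambda>z. - T_m V y x z)"

definition end_smult ::
  "('k::comm_ring_1, 'v::ab_group_add, 'w::ab_group_add) jpair \<Rightarrow> 'k \<Rightarrow>
    ('v \<Rightarrow> 'v) \<times> ('w \<Rightarrow> 'w) \<Rightarrow> ('v \<Rightarrow> 'v) \<times> ('w \<Rightarrow> 'w)" where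
  "end_smult V r = (\<lambda>(A, B). (\<lambda>z. smult_p V r (A z), \<lambda>z. smult_m V r (B z)))"

definition tkk0 ::
  "('k::comm_ring_1, 'v::ab_group_add, 'w::ab_group_add) jpair \<Rightarrow>
    (('v \<Rightarrow> 'v) \<times> ('w \<Rightarrow> 'w)) set" where
  "tkk0 V = module.span (end_smult V)
     (insert (\<lambda>x. x, \<lambda>y. - y) {inner_D V x y | x y. True})"

definition tkk ::
  "('k::comm_ring_1, 'v::ab_group_add, 'w::ab_group_add) jpair \<Rightarrow> ('v, 'w) tkk set" where
  "tkk V = UNIV \<times> tkk0 V \<times> UNIV"

definition grade_p ::
  "('k::comm_ring_1, 'v::ab_group_add, 'w::ab_group_add) jpair \<Rightarrow> ('v, 'w) tkk set" where
  "grade_p V = UNIV \<times> {0} \<times> {0}"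

definition grade_0 ::
  "('k::comm_ring_1, 'v::ab_group_add, 'w::ab_group_add) jpair \<Rightarrow> ('v, 'w) tkk set" where
  "grade_0 V = {0} \<times> tkk0 V \<times> {0}"

definition grade_m ::
  "('k::comm_ring_1, 'v::ab_group_add, 'w::ab_group_add) jpair \<Rightarrow> ('v, 'w) tkk set" where
  "grade_m V = {0} \<times> {0} \<times> UNIV"

definition tkk_smult ::
  "('k::comm_ring_1, 'v::ab_group_add, 'w::ab_group_add) jpair \<Rightarrow> 'k \<Rightarrow>
    ('v, 'w) tkk \<Rightarrow> ('v, 'w) tkk" where
  "tkk_smult V r = (\<lambda>(x, AB, y). (smult_p V r x, end_smult V r AB, smult_m V r y))"

fun tkk_bracket ::
  "('k::comm_ring_1, 'v::ab_group_add, 'w::ab_group_add) jpair \<Rightarrow>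
    ('v, 'w) tkk \<Rightarrow> ('v, 'w) tkk \<Rightarrow> ('v, 'w) tkk" where
  "tkk_bracket V (x, (A, B), y) (x', (A', B'), y') =
     (A x' - A' x,
      (A \<circ> A' - A' \<circ> A, B \<circ> B' - B' \<circ> B) + inner_D V x y' - inner_D V x' y,
      B y' - B' y)"

text \<open>For \<open>X\<close> in \<open>g\<^sub>1\<close> or \<open>g\<^sub>-\<^sub>1\<close> one has \<open>(ad X)\<^sup>3 = 0\<close>, so the exponential series stops after the
  quadratic term.\<close>

definition exp_ad ::
  "('k::comm_ring_1, 'v::ab_group_add, 'w::ab_group_add) jpair \<Rightarrow>
    ('v, 'w) tkk \<Rightarrow> ('v, 'w) tkk \<Rightarrow> ('v, 'w) tkk" where
  "exp_ad V X = (\<lambda>Z \<in> tkk V.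
     Z + tkk_bracket V X Z + tkk_smult V (unit_inv 2) (tkk_bracket V X (tkk_bracket V X Z)))"

definition exp_p ::
  "('k::comm_ring_1, 'v::ab_group_add, 'w::ab_group_add) jpair \<Rightarrow>
    'v \<Rightarrow> ('v, 'w) tkk \<Rightarrow> ('v, 'w) tkk" where
  "exp_p V x = exp_ad V (x, 0, 0)"

definition exp_m ::
  "('k::comm_ring_1, 'v::ab_group_add, 'w::ab_group_add) jpair \<Rightarrow>
    'w \<Rightarrow> ('v, 'w) tkk \<Rightarrow> ('v, 'w) tkk" where
  "exp_m V y = exp_ad V (0, 0, y)"


section \<open>The groups and the homogeneous spaces\<close>

text \<open>All group operations are taken in the group of bijections of \<open>tkk V\<close>, of which
  \<open>Aut(g)\<close> is a subgroup.\<close>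

abbreviation tkk_bij ::
  "('k::comm_ring_1, 'v::ab_group_add, 'w::ab_group_add) jpair \<Rightarrow>
    (('v, 'w) tkk \<Rightarrow> ('v, 'w) tkk) monoid" where
  "tkk_bij V \<equiv> BijGroup (tkk V)"

definition U_p ::
  "('k::comm_ring_1, 'v::ab_group_add, 'w::ab_group_add) jpair \<Rightarrow>
    (('v, 'w) tkk \<Rightarrow> ('v, 'w) tkk) set" where
  "U_p V = range (exp_p V)"

definition U_m ::
  "('k::comm_ring_1, 'v::ab_group_add, 'w::ab_group_add) jpair \<Rightarrow>
    (('v, 'w) tkk \<Rightarrow> ('v, 'w) tkk) set" where
  "U_m V = range (exp_m V)"

definition elem_grp ::
  "('k::comm_ring_1, 'v::ab_group_add, 'w::ab_group_add) jpair \<Rightarrow>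
    (('v, 'w) tkk \<Rightarrow> ('v, 'w) tkk) set" where
  "elem_grp V = generate (tkk_bij V) (U_p V \<union> U_m V)"

definition H_grp ::
  "('k::comm_ring_1, 'v::ab_group_add, 'w::ab_group_add) jpair \<Rightarrow>
    (('v, 'w) tkk \<Rightarrow> ('v, 'w) tkk) set" where
  "H_grp V = {h \<in> elem_grp V. h ` grade_p V = grade_p V \<and> h ` grade_0 V = grade_0 V
     \<and> h ` grade_m V = grade_m V}"

definition P_p ::
  "('k::comm_ring_1, 'v::ab_group_add, 'w::ab_group_add) jpair \<Rightarrow>
    (('v, 'w) tkk \<Rightarrow> ('v, 'w) tkk) set" where
  "P_p V = U_p V <#>\<^bsub>tkk_bij V\<^esub> H_grp V"

definition P_m ::
  "('k::comm_ring_1, 'v::ab_group_add, 'w::ab_group_add) jpair \<Rightarrow>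
    (('v, 'w) tkk \<Rightarrow> ('v, 'w) tkk) set" where
  "P_m V = U_m V <#>\<^bsub>tkk_bij V\<^esub> H_grp V"

text \<open>Points of both spaces are left cosets; \<open>g\<close> acts on them by \<open>x \<mapsto> g <# x\<close>. Mind the signs:
  \<open>X\<^sup>+ = G/P\<^sup>-\<close> and \<open>X\<^sup>- = G/P\<^sup>+\<close>.\<close>

type_synonym ('v, 'w) point = "(('v, 'w) tkk \<Rightarrow> ('v, 'w) tkk) set"

definition base_p ::
  "('k::comm_ring_1, 'v::ab_group_add, 'w::ab_group_add) jpair \<Rightarrow> ('v, 'w) point" where
  "base_p V = \<one>\<^bsub>tkk_bij V\<^esub> <#\<^bsub>tkk_bij V\<^esub> P_m V"

definition base_m ::
  "('k::comm_ring_1, 'v::ab_group_add, 'w::ab_group_add) jpair \<Rightarrow> ('v, 'w) point" where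
  "base_m V = \<one>\<^bsub>tkk_bij V\<^esub> <#\<^bsub>tkk_bij V\<^esub> P_p V"

definition X_p ::
  "('k::comm_ring_1, 'v::ab_group_add, 'w::ab_group_add) jpair \<Rightarrow> ('v, 'w) point set" where
  "X_p V = {g <#\<^bsub>tkk_bij V\<^esub> P_m V | g. g \<in> elem_grp V}"

definition X_m ::
  "('k::comm_ring_1, 'v::ab_group_add, 'w::ab_group_add) jpair \<Rightarrow> ('v, 'w) point set" where
  "X_m V = {g <#\<^bsub>tkk_bij V\<^esub> P_p V | g. g \<in> elem_grp V}"

definition transversal ::
  "('k::comm_ring_1, 'v::ab_group_add, 'w::ab_group_add) jpair \<Rightarrow>
    ('v, 'w) point \<Rightarrow> ('v, 'w) point \<Rightarrow> bool" where
  "transversal V x a \<longleftrightarrow> (\<exists>g \<in> elem_grp V.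
     x = g <#\<^bsub>tkk_bij V\<^esub> base_p V \<and> a = g <#\<^bsub>tkk_bij V\<^esub> base_m V)"

text \<open>The affine structure of \<open>v\<^sub>a\<close>, \<open>a = g.o\<^sup>-\<close>, transported from \<open>V\<^sup>+\<close> by the chart
  \<open>u \<mapsto> g.exp(u).o\<^sup>+\<close>; this is meaningful for \<open>x, y \<in> v\<^sub>a\<close> only, where the value does not depend
  on \<open>g\<close>. Dually for \<open>aff_m\<close>.\<close>

definition aff_p ::
  "('k::comm_ring_1, 'v::ab_group_add, 'w::ab_group_add) jpair \<Rightarrow> 'k \<Rightarrow>
    ('v, 'w) point \<Rightarrow> ('v, 'w) point \<Rightarrow> ('v, 'w) point \<Rightarrow> ('v, 'w) point" where
  "aff_p V r x a y = (THE z. \<exists>g \<in> elem_grp V. \<exists>u w.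
     a = g <#\<^bsub>tkk_bij V\<^esub> base_m V \<and>
     x = g <#\<^bsub>tkk_bij V\<^esub> (exp_p V u <#\<^bsub>tkk_bij V\<^esub> base_p V) \<and>
     y = g <#\<^bsub>tkk_bij V\<^esub> (exp_p V w <#\<^bsub>tkk_bij V\<^esub> base_p V) \<and>
     z = g <#\<^bsub>tkk_bij V\<^esub>
       (exp_p V (smult_p V (1 - r) u + smult_p V r w) <#\<^bsub>tkk_bij V\<^esub> base_p V))"

definition aff_m ::
  "('k::comm_ring_1, 'v::ab_group_add, 'w::ab_group_add) jpair \<Rightarrow> 'k \<Rightarrow>
    ('v, 'w) point \<Rightarrow> ('v, 'w) point \<Rightarrow> ('v, 'w) point \<Rightarrow> ('v, 'w) point" where
  "aff_m V r a x b = (THE c. \<exists>g \<in> elem_grp V. \<exists>u w.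
     x = g <#\<^bsub>tkk_bij V\<^esub> base_p V \<and>
     a = g <#\<^bsub>tkk_bij V\<^esub> (exp_m V u <#\<^bsub>tkk_bij V\<^esub> base_m V) \<and>
     b = g <#\<^bsub>tkk_bij V\<^esub> (exp_m V w <#\<^bsub>tkk_bij V\<^esub> base_m V) \<and>
     c = g <#\<^bsub>tkk_bij V\<^esub>
       (exp_m V (smult_m V (1 - r) u + smult_m V r w) <#\<^bsub>tkk_bij V\<^esub> base_m V))"

text \<open>The extension of \<open>r\<^sub>x\<^sub>,\<^sub>a\<close> (\<open>r\<close> invertible) from \<open>v\<^sub>a\<close> to all of \<open>X\<^sup>+\<close>. At the base points it is
  induced by the automorphism \<open>\<rho>\<^sub>r = (r, 1, r\<^sup>-\<^sup>1)\<close> of the graded Lie algebra, which acts on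
  \<open>G/P\<^sup>-\<close> by \<open>k P\<^sup>- \<mapsto> \<rho>\<^sub>r k \<rho>\<^sub>r\<^sup>-\<^sup>1 P\<^sup>- = \<rho>\<^sub>r (k P\<^sup>-) \<rho>\<^sub>r\<^sup>-\<^sup>1\<close>; at \<open>(x, a) = (g.o\<^sup>+, g.o\<^sup>-)\<close> it is the
  conjugate of this bijection by \<open>g\<close>. (Preservation of transversality and of the affine
  structures alone does not determine the extension in general.)\<close>

definition grading_aut ::
  "('k::comm_ring_1, 'v::ab_group_add, 'w::ab_group_add) jpair \<Rightarrow> 'k \<Rightarrow>
    ('v, 'w) tkk \<Rightarrow> ('v, 'w) tkk" where
  "grading_aut V r = restrict
     (\<lambda>(x, AB, y). (smult_p V r x, AB, smult_m V (unit_inv r) y)) (tkk V)"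

definition base_dilation ::
  "('k::comm_ring_1, 'v::ab_group_add, 'w::ab_group_add) jpair \<Rightarrow> 'k \<Rightarrow>
    ('v, 'w) point \<Rightarrow> ('v, 'w) point" where
  "base_dilation V r z =
     (\<lambda>k. grading_aut V r \<otimes>\<^bsub>tkk_bij V\<^esub> k \<otimes>\<^bsub>tkk_bij V\<^esub> inv\<^bsub>tkk_bij V\<^esub> grading_aut V r) ` z"

definition dilation ::
  "('k::comm_ring_1, 'v::ab_group_add, 'w::ab_group_add) jpair \<Rightarrow> 'k \<Rightarrow>
    ('v, 'w) point \<Rightarrow> ('v, 'w) point \<Rightarrow> ('v, 'w) point \<Rightarrow> ('v, 'w) point" where
  "dilation V r x a z = (THE z'. \<exists>g \<in> elem_grp V.
     x = g <#\<^bsub>tkk_bij V\<^esub> base_p V \<and> a = g <#\<^bsub>tkk_bij V\<^esub> base_m V \<and>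
     z' = g <#\<^bsub>tkk_bij V\<^esub> base_dilation V r (inv\<^bsub>tkk_bij V\<^esub> g <#\<^bsub>tkk_bij V\<^esub> z))"


section \<open>Geometries, isomorphisms and polarities\<close>

record ('k, 'x, 'a) geometry =
  pts_p :: "'x set"
  pts_m :: "'a set"
  transv :: "'x \<Rightarrow> 'a \<Rightarrow> bool"
  Pi_p :: "'k \<Rightarrow> 'x \<Rightarrow> 'a \<Rightarrow> 'x \<Rightarrow> 'x"
  Pi_m :: "'k \<Rightarrow> 'a \<Rightarrow> 'x \<Rightarrow> 'a \<Rightarrow> 'a"

definition nbh_p :: "('k, 'x, 'a) geometry \<Rightarrow> 'a \<Rightarrow> 'x set" where
  "nbh_p \<Gamma> a = {x \<in> pts_p \<Gamma>. transv \<Gamma> x a}"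

definition nbh_m :: "('k, 'x, 'a) geometry \<Rightarrow> 'x \<Rightarrow> 'a set" where
  "nbh_m \<Gamma> x = {a \<in> pts_m \<Gamma>. transv \<Gamma> x a}"

definition dual_geometry :: "('k, 'x, 'a) geometry \<Rightarrow> ('k, 'a, 'x) geometry" where
  "dual_geometry \<Gamma> = \<lparr>pts_p = pts_m \<Gamma>, pts_m = pts_p \<Gamma>, transv = (\<lambda>a x. transv \<Gamma> x a),
     Pi_p = Pi_m \<Gamma>, Pi_m = Pi_p \<Gamma>\<rparr>"

definition geometry_iso ::
  "('k, 'x, 'a) geometry \<Rightarrow> ('k, 'y, 'b) geometry \<Rightarrow> ('x \<Rightarrow> 'y) \<Rightarrow> ('a \<Rightarrow> 'b) \<Rightarrow> bool" where
  "geometry_iso \<Gamma> \<Delta> f f' \<longleftrightarrow>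
     bij_betw f (pts_p \<Gamma>) (pts_p \<Delta>) \<and> bij_betw f' (pts_m \<Gamma>) (pts_m \<Delta>) \<and>
     (\<forall>x \<in> pts_p \<Gamma>. \<forall>a \<in> pts_m \<Gamma>. transv \<Gamma> x a \<longleftrightarrow> transv \<Delta> (f x) (f' a)) \<and>
     (\<forall>r. \<forall>a \<in> pts_m \<Gamma>. \<forall>x \<in> nbh_p \<Gamma> a. \<forall>y \<in> nbh_p \<Gamma> a.
        f (Pi_p \<Gamma> r x a y) = Pi_p \<Delta> r (f x) (f' a) (f y)) \<and>
     (\<forall>r. \<forall>x \<in> pts_p \<Gamma>. \<forall>a \<in> nbh_m \<Gamma> x. \<forall>b \<in> nbh_m \<Gamma> x.
        f' (Pi_m \<Gamma> r a x b) = Pi_m \<Delta> r (f' a) (f x) (f' b))"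

definition polarity :: "('k, 'x, 'a) geometry \<Rightarrow> ('x \<Rightarrow> 'a) \<Rightarrow> bool" where
  "polarity \<Gamma> q \<longleftrightarrow>
     bij_betw q (pts_p \<Gamma>) (pts_m \<Gamma>) \<and>
     geometry_iso \<Gamma> (dual_geometry \<Gamma>) q (inv_into (pts_p \<Gamma>) q) \<and>
     (\<exists>x \<in> pts_p \<Gamma>. transv \<Gamma> x (q x))"

definition jp_geometry ::
  "('k::comm_ring_1, 'v::ab_group_add, 'w::ab_group_add) jpair \<Rightarrow>
    ('k, ('v, 'w) point, ('v, 'w) point) geometry" where
  "jp_geometry V = \<lparr>pts_p = X_p V, pts_m = X_m V, transv = transversal V,
     Pi_p = aff_p V, Pi_m = aff_m V\<rparr>"

definition polar_set ::
  "('k::comm_ring_1, 'v::ab_group_add, 'w::ab_group_add) jpair \<Rightarrow>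
    (('v, 'w) point \<Rightarrow> ('v, 'w) point) \<Rightarrow> ('v, 'w) point set" where
  "polar_set V q = {x \<in> X_p V. transversal V x (q x)}"

definition polar_mult ::
  "('k::comm_ring_1, 'v::ab_group_add, 'w::ab_group_add) jpair \<Rightarrow>
    (('v, 'w) point \<Rightarrow> ('v, 'w) point) \<Rightarrow>
    ('v, 'w) point \<Rightarrow> ('v, 'w) point \<Rightarrow> ('v, 'w) point" where
  "polar_mult V q x y = dilation V (- 1) x (q x) y"

definition U_set ::
  "('k::comm_ring_1, 'v::ab_group_add, 'w::ab_group_add) jpair \<Rightarrow>
    ('v, 'w) point \<Rightarrow> ('v, 'w) point \<Rightarrow> ('v, 'w) point set" where
  "U_set V a b = nbh_p (jp_geometry V) a \<inter> nbh_p (jp_geometry V) b"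

definition midpt ::
  "('k::comm_ring_1, 'v::ab_group_add, 'w::ab_group_add) jpair \<Rightarrow>
    ('v, 'w) point \<Rightarrow> ('v, 'w) point \<Rightarrow> ('v, 'w) point \<Rightarrow> ('v, 'w) point" where
  "midpt V a b x = Pi_m (jp_geometry V) (unit_inv 2) a x b"

definition U_mult ::
  "('k::comm_ring_1, 'v::ab_group_add, 'w::ab_group_add) jpair \<Rightarrow>
    ('v, 'w) point \<Rightarrow> ('v, 'w) point \<Rightarrow>
    ('v, 'w) point \<Rightarrow> ('v, 'w) point \<Rightarrow> ('v, 'w) point" where
  "U_mult V a b x y = dilation V (- 1) x (midpt V a b x) y"


section \<open>Symmetric spaces\<close>

text \<open>\<open>C x\<close> is the domain of the affine chart around \<open>x\<close>, and \<open>neg x y\<close> is the negative of \<open>y\<close> in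
  the module \<open>C x\<close> with zero vector \<open>x\<close>. The four last conjuncts are (S1)--(S4).\<close>

definition symmetric_space ::
  "'m set \<Rightarrow> ('m \<Rightarrow> 'm \<Rightarrow> 'm) \<Rightarrow> ('m \<Rightarrow> 'm set) \<Rightarrow> ('m \<Rightarrow> 'm \<Rightarrow> 'm) \<Rightarrow> bool" where
  "symmetric_space M \<mu> C neg \<longleftrightarrow>
     (\<forall>x \<in> M. \<forall>y \<in> M. \<mu> x y \<in> M) \<and>
     (\<forall>x \<in> M. \<mu> x x = x) \<and>
     (\<forall>x \<in> M. \<forall>y \<in> M. \<mu> x (\<mu> x y) = y) \<and>
     (\<forall>x \<in> M. \<forall>y \<in> M. \<forall>z \<in> M. \<mu> x (\<mu> y (\<mu> x z)) = \<mu> (\<mu> x y) z) \<and>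
     (\<forall>x \<in> M. x \<in> C x \<and> (\<forall>y \<in> C x. \<mu> x y = neg x y))"

definition mult_isomorphic ::
  "'m set \<Rightarrow> ('m \<Rightarrow> 'm \<Rightarrow> 'm) \<Rightarrow> 'n set \<Rightarrow> ('n \<Rightarrow> 'n \<Rightarrow> 'n) \<Rightarrow> bool" where
  "mult_isomorphic M \<mu> N \<nu> \<longleftrightarrow>
     (\<exists>f. bij_betw f M N \<and> (\<forall>x \<in> M. \<forall>y \<in> M. f (\<mu> x y) = \<nu> (f x) (f y)))"


section \<open>Unital Jordan algebras\<close>

definition unital_jordan_algebra ::
  "('k::comm_ring_1 \<Rightarrow> 'j::ab_group_add \<Rightarrow> 'j) \<Rightarrow> ('j \<Rightarrow> 'j \<Rightarrow> 'j) \<Rightarrow> bool" where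
  "unital_jordan_algebra s m \<longleftrightarrow>
     module s \<and>
     (\<forall>y. module_hom s s (\<lambda>x. m x y)) \<and> (\<forall>x. module_hom s s (\<lambda>y. m x y)) \<and>
     (\<forall>x y. m x y = m y x) \<and>
     (\<forall>x y. m x (m (m x x) y) = m (m x x) (m x y)) \<and>
     (\<exists>e. \<forall>x. m e x = x)"

definition jordan_triple ::
  "('k::comm_ring_1 \<Rightarrow> 'j::ab_group_add \<Rightarrow> 'j) \<Rightarrow> ('j \<Rightarrow> 'j \<Rightarrow> 'j) \<Rightarrow>
    'j \<Rightarrow> 'j \<Rightarrow> 'j \<Rightarrow> 'j" where
  "jordan_triple s m x y z = s 2 (m (m x y) z + m x (m y z) - m y (m x z))"

definition algebra_jpair ::
  "('k::comm_ring_1 \<Rightarrow> 'j::ab_group_add \<Rightarrow> 'j) \<Rightarrow> ('j \<Rightarrow> 'j \<Rightarrow> 'j) \<Rightarrow> ('k, 'j, 'j) jpair" where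
  "algebra_jpair s m = \<lparr>smult_p = s, smult_m = s,
     T_p = jordan_triple s m, T_m = jordan_triple s m\<rparr>"

definition U_op ::
  "('k::comm_ring_1 \<Rightarrow> 'j::ab_group_add \<Rightarrow> 'j) \<Rightarrow> ('j \<Rightarrow> 'j \<Rightarrow> 'j) \<Rightarrow> 'j \<Rightarrow> 'j \<Rightarrow> 'j" where
  "U_op s m x y = s 2 (m x (m x y)) - m (m x x) y"

definition J_units ::
  "('k::comm_ring_1 \<Rightarrow> 'j::ab_group_add \<Rightarrow> 'j) \<Rightarrow> ('j \<Rightarrow> 'j \<Rightarrow> 'j) \<Rightarrow> 'j set" where
  "J_units s m = {x. module_hom s s (U_op s m x) \<and> bij (U_op s m x)}"

definition J_inv ::
  "('k::comm_ring_1 \<Rightarrow> 'j::ab_group_add \<Rightarrow> 'j) \<Rightarrow> ('j \<Rightarrow> 'j \<Rightarrow> 'j) \<Rightarrow> 'j \<Rightarrow> 'j" where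
  "J_inv s m x = inv_into UNIV (U_op s m x) x"

definition J_mult ::
  "('k::comm_ring_1 \<Rightarrow> 'j::ab_group_add \<Rightarrow> 'j) \<Rightarrow> ('j \<Rightarrow> 'j \<Rightarrow> 'j) \<Rightarrow> 'j \<Rightarrow> 'j \<Rightarrow> 'j" where
  "J_mult s m x y = U_op s m x (J_inv s m y)"

text \<open>For some \<open>x = g.o\<^sup>+\<close> in \<open>v\<^sub>a \<inter> v\<^sub>b\<close>, the point \<open>b\<close> is an invertible element \<open>c\<close> of the module
  \<open>v\<^sub>x \<cong> J\<close> with zero vector \<open>a\<close>; equivalently, \<open>V\<^sup>+\<close> with the product \<open>T\<^sup>+(u, c, w)/2\<close> defined by
  \<open>(x, a, b)\<close> is a unital Jordan algebra, an isotope of \<open>J\<close>. This excludes degenerate positions such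
  as \<open>a = b\<close>, where the midpoint map is constant.\<close>

definition invertible_position ::
  "('k::comm_ring_1 \<Rightarrow> 'j::ab_group_add \<Rightarrow> 'j) \<Rightarrow> ('j \<Rightarrow> 'j \<Rightarrow> 'j) \<Rightarrow>
    ('j, 'j) point \<Rightarrow> ('j, 'j) point \<Rightarrow> bool" where
  "invertible_position s m a b \<longleftrightarrow>
     (let V = algebra_jpair s m in
      \<exists>g \<in> elem_grp V. \<exists>c \<in> J_units s m.
        a = g <#\<^bsub>tkk_bij V\<^esub> base_m V \<and>
        b = g <#\<^bsub>tkk_bij V\<^esub> (exp_m V c <#\<^bsub>tkk_bij V\<^esub> base_m V))"

end

theory Submission
  imports Defs
begin

text \<open>Everything is read off the Euler element \<open>E = (id, -id)\<close> of \<open>g\<^sub>0\<close>: an element \<open>g\<close> of \<open>G\<close> lies in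
  \<open>H\<close>, \<open>P\<^sup>-\<close>, \<open>P\<^sup>+\<close> iff \<open>g E - E\<close> lies in \<open>0\<close>, \<open>g\<^sub>-\<^sub>1\<close>, \<open>g\<^sub>1\<close>. At \<open>x\<close> in \<open>v\<^sub>a \<inter> v\<^sub>b\<close> choose a frame \<open>g\<close> with
  \<open>x = g.o\<^sup>+\<close>, \<open>p(x) = g.o\<^sup>-\<close>, \<open>a = g.exp(-t).o\<^sup>-\<close>, \<open>b = g.exp(t).o\<^sup>-\<close>. The symmetry at \<open>x\<close> is
  conjugation by \<open>g \<rho> g\<^sup>-\<^sup>1\<close> with \<open>\<rho> = (-1, 1, -1)\<close>; it exchanges \<open>a\<close> and \<open>b\<close>, hence commutes with the
  midpoint map, and this gives (S3).

  In the Jordan algebra case one may take \<open>a = o\<^sup>-\<close> and \<open>b = w.o\<^sup>-\<close> with a Weyl element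
  \<open>w = exp(x) exp(-x\<^sup>-\<^sup>1) exp(x)\<close>, for which \<open>w E = -E\<close>. Right multiplication by \<open>w\<close> identifies \<open>X\<^sup>+\<close> with
  \<open>X\<^sup>-\<close>, and \<open>p(x)\<close> is the image of \<open>-x\<close> (\<open>x\<close>, \<open>-x\<close> are harmonic with respect to \<open>0\<close>, \<open>\<infinity>\<close>); this formula
  makes sense on all of \<open>X\<^sup>+\<close> and is the polarity \<open>q\<close>. If \<open>z = K.o\<^sup>+\<close> is transversal to \<open>q(z)\<close> then
  \<open>\<rho> (K E) = - K E\<close>, so \<open>K E = u + v\<close> with \<open>u\<close>, \<open>v\<close> of degree \<open>1\<close>, \<open>-1\<close>; such a conjugate of \<open>E\<close> forces
  \<open>D(u, v) = E/2\<close>, and \<open>z\<close> is the invertible element \<open>-2u\<close>.\<close>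

lemma unit_inv_mult:
  fixes r :: "'k::comm_ring_1"
  assumes "r dvd 1"
  shows "r * unit_inv r = 1"
proof -
  obtain t where t: "r * t = 1" using assms by (metis dvdE)
  have "unit_inv r = t" unfolding unit_inv_def
  proof (rule the_equality)
    show "r * t = 1" by (rule t)
  next
    fix u assume "r * u = 1"
    then show "u = t" using t by (metis mult.assoc mult.commute mult_1)
  qed
  then show ?thesis using t by simp
qed

lemma unit_inv_minus_one [simp]: "unit_inv (- 1 :: 'k::comm_ring_1) = - 1"
  using unit_inv_mult[of "- 1 :: 'k"] by (simp add: minus_equation_iff)

section \<open>Jordan pairs and their Lie algebras\<close>

locale jordan_pair_space =
  fixes V :: "('k::comm_ring_1, 'v::ab_group_add, 'w::ab_group_add) jpair"
  assumes jp: "jordan_pair V" and two: "(2::'k) dvd 1" and three: "(3::'k) dvd 1"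
begin

abbreviation "sp \<equiv> smult_p V"
abbreviation "sm \<equiv> smult_m V"
abbreviation "Tp \<equiv> T_p V"
abbreviation "Tm \<equiv> T_m V"
abbreviation half :: 'k where "half \<equiv> unit_inv 2"

lemma module_p: "module sp" and module_m: "module sm"
  using jp by (auto simp: jordan_pair_def)

section \<open>Scalars, and division by 2 and 3\<close>

lemma scale_simps [simp]:
  "sp 1 x = x" "sm 1 y = y" "sp r 0 = 0" "sm r 0 = 0" "sp 0 x = 0" "sm 0 y = 0"
  "sp r (sp r' x) = sp (r * r') x" "sm r (sm r' y) = sm (r * r') y"
  "sp r (- x) = - sp r x" "sm r (- y) = - sm r y"
  "sp (- r) x = - sp r x" "sm (- r) y = - sm r y"
  by (simp_all add: module.scale_one[OF module_p] module.scale_one[OF module_m]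
      module.scale_zero_right[OF module_p] module.scale_zero_right[OF module_m]
      module.scale_zero_left[OF module_p] module.scale_zero_left[OF module_m]
      module.scale_scale[OF module_p] module.scale_scale[OF module_m]
      module.scale_minus_right[OF module_p] module.scale_minus_right[OF module_m]
      module.scale_minus_left[OF module_p] module.scale_minus_left[OF module_m])

lemma scale_distrib:
  "sp r (x + x') = sp r x + sp r x'" "sm r (y + y') = sm r y + sm r y'"
  "sp r (x - x') = sp r x - sp r x'" "sm r (y - y') = sm r y - sm r y'"
  "sp (r + r') x = sp r x + sp r' x" "sm (r + r') y = sm r y + sm r' y"
  "sp (r - r') x = sp r x - sp r' x" "sm (r - r') y = sm r y - sm r' y"
  by (simp_all add: module.scale_right_distrib[OF module_p] module.scale_right_distrib[OF module_m]
      module.scale_right_diff_distrib[OF module_p] module.scale_right_diff_distrib[OF module_m]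
      module.scale_left_distrib[OF module_p] module.scale_left_distrib[OF module_m]
      module.scale_left_diff_distrib[OF module_p] module.scale_left_diff_distrib[OF module_m])

lemma half_add: "sp half x + sp half x = x" "sm half y + sm half y = y"
proof -
  have h: "half + half = 1" using unit_inv_mult[OF two] unfolding mult_2 .
  show "sp half x + sp half x = x" "sm half y + sm half y = y"
    unfolding scale_distrib(5,6)[symmetric] h by simp_all
qed

lemma double_half: "sp half (x + x) = x" "sm half (y + y) = y"
  by (simp_all add: scale_distrib half_add)

lemma double_eq_0_iff [simp]: "(x::'v) + x = 0 \<longleftrightarrow> x = 0" "(y::'w) + y = 0 \<longleftrightarrow> y = 0"
  by (auto dest: arg_cong[where f = "sp half"] arg_cong[where f = "sm half"] simp: double_half)

lemma double_inject: "(x::'v) + x = x' + x' \<Longrightarrow> x = x'" "(y::'w) + y = y' + y' \<Longrightarrow> y = y'"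
  by (drule arg_cong[where f = "sp half"], simp only: double_half)
    (drule arg_cong[where f = "sm half"], simp only: double_half)

text \<open>Entry point of the invertibility of 3: \<open>Tp_commute\<close>,
  \<open>half_eigen_p\<close> and their duals all reduce to \<open>3 x = 0\<close>.\<close>

lemma triple_eq_0: "(x::'v) + x + x = 0 \<Longrightarrow> x = 0" "(y::'w) + y + y = 0 \<Longrightarrow> y = 0"
proof -
  have 3: "unit_inv 3 + unit_inv 3 + unit_inv 3 = (1::'k)"
    using unit_inv_mult[OF three] by (simp add: algebra_simps)
  show "x = 0" if "x + x + x = 0" for x :: 'v
  proof -
    have "x = sp (unit_inv 3 + unit_inv 3 + unit_inv 3) x" unfolding 3 by simp
    also have "\<dots> = sp (unit_inv 3) (x + x + x)" by (simp only: scale_distrib)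
    finally show ?thesis using that by simp
  qed
  show "y = 0" if "y + y + y = 0" for y :: 'w
  proof -
    have "y = sm (unit_inv 3 + unit_inv 3 + unit_inv 3) y" unfolding 3 by simp
    also have "\<dots> = sm (unit_inv 3) (y + y + y)" by (simp only: scale_distrib)
    finally show ?thesis using that by simp
  qed
qed

section \<open>The triple products and their identities\<close>

lemma Tp_hom: "module_hom sp sp (\<lambda>x. Tp x y z)" "module_hom sm sp (\<lambda>y. Tp x y z)"
    "module_hom sp sp (\<lambda>z. Tp x y z)"
  and Tm_hom: "module_hom sm sm (\<lambda>y. Tm y x y')" "module_hom sp sm (\<lambda>x. Tm y x y')"
    "module_hom sm sm (\<lambda>y'. Tm y x y')"
  using jp by (simp_all add: jordan_pair_def trilinear_def)

lemma T_add:
  "Tp (x + x') y z = Tp x y z + Tp x' y z" "Tp x (y + y') z = Tp x y z + Tp x y' z"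
  "Tp x y (z + z') = Tp x y z + Tp x y z'"
  "Tm (y + y') x v = Tm y x v + Tm y' x v" "Tm y (x + x') v = Tm y x v + Tm y x' v"
  "Tm y x (v + v') = Tm y x v + Tm y x v'"
  using module_hom.add[OF Tp_hom(1)] module_hom.add[OF Tp_hom(2)] module_hom.add[OF Tp_hom(3)]
    module_hom.add[OF Tm_hom(1)] module_hom.add[OF Tm_hom(2)] module_hom.add[OF Tm_hom(3)] by auto

lemma T_diff:
  "Tp (x - x') y z = Tp x y z - Tp x' y z" "Tp x (y - y') z = Tp x y z - Tp x y' z"
  "Tp x y (z - z') = Tp x y z - Tp x y z'"
  "Tm (y - y') x v = Tm y x v - Tm y' x v" "Tm y (x - x') v = Tm y x v - Tm y x' v"
  "Tm y x (v - v') = Tm y x v - Tm y x v'"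
  using module_hom.diff[OF Tp_hom(1)] module_hom.diff[OF Tp_hom(2)] module_hom.diff[OF Tp_hom(3)]
    module_hom.diff[OF Tm_hom(1)] module_hom.diff[OF Tm_hom(2)] module_hom.diff[OF Tm_hom(3)] by auto

lemma T_simps [simp]:
  "Tp 0 y z = 0" "Tp x 0 z = 0" "Tp x y 0 = 0" "Tm 0 x v = 0" "Tm y 0 v = 0" "Tm y x 0 = 0"
  "Tp (- x) y z = - Tp x y z" "Tp x (- y) z = - Tp x y z" "Tp x y (- z) = - Tp x y z"
  "Tm (- y) x v = - Tm y x v" "Tm y (- x) v = - Tm y x v" "Tm y x (- v) = - Tm y x v"
  "Tp (sp r x) y z = sp r (Tp x y z)" "Tp x (sm r y) z = sp r (Tp x y z)"
  "Tp x y (sp r z) = sp r (Tp x y z)"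
  "Tm (sm r y) x v = sm r (Tm y x v)" "Tm y (sp r x) v = sm r (Tm y x v)"
  "Tm y x (sm r v) = sm r (Tm y x v)"
  using module_hom.zero[OF Tp_hom(1)] module_hom.zero[OF Tp_hom(2)] module_hom.zero[OF Tp_hom(3)]
    module_hom.zero[OF Tm_hom(1)] module_hom.zero[OF Tm_hom(2)] module_hom.zero[OF Tm_hom(3)]
    module_hom.neg[OF Tp_hom(1)] module_hom.neg[OF Tp_hom(2)] module_hom.neg[OF Tp_hom(3)]
    module_hom.neg[OF Tm_hom(1)] module_hom.neg[OF Tm_hom(2)] module_hom.neg[OF Tm_hom(3)]
    module_hom.scale[OF Tp_hom(1)] module_hom.scale[OF Tp_hom(2)] module_hom.scale[OF Tp_hom(3)]
    module_hom.scale[OF Tm_hom(1)] module_hom.scale[OF Tm_hom(2)] module_hom.scale[OF Tm_hom(3)]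
  by auto

lemma Tp_sym: "Tp x y z = Tp z y x" and Tm_sym: "Tm y x v = Tm v x y"
  using jp unfolding jordan_pair_def by blast+

lemma Tp_jordan:
    "Tp u v (Tp x y z) = Tp (Tp u v x) y z - Tp x (Tm v u y) z + Tp x y (Tp u v z)"
  and Tm_jordan:
    "Tm v u (Tm y x t) = Tm (Tm v u y) x t - Tm y (Tp u v x) t + Tm y x (Tm v u t)"
  using jp unfolding jordan_pair_def by blast+

text \<open>Two instances of the Jordan identity give \<open>?a = 2 ?b - ?c\<close> and, with
  \<open>y\<close> and \<open>z\<close> exchanged, \<open>?b = 2 ?a - ?c\<close>; hence
  \<open>3 (?a - ?b) = 0\<close>.\<close>

lemma Tp_commute: "Tp x y (Tp x z x) = Tp x z (Tp x y x)"
  and Tp_shift: "Tp x y (Tp x z x) = Tp x (Tm y x z) x"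
proof -
  let ?a = "Tp x y (Tp x z x)" and ?b = "Tp x z (Tp x y x)" and ?c = "Tp x (Tm y x z) x"
  have a: "?a = ?b + ?b - ?c"
    using Tp_jordan[of x y x z x] Tp_sym[of "Tp x y x" z x] by simp
  have b: "?b = ?a + ?a - ?c"
    using Tp_jordan[of x z x y x] Tp_sym[of "Tp x z x" y x] Tm_sym[of z x y] by simp
  have "(?a - ?b) + (?a - ?b) + (?a - ?b) = 0"
    \<comment> \<open>Only one \<open>?a\<close> and one subtracted \<open>?b\<close> are rewritten;
      then everything cancels.\<close>
    by (subst (1) a, subst (5) b) (simp add: algebra_simps)
  from triple_eq_0(1)[OF this] show ab: "?a = ?b" by simp
  show "?a = ?c" using a ab by simp
qed

lemma Tm_commute: "Tm x y (Tm x z x) = Tm x z (Tm x y x)"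
  and Tm_shift: "Tm x y (Tm x z x) = Tm x (Tp y x z) x"
proof -
  let ?a = "Tm x y (Tm x z x)" and ?b = "Tm x z (Tm x y x)" and ?c = "Tm x (Tp y x z) x"
  have a: "?a = ?b + ?b - ?c"
    using Tm_jordan[of x y x z x] Tm_sym[of "Tm x y x" z x] by simp
  have b: "?b = ?a + ?a - ?c"
    using Tm_jordan[of x z x y x] Tm_sym[of "Tm x z x" y x] Tp_sym[of z x y] by simp
  have "(?a - ?b) + (?a - ?b) + (?a - ?b) = 0"
    by (subst (1) a, subst (5) b) (simp add: algebra_simps)
  from triple_eq_0(2)[OF this] show ab: "?a = ?b" by simp
  show "?a = ?c" using a ab by simp
qed

section \<open>Derivations of the pair and the degree-zero part\<close>

abbreviation "euler0 \<equiv> (\<lambda>x::'v. x, \<lambda>y::'w. - y)"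

text \<open>Collects what the bracket computations need to know about an element of
  \<open>g_0\<close>; it follows from membership in the span by induction
  (\<open>derivation_pair_tkk0\<close>).\<close>

definition derivation_pair :: "('v \<Rightarrow> 'v) \<Rightarrow> ('w \<Rightarrow> 'w) \<Rightarrow> bool" where
  "derivation_pair A B \<longleftrightarrow>
     (\<forall>x y. A (x + y) = A x + A y) \<and> (\<forall>r x. A (sp r x) = sp r (A x)) \<and>
     (\<forall>x y. B (x + y) = B x + B y) \<and> (\<forall>r x. B (sm r x) = sm r (B x)) \<and>
     (\<forall>x y z. A (Tp x y z) = Tp (A x) y z + Tp x (B y) z + Tp x y (A z)) \<and>
     (\<forall>x y z. B (Tm x y z) = Tm (B x) y z + Tm x (A y) z + Tm x y (B z))"

lemma end_smult_apply: "end_smult V r (A, B) = (\<lambda>z. sp r (A z), \<lambda>z. sm r (B z))"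
  by (simp add: end_smult_def)

lemma module_end: "module (end_smult V)"
  by unfold_locales
    (auto simp: end_smult_def fun_eq_iff scale_distrib plus_prod_def split: prod.splits)

lemma derivation_pair_euler0: "derivation_pair (\<lambda>x. x) (\<lambda>y. - y)"
  by (simp add: derivation_pair_def)

lemma derivation_pair_inner: "derivation_pair (Tp x y) (\<lambda>z. - Tm y x z)"
  unfolding derivation_pair_def
  by (intro conjI allI) (simp_all add: T_add Tp_jordan[of x y] Tm_jordan[of y x])

lemma tkk0_induct [consumes 1, case_names zero add]:
  assumes "AB \<in> tkk0 V" and "P 0"
    and "\<And>r S X. S \<in> insert euler0 {inner_D V x y | x y. True} \<Longrightarrow> P X \<Longrightarrow> P (end_smult V r S + X)"
  shows "P AB"
  by (rule module.span_induct_alt[OF module_end assms(1)[unfolded tkk0_def]]) (fact assms)+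

lemma tkk0_closed:
  "0 \<in> tkk0 V" "X \<in> tkk0 V \<Longrightarrow> Y \<in> tkk0 V \<Longrightarrow> X + Y \<in> tkk0 V"
  "X \<in> tkk0 V \<Longrightarrow> Y \<in> tkk0 V \<Longrightarrow> X - Y \<in> tkk0 V" "X \<in> tkk0 V \<Longrightarrow> - X \<in> tkk0 V"
  "X \<in> tkk0 V \<Longrightarrow> end_smult V r X \<in> tkk0 V"
  "euler0 \<in> tkk0 V" "inner_D V x y \<in> tkk0 V"
  unfolding tkk0_def
  by (auto intro: module.span_zero[OF module_end] module.span_add[OF module_end]
      module.span_diff[OF module_end] module.span_neg[OF module_end]
      module.span_scale[OF module_end] module.span_base[OF module_end])

lemma derivation_pair_tkk0:
  assumes "(A, B) \<in> tkk0 V" shows "derivation_pair A B"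
proof -
  have "derivation_pair (fst X) (snd X)" if "X \<in> tkk0 V" for X
    using that
  proof (induction X rule: tkk0_induct)
    case zero
    show ?case by (simp add: derivation_pair_def)
  next
    case (add r S X)
    have "derivation_pair (fst S) (snd S)"
      using add(1) derivation_pair_euler0 derivation_pair_inner by (auto simp: inner_D_def)
    with add(2) show ?case
      by (cases S; cases X)
        (simp add: derivation_pair_def end_smult_apply scale_distrib T_add algebra_simps)
  qed
  from this[OF assms] show ?thesis by simp
qed

lemma derivation_pairD:
  assumes "derivation_pair A B"
  shows "A (x + y) = A x + A y" "A (sp r x) = sp r (A x)"
    "B (u + v) = B u + B v" "B (sm r u) = sm r (B u)"
    "A (Tp x u z) = Tp (A x) u z + Tp x (B u) z + Tp x u (A z)"
    "B (Tm u x v) = Tm (B u) x v + Tm u (A x) v + Tm u x (B v)"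
    "A 0 = 0" "B 0 = 0" "A (- x) = - A x" "B (- u) = - B u"
    "A (x - y) = A x - A y" "B (u - v) = B u - B v"
proof -
  show a: "A (x + y) = A x + A y" "A (sp r x) = sp r (A x)"
    "B (u + v) = B u + B v" "B (sm r u) = sm r (B u)"
    "A (Tp x u z) = Tp (A x) u z + Tp x (B u) z + Tp x u (A z)"
    "B (Tm u x v) = Tm (B u) x v + Tm u (A x) v + Tm u x (B v)" for x y u v r z
    using assms unfolding derivation_pair_def by blast+
  show z: "A 0 = 0" "B 0 = 0" using a(1)[of 0 0] a(3)[of 0 0] by simp_all
  show n: "A (- x) = - A x" "B (- u) = - B u" for x u
    using a(2)[of "- 1" x] a(4)[of "- 1" u] by simp_all
  show "A (x - y) = A x - A y" "B (u - v) = B u - B v"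
    using a(1)[of x "- y"] a(3)[of u "- v"] n by simp_all
qed

definition comm0 ::
  "('v \<Rightarrow> 'v) \<times> ('w \<Rightarrow> 'w) \<Rightarrow> ('v \<Rightarrow> 'v) \<times> ('w \<Rightarrow> 'w) \<Rightarrow> ('v \<Rightarrow> 'v) \<times> ('w \<Rightarrow> 'w)" where
  "comm0 X Y = (\<lambda>z. fst X (fst Y z) - fst Y (fst X z), \<lambda>z. snd X (snd Y z) - snd Y (snd X z))"

text \<open>Immediate from the derivation property. Commutators with inner derivations are therefore
  again inner, which closes the span under commutators (\<open>comm0_closed\<close>).\<close>

lemma comm0_inner_D:
  assumes "derivation_pair A B"
  shows "comm0 (A, B) (inner_D V x y) = inner_D V (A x) y + inner_D V x (B y)"
  by (simp add: comm0_def inner_D_def fun_eq_iff derivation_pairD[OF assms] algebra_simps)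

lemma comm0_add:
  assumes "derivation_pair A B"
  shows "comm0 (A, B) (X + Y) = comm0 (A, B) X + comm0 (A, B) Y"
  by (simp add: comm0_def fun_eq_iff derivation_pairD[OF assms] algebra_simps)

lemma comm0_scale:
  assumes "derivation_pair A B"
  shows "comm0 (A, B) (end_smult V r X) = end_smult V r (comm0 (A, B) X)"
  by (cases X) (simp add: comm0_def end_smult_apply fun_eq_iff derivation_pairD[OF assms]
      scale_distrib)

lemma comm0_euler0:
  assumes "derivation_pair A B"
  shows "comm0 (A, B) euler0 = 0"
  by (simp add: comm0_def fun_eq_iff zero_prod_def derivation_pairD[OF assms])

lemma comm0_zero:
  assumes "derivation_pair A B"
  shows "comm0 (A, B) 0 = 0" "comm0 0 (A, B) = 0"
  by (simp_all add: comm0_def fun_eq_iff zero_prod_def derivation_pairD[OF assms])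

lemma comm0_skew: "comm0 X Y = - comm0 Y X"
  by (simp add: comm0_def fun_eq_iff)

lemma comm0_closed:
  assumes AB: "X \<in> tkk0 V" and "Y \<in> tkk0 V"
  shows "comm0 X Y \<in> tkk0 V"
proof -
  obtain A B where X: "X = (A, B)" by (cases X)
  note d = derivation_pair_tkk0[OF AB[unfolded X]]
  show ?thesis unfolding X using assms(2)
  proof (induction Y rule: tkk0_induct)
    case zero
    show ?case by (simp add: comm0_zero[OF d] tkk0_closed)
  next
    case (add r S Y)
    have "comm0 (A, B) S \<in> tkk0 V"
      using add(1) by (auto simp: comm0_euler0[OF d] comm0_inner_D[OF d] tkk0_closed)
    then show ?case using add(2) by (simp add: comm0_add[OF d] comm0_scale[OF d] tkk0_closed)
  qed
qed

text \<open>The bracket of the 3-graded Lie algebra. It is restated here because in \<open>tkk_bracket\<close> the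
  \<open>g\<^sub>0\<close>-commutator is written without parentheses, and there \<open>A \<circ> A' - A' \<circ> A\<close> is
  read as \<open>A \<circ> (A' - A') \<circ> A\<close>. The two agree when one argument has no \<open>g\<^sub>0\<close>-component, hence in
  \<open>exp_p\<close> and \<open>exp_m\<close>.\<close>

definition lie :: "('v, 'w) tkk \<Rightarrow> ('v, 'w) tkk \<Rightarrow> ('v, 'w) tkk" where
  "lie X Y = (case (X, Y) of ((x, AB, y), (x', AB', y')) \<Rightarrow>
     (fst AB x' - fst AB' x, comm0 AB AB' + inner_D V x y' - inner_D V x' y,
      snd AB y' - snd AB' y))"

lemma lie_apply:
  "lie (x, (A, B), y) (x', (A', B'), y') =
     (A x' - A' x, comm0 (A, B) (A', B') + inner_D V x y' - inner_D V x' y, B y' - B' y)"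
  by (simp add: lie_def)

lemma inner_D_simps [simp]:
  "inner_D V 0 y = 0" "inner_D V x 0 = 0"
  "inner_D V (- x) y = - inner_D V x y" "inner_D V x (- y) = - inner_D V x y"
  "inner_D V (sp r x) y = end_smult V r (inner_D V x y)"
  "inner_D V x (sm r y) = end_smult V r (inner_D V x y)"
  by (auto simp: inner_D_def fun_eq_iff zero_prod_def end_smult_apply)

lemma inner_D_add:
  "inner_D V (x + x') y = inner_D V x y + inner_D V x' y"
  "inner_D V x (y + y') = inner_D V x y + inner_D V x y'"
  "inner_D V (x - x') y = inner_D V x y - inner_D V x' y"
  "inner_D V x (y - y') = inner_D V x y - inner_D V x y'"
  by (auto simp: inner_D_def fun_eq_iff T_add T_diff)

text \<open>\<open>ad x\<close> sends \<open>t\<close> in \<open>g_-1\<close> to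
  \<open>D(x, t)\<close>, sends \<open>(A, B)\<close> to \<open>- A x\<close> and kills
  \<open>g_1\<close>, so its square is \<open>t \<mapsto> - T(x, t, x)\<close>. Later computations
  with exponentials go through this form and its dual.\<close>

lemma exp_p_apply:
  assumes "(z, (A, B), t) \<in> tkk V"
  shows "exp_p V x (z, (A, B), t) =
    (z - A x - sp half (Tp x t x), (A, B) + inner_D V x t, t)"
proof -
  have "(A, B) \<in> tkk0 V" using assms by (simp add: tkk_def)
  note d = derivation_pairD[OF derivation_pair_tkk0[OF this]]
  show ?thesis using assms
    by (simp add: exp_p_def exp_ad_def tkk_smult_def zero_prod_def inner_D_def end_smult_apply
        fun_eq_iff d algebra_simps)
qed

lemma exp_m_apply:
  assumes "(z, (A, B), t) \<in> tkk V"
  shows "exp_m V y (z, (A, B), t) =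
    (z, (A, B) - inner_D V z y, t - B y - sm half (Tm y z y))"
proof -
  have "(A, B) \<in> tkk0 V" using assms by (simp add: tkk_def)
  note d = derivation_pairD[OF derivation_pair_tkk0[OF this]]
  show ?thesis using assms
    by (simp add: exp_m_def exp_ad_def tkk_smult_def zero_prod_def inner_D_def end_smult_apply
        fun_eq_iff d algebra_simps)
qed

lemma tkk_iff: "(z, AB, t) \<in> tkk V \<longleftrightarrow> AB \<in> tkk0 V"
  by (simp add: tkk_def)

lemma exp_apply:
  assumes "AB \<in> tkk0 V"
  shows "exp_p V x (z, AB, t) = (z - fst AB x - sp half (Tp x t x), AB + inner_D V x t, t)"
    "exp_m V y (z, AB, t) = (z, AB - inner_D V z y, t - snd AB y - sm half (Tm y z y))"
  using exp_p_apply[of z "fst AB" "snd AB" t x] exp_m_apply[of z "fst AB" "snd AB" t y] assms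
  by (simp_all add: tkk_iff)

lemma tkk_closed:
  "X \<in> tkk V \<Longrightarrow> Y \<in> tkk V \<Longrightarrow> X + Y \<in> tkk V"
  "X \<in> tkk V \<Longrightarrow> Y \<in> tkk V \<Longrightarrow> X - Y \<in> tkk V"
  "X \<in> tkk V \<Longrightarrow> - X \<in> tkk V"
  "X \<in> tkk V \<Longrightarrow> tkk_smult V r X \<in> tkk V"
  "X \<in> tkk V \<Longrightarrow> Y \<in> tkk V \<Longrightarrow> lie X Y \<in> tkk V"
  by (simp_all add: tkk_def mem_Times_iff tkk_smult_def lie_def split_beta tkk0_closed comm0_closed)

lemma tkk_bracket_eq_lie:
  assumes "X \<in> grade_p V \<or> X \<in> grade_m V" "Z \<in> tkk V"
  shows "tkk_bracket V X Z = lie X Z"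
proof -
  obtain z A B t where Z: "Z = (z, (A, B), t)" by (metis prod.exhaust)
  have "(A, B) \<in> tkk0 V" using assms(2) by (simp add: tkk_def Z)
  note d = derivation_pair_tkk0[OF this]
  \<comment> \<open>The \<open>g_0\<close>-entry of \<open>tkk_bracket\<close>, as parsed, is
    \<open>0 \<circ> (A - A) \<circ> 0\<close> here, which agrees with the commutator of 0 and
    \<open>A\<close>.\<close>
  have *: "((0::'v \<Rightarrow> 'v) \<circ> F \<circ> (0::'v \<Rightarrow> 'v)) = 0" "((0::'w \<Rightarrow> 'w) \<circ> F' \<circ> (0::'w \<Rightarrow> 'w)) = 0"
    for F F' by (simp_all add: fun_eq_iff)
  consider x where "X = (x, (0, 0), 0)" | y where "X = (0, (0, 0), y)"
    using assms(1) by (auto simp: grade_p_def grade_m_def zero_prod_def)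
  then show ?thesis
    by cases (simp_all add: Z lie_apply comm0_zero[OF d, unfolded zero_prod_def] *
        derivation_pairD[OF d])
qed

text \<open>Puts the genuine Lie bracket, which automorphisms preserve, into the exponential; this
  is what \<open>aut_exp_ad\<close> needs.\<close>

lemma exp_ad_lie:
  assumes "X \<in> grade_p V \<or> X \<in> grade_m V" "Z \<in> tkk V"
  shows "exp_ad V X Z = Z + lie X Z + tkk_smult V half (lie X (lie X Z))"
proof -
  have "X \<in> tkk V" using assms(1) tkk0_closed(1) by (auto simp: grade_p_def grade_m_def tkk_def)
  then show ?thesis
    using assms by (simp add: exp_ad_def tkk_bracket_eq_lie tkk_closed)
qed

section \<open>Automorphisms of the Lie algebra; exponentials respect the bracket\<close>

definition aut :: "(('v, 'w) tkk \<Rightarrow> ('v, 'w) tkk) set" where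
  "aut = {f \<in> Bij (tkk V). \<forall>X \<in> tkk V. \<forall>Y \<in> tkk V.
     f (X + Y) = f X + f Y \<and> (\<forall>r. f (tkk_smult V r X) = tkk_smult V r (f X)) \<and>
     f (lie X Y) = lie (f X) (f Y)}"

lemma end_smult_add: "end_smult V r (X + Y) = end_smult V r X + end_smult V r Y"
  "end_smult V r (X - Y) = end_smult V r X - end_smult V r Y"
  by (cases X; cases Y; simp add: end_smult_apply scale_distrib fun_eq_iff)+

lemma end_half: "end_smult V half (X + X) = X"
  by (cases X; simp add: end_smult_apply double_half fun_eq_iff)

text \<open>\<open>comm0_inner_D\<close> gives expressions that are not visibly skew. Subtracting
  the same expression with the two arguments exchanged cancels the terms with
  \<open>T(t, x, t')\<close>, respectively \<open>T(x, t, x')\<close>, and leaves twice the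
  commutator in terms of quadratic maps.\<close>

lemma comm0_inner_D_inner_D:
  "comm0 (inner_D V x t) (inner_D V x t') =
     inner_D V (sp half (Tp x t x)) t' - inner_D V (sp half (Tp x t' x)) t"
  "comm0 (inner_D V x t) (inner_D V x' t) =
     inner_D V x (sm half (Tm t x' t)) - inner_D V x' (sm half (Tm t x t))"
proof -
  have *: "comm0 (inner_D V x t) (inner_D V x' t') =
      inner_D V (Tp x t x') t' - inner_D V x' (Tm t x t')" for x t x' t'
    using comm0_inner_D[OF derivation_pair_inner[of x t], folded inner_D_def, of x' t'] by simp
  have "comm0 (inner_D V x t) (inner_D V x t') + comm0 (inner_D V x t) (inner_D V x t') =
      comm0 (inner_D V x t) (inner_D V x t') - comm0 (inner_D V x t') (inner_D V x t)"
    by (subst (2) comm0_skew) simp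
  also have "\<dots> = inner_D V (Tp x t x) t' - inner_D V (Tp x t' x) t"
    unfolding * Tm_sym[of t' x t] by simp
  finally have 1: "end_smult V half (comm0 (inner_D V x t) (inner_D V x t') +
      comm0 (inner_D V x t) (inner_D V x t')) = end_smult V half (inner_D V (Tp x t x) t' - inner_D V (Tp x t' x) t)"
    by simp
  have "comm0 (inner_D V x t) (inner_D V x' t) + comm0 (inner_D V x t) (inner_D V x' t) =
      comm0 (inner_D V x t) (inner_D V x' t) - comm0 (inner_D V x' t) (inner_D V x t)"
    by (subst (2) comm0_skew) simp
  also have "\<dots> = inner_D V x (Tm t x' t) - inner_D V x' (Tm t x t)"
    unfolding * Tp_sym[of x' t x] by simp
  finally have 2: "end_smult V half (comm0 (inner_D V x t) (inner_D V x' t) +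
      comm0 (inner_D V x t) (inner_D V x' t)) = end_smult V half (inner_D V x (Tm t x' t) - inner_D V x' (Tm t x t))"
    by simp
  show "comm0 (inner_D V x t) (inner_D V x t') =
     inner_D V (sp half (Tp x t x)) t' - inner_D V (sp half (Tp x t' x)) t"
    "comm0 (inner_D V x t) (inner_D V x' t) =
     inner_D V x (sm half (Tm t x' t)) - inner_D V x' (sm half (Tm t x t))"
    using 1 2 unfolding end_half by (simp_all add: end_smult_add)
qed

lemma comm0_linear:
  assumes "X \<in> tkk0 V"
  shows "comm0 X (Y + Z) = comm0 X Y + comm0 X Z" "comm0 X (Y - Z) = comm0 X Y - comm0 X Z"
    "comm0 (Y + Z) X = comm0 Y X + comm0 Z X" "comm0 (Y - Z) X = comm0 Y X - comm0 Z X"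
proof -
  have d: "derivation_pair (fst X) (snd X)" using assms by (simp add: derivation_pair_tkk0)
  show "comm0 X (Y + Z) = comm0 X Y + comm0 X Z" "comm0 X (Y - Z) = comm0 X Y - comm0 X Z"
    "comm0 (Y + Z) X = comm0 Y X + comm0 Z X" "comm0 (Y - Z) X = comm0 Y X - comm0 Z X"
    by (auto simp: comm0_def fun_eq_iff derivation_pairD[OF d] algebra_simps)
qed

text \<open>Checked degree by degree. Degree -1 is the symmetry of the triple product, degree 0 the
  formulas for commutators of inner derivations; in degree 1 the terms quadratic in \<open>x\<close>
  match by the derivation property and the cubic ones by \<open>Tp_commute\<close>.\<close>

lemma exp_p_lie:
  assumes "X \<in> tkk V" "Y \<in> tkk V"
  shows "exp_p V x (lie X Y) = lie (exp_p V x X) (exp_p V x Y)"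
proof -
  obtain z A B t z' A' B' t' where X: "X = (z, (A, B), t)" and Y: "Y = (z', (A', B'), t')"
    by (metis prod.exhaust)
  have AB: "(A, B) \<in> tkk0 V" "(A', B') \<in> tkk0 V" using assms by (simp_all add: X Y tkk_iff)
  note d = derivation_pair_tkk0[OF AB(1)] and d' = derivation_pair_tkk0[OF AB(2)]
  note D = derivation_pairD[OF d] and D' = derivation_pairD[OF d']
  define M where "M = comm0 (A, B) (A', B') + inner_D V z t' - inner_D V z' t"
  have L: "lie X Y = (A z' - A' z, M, B t' - B' t)" by (simp add: X Y lie_apply M_def)
  have M: "(fst M, snd M) \<in> tkk0 V" using tkk_closed(5)[OF assms] by (simp add: L tkk_iff)
  have fM: "fst M x = A (A' x) - A' (A x) + Tp z t' x - Tp z' t x"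
    by (simp add: M_def comm0_def inner_D_def)
  have eL: "exp_p V x (lie X Y) = (A z' - A' z - fst M x - sp half (Tp x (B t' - B' t) x),
      M + inner_D V x (B t' - B' t), B t' - B' t)"
    using exp_p_apply[of _ "fst M" "snd M"] M by (simp add: L tkk_iff)
  define N N' where "N = (A, B) + inner_D V x t" and "N' = (A', B') + inner_D V x t'"
  have N0: "N \<in> tkk0 V" using AB(1) by (simp add: N_def tkk0_closed)
  have N: "fst N u = A u + Tp x t u" "snd N v = B v - Tm t x v"
    "fst N' u = A' u + Tp x t' u" "snd N' v = B' v - Tm t' x v" for u v
    by (simp_all add: N_def N'_def inner_D_def)
  have e: "exp_p V x X = (z - A x - sp half (Tp x t x), N, t)"
    "exp_p V x Y = (z' - A' x - sp half (Tp x t' x), N', t')"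
    using assms by (simp_all add: X Y exp_p_apply N_def N'_def)
  have c: "comm0 N N' = comm0 (A, B) (A', B') + comm0 (A, B) (inner_D V x t')
      - comm0 (A', B') (inner_D V x t) + comm0 (inner_D V x t) (inner_D V x t')"
  proof -
    have "comm0 N N' = comm0 N (A', B') + comm0 N (inner_D V x t')"
      unfolding N'_def using N0 by (rule comm0_linear)
    also have "\<dots> = comm0 (A, B) (A', B') + comm0 (inner_D V x t) (A', B')
        + (comm0 (A, B) (inner_D V x t') + comm0 (inner_D V x t) (inner_D V x t'))"
      unfolding N_def using comm0_linear(3)[OF AB(2)] comm0_linear(3)[OF tkk0_closed(7)] by simp
    finally show ?thesis using comm0_skew[of "inner_D V x t" "(A', B')"] by simp
  qed
  have 0: "comm0 N N' + inner_D V (z - A x - sp half (Tp x t x)) t'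
      - inner_D V (z' - A' x - sp half (Tp x t' x)) t = M + inner_D V x (B t' - B' t)"
    unfolding c M_def comm0_inner_D[OF d] comm0_inner_D[OF d'] comm0_inner_D_inner_D inner_D_add
    by (simp add: algebra_simps)
  have m: "snd N t' - snd N' t = B t' - B' t"
    by (simp add: N Tm_sym[of t' x t])
  \<comment> \<open>Differentiating the quadratic map of \<open>x\<close> produces two halves that
    coincide by symmetry.\<close>
  have h: "sp half (Tp x s (C x)) + sp half (Tp (C x) s x) = Tp x s (C x)" for s C
    using half_add(1) by (simp add: Tp_sym[of "C x" s x])
  have p: "fst N (z' - A' x - sp half (Tp x t' x)) - fst N' (z - A x - sp half (Tp x t x))
      = A z' - A' z - fst M x - sp half (Tp x (B t' - B' t) x)"
  proof -
    have q: "A (sp half (Tp x t' x)) = Tp x t' (A x) + sp half (Tp x (B t') x)"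
      "A' (sp half (Tp x t x)) = Tp x t (A' x) + sp half (Tp x (B' t) x)"
      using h[of t' A] h[of t A'] by (simp_all add: D D' scale_distrib algebra_simps)
    show ?thesis
      unfolding N fM
      by (simp add: D(11,12) D'(11,12) q T_diff scale_distrib Tp_commute[of x t t'] Tp_sym[of x t' z] Tp_sym[of x t z'])
  qed
  show ?thesis
    unfolding eL e using 0 m p by (simp add: lie_def)
qed

lemma exp_m_lie:
  assumes "X \<in> tkk V" "Y \<in> tkk V"
  shows "exp_m V y (lie X Y) = lie (exp_m V y X) (exp_m V y Y)"
proof -
  obtain z A B t z' A' B' t' where X: "X = (z, (A, B), t)" and Y: "Y = (z', (A', B'), t')"
    by (metis prod.exhaust)
  have AB: "(A, B) \<in> tkk0 V" "(A', B') \<in> tkk0 V" using assms by (simp_all add: X Y tkk_iff)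
  note d = derivation_pair_tkk0[OF AB(1)] and d' = derivation_pair_tkk0[OF AB(2)]
  note D = derivation_pairD[OF d] and D' = derivation_pairD[OF d']
  define M where "M = comm0 (A, B) (A', B') + inner_D V z t' - inner_D V z' t"
  have L: "lie X Y = (A z' - A' z, M, B t' - B' t)" by (simp add: X Y lie_apply M_def)
  have M: "(fst M, snd M) \<in> tkk0 V" using tkk_closed(5)[OF assms] by (simp add: L tkk_iff)
  have fM: "snd M y = B (B' y) - B' (B y) - Tm t' z y + Tm t z' y"
    by (simp add: M_def comm0_def inner_D_def)
  have eL: "exp_m V y (lie X Y) = (A z' - A' z, M - inner_D V (A z' - A' z) y,
      B t' - B' t - snd M y - sm half (Tm y (A z' - A' z) y))"
    using exp_m_apply[of _ "fst M" "snd M"] M by (simp add: L tkk_iff)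
  define N N' where "N = (A, B) - inner_D V z y" and "N' = (A', B') - inner_D V z' y"
  have N0: "N \<in> tkk0 V" using AB(1) by (simp add: N_def tkk0_closed)
  have N: "fst N u = A u - Tp z y u" "snd N v = B v + Tm y z v"
    "fst N' u = A' u - Tp z' y u" "snd N' v = B' v + Tm y z' v" for u v
    by (simp_all add: N_def N'_def inner_D_def)
  have e: "exp_m V y X = (z, N, t - B y - sm half (Tm y z y))"
    "exp_m V y Y = (z', N', t' - B' y - sm half (Tm y z' y))"
    using assms by (simp_all add: X Y exp_m_apply N_def N'_def)
  have c: "comm0 N N' = comm0 (A, B) (A', B') - comm0 (A, B) (inner_D V z' y)
      + comm0 (A', B') (inner_D V z y) + comm0 (inner_D V z y) (inner_D V z' y)"
  proof -
    have "comm0 N N' = comm0 N (A', B') - comm0 N (inner_D V z' y)"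
      unfolding N'_def using N0 by (rule comm0_linear)
    also have "\<dots> = comm0 (A, B) (A', B') - comm0 (inner_D V z y) (A', B')
        - (comm0 (A, B) (inner_D V z' y) - comm0 (inner_D V z y) (inner_D V z' y))"
      unfolding N_def using comm0_linear(4)[OF AB(2)] comm0_linear(4)[OF tkk0_closed(7)] by simp
    finally show ?thesis using comm0_skew[of "inner_D V z y" "(A', B')"] by simp
  qed
  have 0: "comm0 N N' + inner_D V z (t' - B' y - sm half (Tm y z' y))
      - inner_D V z' (t - B y - sm half (Tm y z y)) = M - inner_D V (A z' - A' z) y"
    unfolding c M_def comm0_inner_D[OF d] comm0_inner_D[OF d'] comm0_inner_D_inner_D inner_D_add
    by (simp add: algebra_simps)
  have m: "fst N z' - fst N' z = A z' - A' z"
    by (simp add: N Tp_sym[of z' y z])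
  have h: "sm half (Tm y s (C y)) + sm half (Tm (C y) s y) = Tm y s (C y)" for s C
    using half_add(2) by (simp add: Tm_sym[of "C y" s y])
  have p: "snd N (t' - B' y - sm half (Tm y z' y)) - snd N' (t - B y - sm half (Tm y z y))
      = B t' - B' t - snd M y - sm half (Tm y (A z' - A' z) y)"
  proof -
    have q: "B (sm half (Tm y z' y)) = Tm y z' (B y) + sm half (Tm y (A z') y)"
      "B' (sm half (Tm y z y)) = Tm y z (B' y) + sm half (Tm y (A' z) y)"
      using h[of z' B] h[of z B'] by (simp_all add: D D' scale_distrib algebra_simps)
    show ?thesis
      unfolding N fM
      by (simp add: D(11,12) D'(11,12) q T_diff scale_distrib Tm_commute[of y z z'] Tm_sym[of y z' t] Tm_sym[of y z t'])
  qed
  show ?thesis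
    unfolding eL e using 0 m p by (simp add: lie_def)
qed

subsection \<open>Automorphisms and the Euler element\<close>

abbreviation mul (infixl "\<cdot>" 70) where "f \<cdot> g \<equiv> f \<otimes>\<^bsub>tkk_bij V\<^esub> g"
abbreviation gone ("\<^bold>1") where "\<^bold>1 \<equiv> \<one>\<^bsub>tkk_bij V\<^esub>"
abbreviation ginv where "ginv f \<equiv> inv\<^bsub>tkk_bij V\<^esub> f"
abbreviation act (infixr "\<star>" 65) where "g \<star> z \<equiv> g <#\<^bsub>tkk_bij V\<^esub> z"
abbreviation "ep \<equiv> exp_p V"
abbreviation "em \<equiv> exp_m V"
abbreviation "G \<equiv> elem_grp V"

sublocale Bij: group "tkk_bij V" by (rule group_BijGroup)

lemma carrier_Bij: "carrier (tkk_bij V) = Bij (tkk V)"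
  by (simp add: BijGroup_def)

lemma mul_apply [simp]:
  "f \<in> Bij (tkk V) \<Longrightarrow> g \<in> Bij (tkk V) \<Longrightarrow> z \<in> tkk V \<Longrightarrow> (f \<cdot> g) z = f (g z)"
  by (simp add: BijGroup_def compose_def)

lemma gone_apply [simp]: "z \<in> tkk V \<Longrightarrow> \<^bold>1 z = z"
  by (simp add: BijGroup_def)

lemma Bij_closed: "f \<in> Bij (tkk V) \<Longrightarrow> z \<in> tkk V \<Longrightarrow> f z \<in> tkk V"
  by (auto simp: Bij_def bij_betw_def)

lemma Bij_eqI:
  assumes "f \<in> Bij (tkk V)" "g \<in> Bij (tkk V)" "\<And>z. z \<in> tkk V \<Longrightarrow> f z = g z"
  shows "f = g"
  using assms by (intro extensionalityI[of f "tkk V" g]) (auto simp: Bij_def)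

lemma ginv_apply:
  assumes "f \<in> Bij (tkk V)" "z \<in> tkk V"
  shows "f (ginv f z) = z" "ginv f (f z) = z"
proof -
  have "ginv f \<in> Bij (tkk V)" using assms(1) Bij.inv_closed by (simp add: carrier_Bij)
  then show "f (ginv f z) = z" "ginv f (f z) = z"
    using mul_apply[of f "ginv f" z] mul_apply[of "ginv f" f z] assms
    by (simp_all add: carrier_Bij Bij.r_inv Bij.l_inv del: mul_apply)
qed

lemma exp_p_exp_p:
  assumes "Z \<in> tkk V" shows "ep x (ep x' Z) = ep (x + x') Z"
proof -
  obtain z A B t where Z: "Z = (z, (A, B), t)" by (metis prod.exhaust)
  have AB: "(A, B) \<in> tkk0 V" using assms by (simp add: tkk_iff Z)
  note d = derivation_pairD[OF derivation_pair_tkk0[OF AB]]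
  let ?N = "(A, B) + inner_D V x' t"
  have N: "?N \<in> tkk0 V" using AB by (rule tkk0_closed) (rule tkk0_closed)
  have *: "ep x (z', ?N, t) = (z' - fst ?N x - sp half (Tp x t x), ?N + inner_D V x t, t)" for z'
    using N by (rule exp_apply)
  have "Tp x' t x = sp half (Tp x' t x) + sp half (Tp x' t x)" by (simp add: half_add)
  then show ?thesis
    unfolding Z exp_p_apply[OF assms[unfolded Z]] *
    by (simp add: inner_D_add T_add scale_distrib d Tp_sym[of x t x'] algebra_simps)
      (simp add: inner_D_def)
qed

lemma exp_m_exp_m:
  assumes "Z \<in> tkk V" shows "em y (em y' Z) = em (y + y') Z"
proof -
  obtain z A B t where Z: "Z = (z, (A, B), t)" by (metis prod.exhaust)
  have AB: "(A, B) \<in> tkk0 V" using assms by (simp add: tkk_iff Z)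
  note d = derivation_pairD[OF derivation_pair_tkk0[OF AB]]
  let ?N = "(A, B) - inner_D V z y'"
  have N: "?N \<in> tkk0 V" using AB by (rule tkk0_closed) (rule tkk0_closed)
  have *: "em y (z, ?N, t') = (z, ?N - inner_D V z y, t' - snd ?N y - sm half (Tm y z y))" for t'
    using N by (rule exp_apply)
  have "Tm y' z y = sm half (Tm y' z y) + sm half (Tm y' z y)" by (simp add: half_add)
  then show ?thesis
    unfolding Z exp_m_apply[OF assms[unfolded Z]] *
    by (simp add: inner_D_add T_add scale_distrib d Tm_sym[of y z y'] algebra_simps)
      (simp add: inner_D_def)
qed

lemma exp_zero: "Z \<in> tkk V \<Longrightarrow> ep 0 Z = Z" "Z \<in> tkk V \<Longrightarrow> em 0 Z = Z"
proof -
  obtain z A B t where Z: "Z = (z, (A, B), t)" by (metis prod.exhaust)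
  assume Z': "Z \<in> tkk V"
  then have AB: "(A, B) \<in> tkk0 V" by (simp add: tkk_iff Z)
  note d = derivation_pairD[OF derivation_pair_tkk0[OF AB]]
  show "ep 0 Z = Z" "em 0 Z = Z"
    using Z' unfolding Z by (simp_all add: exp_p_apply exp_m_apply d)
qed

lemma exp_closed:
  assumes "Z \<in> tkk V" shows "ep x Z \<in> tkk V" "em y Z \<in> tkk V"
proof -
  obtain z A B t where Z: "Z = (z, (A, B), t)" by (metis prod.exhaust)
  then have "(A, B) \<in> tkk0 V" using assms by (simp add: tkk_iff)
  from tkk0_closed(2,3)[OF this tkk0_closed(7)]
  show "ep x Z \<in> tkk V" "em y Z \<in> tkk V"
    using assms unfolding Z by (simp_all add: exp_p_apply exp_m_apply tkk_iff)
qed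

lemma exp_Bij: "ep x \<in> Bij (tkk V)" "em y \<in> Bij (tkk V)"
proof -
  have "bij_betw (ep x) (tkk V) (tkk V)"
    by (rule bij_betw_byWitness[where f' = "ep (- x)"])
      (auto simp: exp_p_exp_p exp_zero exp_closed)
  moreover have "bij_betw (em y) (tkk V) (tkk V)"
    by (rule bij_betw_byWitness[where f' = "em (- y)"])
      (auto simp: exp_m_exp_m exp_zero exp_closed)
  ultimately show "ep x \<in> Bij (tkk V)" "em y \<in> Bij (tkk V)"
    by (auto simp: Bij_def exp_p_def exp_m_def exp_ad_def)
qed

lemma exp_mult: "ep x \<cdot> ep x' = ep (x + x')" "em y \<cdot> em y' = em (y + y')"
proof -
  have c: "ep x \<cdot> ep x' \<in> Bij (tkk V)" "em y \<cdot> em y' \<in> Bij (tkk V)"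
    using Bij.m_closed exp_Bij by (simp_all add: carrier_Bij)
  show "ep x \<cdot> ep x' = ep (x + x')"
    by (rule Bij_eqI[OF c(1) exp_Bij(1)]) (simp add: exp_Bij exp_p_exp_p)
  show "em y \<cdot> em y' = em (y + y')"
    by (rule Bij_eqI[OF c(2) exp_Bij(2)]) (simp add: exp_Bij exp_m_exp_m)
qed

lemma exp_zero_gone [simp]: "ep 0 = \<^bold>1" "em 0 = \<^bold>1"
proof -
  have "\<^bold>1 \<in> Bij (tkk V)" using Bij.one_closed by (simp add: carrier_Bij)
  then show "ep 0 = \<^bold>1" "em 0 = \<^bold>1"
    by (auto intro!: Bij_eqI simp: exp_Bij exp_zero)
qed

lemma exp_inv: "ginv (ep x) = ep (- x)" "ginv (em y) = em (- y)"
  using Bij.inv_equality[of "ep (- x)" "ep x"] Bij.inv_equality[of "em (- y)" "em y"]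
  by (simp_all add: exp_mult carrier_Bij exp_Bij)

section \<open>The elementary group inside the automorphism group\<close>

lemma autD:
  assumes "f \<in> aut"
  shows "f \<in> Bij (tkk V)"
    "X \<in> tkk V \<Longrightarrow> f X \<in> tkk V"
    "X \<in> tkk V \<Longrightarrow> Y \<in> tkk V \<Longrightarrow> f (X + Y) = f X + f Y"
    "X \<in> tkk V \<Longrightarrow> f (tkk_smult V r X) = tkk_smult V r (f X)"
    "X \<in> tkk V \<Longrightarrow> Y \<in> tkk V \<Longrightarrow> f (lie X Y) = lie (f X) (f Y)"
  using assms Bij_closed unfolding aut_def by blast+

lemma tkk_smult_minus_one: "tkk_smult V (- 1) X = - X"
  by (cases X, rename_tac a b c, case_tac b) (simp add: tkk_smult_def end_smult_apply fun_eq_iff)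

lemma aut_minus:
  assumes "f \<in> aut" "X \<in> tkk V" shows "f (- X) = - f X"
  using autD(4)[OF assms, of "- 1"] by (simp add: tkk_smult_minus_one)

lemma aut_ginv: assumes "f \<in> aut" shows "ginv f \<in> aut"
proof -
  note f = autD[OF assms]
  have b: "ginv f \<in> Bij (tkk V)" using f(1) Bij.inv_closed by (simp add: carrier_Bij)
  have eq: "ginv f Z = W" if "W \<in> tkk V" "Z = f W" for Z W
    using that ginv_apply(2)[OF f(1)] by simp
  show ?thesis unfolding aut_def
  proof (intro CollectI conjI ballI allI b)
    fix X Y assume XY: "X \<in> tkk V" "Y \<in> tkk V"
    note c = Bij_closed[OF b] and i = ginv_apply(1)[OF f(1)]
    show "ginv f (X + Y) = ginv f X + ginv f Y"
      by (rule eq) (simp_all add: XY c f i tkk_closed)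
    show "ginv f (tkk_smult V r X) = tkk_smult V r (ginv f X)" for r
      by (rule eq) (simp_all add: XY c f i tkk_closed)
    show "ginv f (lie X Y) = lie (ginv f X) (ginv f Y)"
      by (rule eq) (simp_all add: XY c f i tkk_closed)
  qed
qed

lemma aut_mul: assumes "f \<in> aut" "g \<in> aut" shows "f \<cdot> g \<in> aut"
proof -
  note f = autD[OF assms(1)] and g = autD[OF assms(2)]
  have "f \<cdot> g \<in> Bij (tkk V)" using f(1) g(1) Bij.m_closed by (simp add: carrier_Bij)
  then show ?thesis unfolding aut_def using f g by (simp add: tkk_closed)
qed

lemma subgroup_aut: "subgroup aut (tkk_bij V)"
proof
  show "aut \<subseteq> carrier (tkk_bij V)" by (auto simp: carrier_Bij aut_def)
  show "\<^bold>1 \<in> aut"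
    using Bij.one_closed by (auto simp: aut_def carrier_Bij tkk_closed)
qed (auto intro: aut_mul aut_ginv)

lemma exp_add:
  assumes "X \<in> tkk V" "Y \<in> tkk V"
  shows "ep x (X + Y) = ep x X + ep x Y" "em y (X + Y) = em y X + em y Y"
    "ep x (tkk_smult V r X) = tkk_smult V r (ep x X)" "em y (tkk_smult V r X) = tkk_smult V r (em y X)"
proof -
  obtain z A B t z' A' B' t' where X: "X = (z, (A, B), t)" and Y: "Y = (z', (A', B'), t')"
    by (metis prod.exhaust)
  have AB: "(A, B) \<in> tkk0 V" "(A', B') \<in> tkk0 V" using assms by (simp_all add: X Y tkk_iff)
  have AB': "(A + A', B + B') \<in> tkk0 V" using tkk0_closed(2)[OF AB] by simp
  have ABr: "(\<lambda>z. sp r (A z), \<lambda>z. sm r (B z)) \<in> tkk0 V"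
    using tkk0_closed(5)[OF AB(1)] by (simp add: end_smult_apply)
  show "ep x (X + Y) = ep x X + ep x Y" "em y (X + Y) = em y X + em y Y"
    unfolding X Y using AB AB'
    by (simp_all add: exp_p_apply exp_m_apply tkk_iff T_add inner_D_add scale_distrib algebra_simps)
  show "ep x (tkk_smult V r X) = tkk_smult V r (ep x X)" "em y (tkk_smult V r X) = tkk_smult V r (em y X)"
    unfolding X using AB ABr
    by (simp_all add: exp_p_apply exp_m_apply tkk_iff tkk_smult_def end_smult_apply end_smult_add
        scale_distrib mult.commute)
qed

lemma exp_aut: "ep x \<in> aut" "em y \<in> aut"
  using exp_Bij by (auto simp: aut_def exp_add exp_p_lie exp_m_lie)

lemma G_aut: "g \<in> G \<Longrightarrow> g \<in> aut"
  using Bij.generate_subgroup_incl[OF _ subgroup_aut, of "U_p V \<union> U_m V"] exp_aut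
  by (auto simp: elem_grp_def U_p_def U_m_def)

lemma subgroup_G: "subgroup G (tkk_bij V)"
  unfolding elem_grp_def
  by (rule Bij.generate_is_subgroup) (auto simp: U_p_def U_m_def carrier_Bij exp_Bij)

lemma exp_G [simp]: "ep x \<in> G" "em y \<in> G"
  by (auto simp: elem_grp_def U_p_def U_m_def intro: generate.incl)

lemma G_closed [simp]:
  "g \<in> G \<Longrightarrow> k \<in> G \<Longrightarrow> g \<cdot> k \<in> G" "g \<in> G \<Longrightarrow> ginv g \<in> G" "\<^bold>1 \<in> G"
  using subgroup_G by (auto simp: subgroup.m_closed subgroup.m_inv_closed subgroup.one_closed)

lemma G_carrier [simp]: "g \<in> G \<Longrightarrow> g \<in> carrier (tkk_bij V)"
  using subgroup_G by (simp add: subgroup.mem_carrier)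

lemma aut_carrier: "g \<in> aut \<Longrightarrow> g \<in> carrier (tkk_bij V)"
  using subgroup_aut by (simp add: subgroup.mem_carrier)

section \<open>The Euler element and the grading\<close>

abbreviation euler :: "('v, 'w) tkk" where "euler \<equiv> (0, euler0, 0)"

lemma euler_tkk [simp]: "euler \<in> tkk V"
  by (simp add: tkk_iff tkk0_closed)

lemma lie_euler: "X \<in> tkk V \<Longrightarrow> lie euler X = (fst X, 0, - snd (snd X))"
proof -
  assume X: "X \<in> tkk V"
  obtain z A B t where Z: "X = (z, (A, B), t)" by (metis prod.exhaust)
  have "derivation_pair A B" using X by (simp add: Z tkk_iff derivation_pair_tkk0)
  from comm0_euler0[OF this] comm0_skew[of euler0] derivation_pairD(7,8)[OF this]
  show ?thesis by (simp add: Z lie_apply)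
qed

text \<open>The graded parts are the eigenspaces of \<open>ad E\<close>; since 2 is invertible, the
  eigenvalues 1 and -1 are separated.\<close>

lemma grade_iff:
  "X \<in> grade_p V \<longleftrightarrow> X \<in> tkk V \<and> lie euler X = X"
  "X \<in> grade_m V \<longleftrightarrow> X \<in> tkk V \<and> lie euler X = - X"
  "X \<in> grade_0 V \<longleftrightarrow> X \<in> tkk V \<and> lie euler X = 0"
proof -
  obtain z AB t where X: "X = (z, AB, t)" by (metis prod.exhaust)
  have n: "(- a = a) = (a = 0)" for a :: 'w using double_eq_0_iff(2)[of a] by (metis eq_neg_iff_add_eq_0 neg_equal_0_iff_equal)
  have n': "(a = - a) = (a = 0)" for a :: 'v using double_eq_0_iff(1)[of a] by (metis eq_neg_iff_add_eq_0)
  have z: "(0::('v, 'w) tkk) = (0, 0, 0)" by (simp add: prod_eq_iff)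
  show "X \<in> grade_p V \<longleftrightarrow> X \<in> tkk V \<and> lie euler X = X"
    "X \<in> grade_m V \<longleftrightarrow> X \<in> tkk V \<and> lie euler X = - X"
    "X \<in> grade_0 V \<longleftrightarrow> X \<in> tkk V \<and> lie euler X = 0"
    by (auto simp: X lie_euler tkk_iff grade_p_def grade_m_def grade_0_def tkk0_closed n n' z)
qed

lemma zero_tkk [simp]: "0 \<in> tkk V"
  by (simp add: tkk_def mem_Times_iff tkk0_closed)

lemma grade_tkk [simp]: "(u, 0, 0) \<in> tkk V" "(0, 0, v) \<in> tkk V"
  by (simp_all add: tkk_iff tkk0_closed)

lemma aut_zero: assumes "f \<in> aut" shows "f 0 = 0"
  using autD(3)[OF assms, of 0 0] by simp

lemma exp_euler: "ep u euler = (- u, euler0, 0)" "em v euler = (0, euler0, v)"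
  by (simp_all add: exp_apply tkk0_closed)

lemma aut_fix_euler_grade:
  assumes "f \<in> aut" "f euler = euler"
  shows "X \<in> grade_p V \<Longrightarrow> f X \<in> grade_p V" "X \<in> grade_m V \<Longrightarrow> f X \<in> grade_m V"
    "X \<in> grade_0 V \<Longrightarrow> f X \<in> grade_0 V"
  using autD[OF assms(1)] aut_minus[OF assms(1)] aut_zero[OF assms(1)] assms(2)
  unfolding grade_iff by (metis euler_tkk)+

text \<open>If \<open>f E = - E\<close>, the eigenvalue of \<open>ad E\<close> on \<open>f X\<close>
  is the negative of that on \<open>X\<close>.\<close>

lemma aut_swap_euler_grade:
  assumes "f \<in> aut" "f euler = - euler"
  shows "X \<in> grade_p V \<Longrightarrow> f X \<in> grade_m V" "X \<in> grade_m V \<Longrightarrow> f X \<in> grade_p V"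
    "X \<in> grade_0 V \<Longrightarrow> f X \<in> grade_0 V"
proof -
  have e: "lie euler (f X) = - f (lie euler X)" if "X \<in> tkk V"
  proof -
    have "f (lie euler X) = lie (- euler) (f X)"
      using autD(5)[OF assms(1) euler_tkk that] assms(2) by simp
    also have "\<dots> = - lie euler (f X)"
    proof -
      have "- lie euler Y = lie (- euler) Y" if "Y \<in> tkk V" for Y
      proof -
        obtain z A B t where Z: "Y = (z, (A, B), t)" by (metis prod.exhaust)
        have "derivation_pair A B" using that by (simp add: Z tkk_iff derivation_pair_tkk0)
        from derivation_pairD[OF this] show ?thesis
          unfolding Z by (simp add: lie_def comm0_def fun_eq_iff)
      qed
      then show ?thesis using autD(2)[OF assms(1) that] by simp
    qed
    finally show ?thesis by simp
  qed
  show "X \<in> grade_p V \<Longrightarrow> f X \<in> grade_m V" "X \<in> grade_m V \<Longrightarrow> f X \<in> grade_p V"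
    "X \<in> grade_0 V \<Longrightarrow> f X \<in> grade_0 V"
    using autD(2)[OF assms(1)] aut_minus[OF assms(1)] aut_zero[OF assms(1)] e by (auto simp: grade_iff)
qed

lemma grade_p_iff: "X \<in> grade_p V \<longleftrightarrow> X = (fst X, 0, 0)" "X \<in> grade_m V \<longleftrightarrow> X = (0, 0, snd (snd X))"
  by (cases X; auto simp: grade_p_def grade_m_def)+

lemma grade_mem [simp]: "(u, 0, 0) \<in> grade_p V" "(0, 0, v) \<in> grade_m V"
  by (simp_all add: grade_p_def grade_m_def)

text \<open>If \<open>g\<close> preserves the graded parts, \<open>g E\<close> lies in
  \<open>g_0\<close> and acts on \<open>g(g_1) = g_1\<close> by 1 and on
  \<open>g(g_-1) = g_-1\<close> by -1; elements of \<open>g_0\<close> are pairs of maps, so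
  \<open>g E = E\<close>. Conversely both \<open>g\<close> and its inverse map each eigenspace of
  \<open>ad E\<close> into itself, so the images are equal.\<close>

lemma H_grp_iff: "g \<in> H_grp V \<longleftrightarrow> g \<in> G \<and> g euler = euler"
proof
  assume "g \<in> H_grp V"
  then have g: "g \<in> G" and gr: "g ` grade_p V = grade_p V" "g ` grade_0 V = grade_0 V"
    "g ` grade_m V = grade_m V" by (auto simp: H_grp_def)
  note a = autD[OF G_aut[OF g]]
  have "euler \<in> grade_0 V" by (simp add: grade_0_def tkk0_closed)
  then have "g euler \<in> grade_0 V" using gr(2) by blast
  then obtain A B where AB: "g euler = (0, (A, B), 0)" by (auto simp: grade_0_def)
  have "A u = u" for u
  proof -
    obtain X where X: "X \<in> grade_p V" "g X = (u, 0, 0)" using gr(1) grade_mem(1)[of u] by (metis imageE)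
    then have "lie (g euler) (u, 0, 0) = (u, 0, 0)" using a(5)[of euler X] by (simp add: grade_iff)
    then show ?thesis by (simp add: AB lie_def)
  qed
  moreover have "B v = - v" for v
  proof -
    obtain X where X: "X \<in> grade_m V" "g X = (0, 0, v)" using gr(3) grade_mem(2)[of v] by (metis imageE)
    then have "lie (g euler) (0, 0, v) = - (0, 0, v)"
      using a(5)[of euler X] aut_minus[OF G_aut[OF g], of X] by (simp add: grade_iff)
    then show ?thesis by (simp add: AB lie_def)
  qed
  ultimately show "g \<in> G \<and> g euler = euler" using g AB by (auto simp: fun_eq_iff)
next
  assume g: "g \<in> G \<and> g euler = euler"
  then have b: "g \<in> Bij (tkk V)" using autD(1) G_aut by blast
  have i: "ginv g \<in> G" "ginv g euler = euler"
    using g ginv_apply(2)[OF b, of euler] by simp_all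
  have gg: "g \<in> aut" "g euler = euler" using g G_aut by auto
  note f = aut_fix_euler_grade[OF gg]
  note f' = aut_fix_euler_grade[OF G_aut[OF i(1)] i(2)]
  have s: "S \<subseteq> g ` S" if "S \<subseteq> tkk V" "\<And>X. X \<in> S \<Longrightarrow> ginv g X \<in> S" for S
  proof
    fix X assume "X \<in> S"
    then show "X \<in> g ` S"
      using that ginv_apply(1)[OF b, of X] by (intro image_eqI[of _ _ "ginv g X"]) auto
  qed
  have t: "grade_p V \<subseteq> tkk V" "grade_m V \<subseteq> tkk V" "grade_0 V \<subseteq> tkk V"
    by (auto simp: grade_iff)
  have "grade_p V \<subseteq> g ` grade_p V" "grade_m V \<subseteq> g ` grade_m V" "grade_0 V \<subseteq> g ` grade_0 V"
    by (rule s[OF t(1) f'(1)] s[OF t(2) f'(2)] s[OF t(3) f'(3)]; assumption)+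
  moreover have "g ` grade_p V \<subseteq> grade_p V" "g ` grade_m V \<subseteq> grade_m V" "g ` grade_0 V \<subseteq> grade_0 V"
    using f by auto
  ultimately show "g \<in> H_grp V" unfolding H_grp_def using g by auto
qed

text \<open>\<open>exp(v) E = E + v\<close> for \<open>v\<close> in \<open>g_-1\<close>, so
  \<open>exp(-v) g\<close> fixes \<open>E\<close> as soon as \<open>g E = E + v\<close>.\<close>

lemma P_m_iff: "g \<in> P_m V \<longleftrightarrow> g \<in> G \<and> (\<exists>v. g euler = (0, euler0, v))"
proof
  assume "g \<in> P_m V"
  then obtain v h where h: "h \<in> G" "h euler = euler" and g: "g = em v \<cdot> h"
    by (auto simp: P_m_def U_m_def set_mult_def H_grp_iff)
  then have "g euler = (0, euler0, v)"
    using autD(1)[OF G_aut[OF h(1)]] by (simp add: exp_Bij exp_euler)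
  then show "g \<in> G \<and> (\<exists>v. g euler = (0, euler0, v))" using g h by auto
next
  assume "g \<in> G \<and> (\<exists>v. g euler = (0, euler0, v))"
  then obtain v where g: "g \<in> G" "g euler = (0, euler0, v)" by blast
  then have b: "g \<in> Bij (tkk V)" using autD(1) G_aut by blast
  have "(em (- v) \<cdot> g) euler = em (- v) (0, euler0, v)" using b g by (simp add: exp_Bij)
  also have "\<dots> = euler" by (simp add: exp_apply tkk0_closed)
  finally have "em (- v) \<cdot> g \<in> H_grp V" using g by (simp add: H_grp_iff)
  moreover have "em v \<cdot> (em (- v) \<cdot> g) = g"
    using g by (simp add: Bij.m_assoc[symmetric] exp_mult)
  ultimately show "g \<in> P_m V" unfolding P_m_def U_m_def set_mult_def
    by (intro UN_I[of "em v"] UN_I[of "em (- v) \<cdot> g"]) auto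
qed

text \<open>As for \<open>P_m_iff\<close>, but with the other sign: \<open>exp(u) E = E - u\<close>
  for \<open>u\<close> in \<open>g_1\<close>.\<close>

lemma P_p_iff: "g \<in> P_p V \<longleftrightarrow> g \<in> G \<and> (\<exists>u. g euler = (u, euler0, 0))"
proof
  assume "g \<in> P_p V"
  then obtain v h where h: "h \<in> G" "h euler = euler" and g: "g = ep v \<cdot> h"
    by (auto simp: P_p_def U_p_def set_mult_def H_grp_iff)
  then have "g euler = (- v, euler0, 0)"
    using autD(1)[OF G_aut[OF h(1)]] by (simp add: exp_Bij exp_euler)
  then show "g \<in> G \<and> (\<exists>u. g euler = (u, euler0, 0))" using g h by auto
next
  assume "g \<in> G \<and> (\<exists>u. g euler = (u, euler0, 0))"
  then obtain v where g: "g \<in> G" "g euler = (v, euler0, 0)" by blast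
  then have b: "g \<in> Bij (tkk V)" using autD(1) G_aut by blast
  have "(ep v \<cdot> g) euler = ep v (v, euler0, 0)" using b g by (simp add: exp_Bij)
  also have "\<dots> = euler" by (simp add: exp_apply tkk0_closed)
  finally have "ep v \<cdot> g \<in> H_grp V" using g by (simp add: H_grp_iff)
  moreover have "ep (- v) \<cdot> (ep v \<cdot> g) = g"
    using g by (simp add: Bij.m_assoc[symmetric] exp_mult)
  ultimately show "g \<in> P_p V" unfolding P_p_def U_p_def set_mult_def
    by (intro UN_I[of "ep (- v)"] UN_I[of "ep v \<cdot> g"]) auto
qed

section \<open>Moving automorphisms past exponentials\<close>

lemma aut_exp_ad:
  assumes "f \<in> aut" "X \<in> grade_p V \<or> X \<in> grade_m V" "f X \<in> grade_p V \<or> f X \<in> grade_m V" "Z \<in> tkk V"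
  shows "f (exp_ad V X Z) = exp_ad V (f X) (f Z)"
proof -
  have "X \<in> tkk V" using assms(2) by (auto simp: grade_iff)
  then show ?thesis
    using autD[OF assms(1)] assms(2-4) by (simp add: exp_ad_lie tkk_closed)
qed

lemma aut_conj:
  assumes f: "f \<in> aut" and e: "e \<in> Bij (tkk V)" "e' \<in> Bij (tkk V)"
    and "\<And>Z. Z \<in> tkk V \<Longrightarrow> f (e Z) = e' (f Z)"
  shows "f \<cdot> e = e' \<cdot> f"
proof (rule Bij_eqI)
  show "f \<cdot> e \<in> Bij (tkk V)" "e' \<cdot> f \<in> Bij (tkk V)"
    using autD(1)[OF f] e Bij.m_closed by (simp_all add: carrier_Bij)
qed (use autD(1)[OF f] e assms(4) in simp)

lemma aut_fix_euler_exp: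
  assumes "f \<in> aut" "f euler = euler"
  shows "f \<cdot> ep u = ep (fst (f (u, 0, 0))) \<cdot> f" "f \<cdot> em v = em (snd (snd (f (0, 0, v)))) \<cdot> f"
proof -
  note g = aut_fix_euler_grade[OF assms]
  have "f (u, 0, 0) = (fst (f (u, 0, 0)), 0, 0)" "f (0, 0, v) = (0, 0, snd (snd (f (0, 0, v))))"
    using g(1)[of "(u, 0, 0)"] g(2)[of "(0, 0, v)"] by (simp_all add: grade_p_iff)
  then show "f \<cdot> ep u = ep (fst (f (u, 0, 0))) \<cdot> f" "f \<cdot> em v = em (snd (snd (f (0, 0, v)))) \<cdot> f"
    using aut_exp_ad[OF assms(1), of "(u, 0, 0)"] aut_exp_ad[OF assms(1), of "(0, 0, v)"] g
    by (auto intro!: aut_conj simp: assms(1) exp_Bij) (auto simp: exp_p_def exp_m_def)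
qed

lemma aut_swap_euler_exp:
  assumes "f \<in> aut" "f euler = - euler"
  shows "f \<cdot> ep u = em (snd (snd (f (u, 0, 0)))) \<cdot> f" "f \<cdot> em v = ep (fst (f (0, 0, v))) \<cdot> f"
proof -
  note g = aut_swap_euler_grade[OF assms]
  have "f (u, 0, 0) = (0, 0, snd (snd (f (u, 0, 0))))" "f (0, 0, v) = (fst (f (0, 0, v)), 0, 0)"
    using g(1)[of "(u, 0, 0)"] g(2)[of "(0, 0, v)"] by (simp_all add: grade_p_iff)
  then show "f \<cdot> ep u = em (snd (snd (f (u, 0, 0)))) \<cdot> f" "f \<cdot> em v = ep (fst (f (0, 0, v))) \<cdot> f"
    using aut_exp_ad[OF assms(1), of "(u, 0, 0)"] aut_exp_ad[OF assms(1), of "(0, 0, v)"] g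
    by (auto intro!: aut_conj simp: assms(1) exp_Bij) (auto simp: exp_p_def exp_m_def)
qed

lemma aut_component_linear:
  assumes "f \<in> aut"
  shows "fst (f (sp r u + sp s u', 0, 0)) = sp r (fst (f (u, 0, 0))) + sp s (fst (f (u', 0, 0)))"
    "snd (snd (f (0, 0, sm r v + sm s v'))) = sm r (snd (snd (f (0, 0, v)))) + sm s (snd (snd (f (0, 0, v'))))"
    "snd (snd (f (sp r u + sp s u', 0, 0))) = sm r (snd (snd (f (u, 0, 0)))) + sm s (snd (snd (f (u', 0, 0))))"
    "fst (f (0, 0, sm r v + sm s v')) = sp r (fst (f (0, 0, v))) + sp s (fst (f (0, 0, v')))"
proof -
  have z: "end_smult V r 0 = 0" for r
    by (simp add: zero_prod_def end_smult_apply fun_eq_iff)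
  have a: "(sp r u + sp s u', 0, 0) = tkk_smult V r (u, 0, 0) + tkk_smult V s (u', 0, 0)"
    "(0, 0, sm r v + sm s v') = tkk_smult V r (0, 0, v) + tkk_smult V s (0, 0, v')"
    by (simp_all add: tkk_smult_def z)
  have t: "fst (tkk_smult V r X) = sp r (fst X)" "snd (snd (tkk_smult V r X)) = sm r (snd (snd X))" for r X
    by (simp_all add: tkk_smult_def split_beta)
  show "fst (f (sp r u + sp s u', 0, 0)) = sp r (fst (f (u, 0, 0))) + sp s (fst (f (u', 0, 0)))"
    "snd (snd (f (0, 0, sm r v + sm s v'))) = sm r (snd (snd (f (0, 0, v)))) + sm s (snd (snd (f (0, 0, v'))))"
    "snd (snd (f (sp r u + sp s u', 0, 0))) = sm r (snd (snd (f (u, 0, 0)))) + sm s (snd (snd (f (u', 0, 0))))"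
    "fst (f (0, 0, sm r v + sm s v')) = sp r (fst (f (0, 0, v))) + sp s (fst (f (0, 0, v')))"
    unfolding a using autD[OF assms] by (simp_all add: tkk_closed t)
qed

subsection \<open>Cosets and affine structures\<close>

lemma aut_diff:
  assumes "f \<in> aut" "X \<in> tkk V" "Y \<in> tkk V" shows "f (X - Y) = f X - f Y"
  using autD(3)[OF assms(1,2), of "- Y"] aut_minus[OF assms(1,3)] tkk_closed(3)[OF assms(3)] by simp

lemma Bij_G: "g \<in> G \<Longrightarrow> g \<in> Bij (tkk V)"
  using autD(1) G_aut by blast

lemma G_cancel [simp]:
  assumes "f \<in> G" "g \<in> G"
  shows "f \<cdot> (ginv f \<cdot> g) = g" "ginv f \<cdot> (f \<cdot> g) = g"
  using assms by (simp_all add: Bij.m_assoc[symmetric] Bij.r_inv Bij.l_inv)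

lemma G_inv_simps [simp]:
  assumes "f \<in> G"
  shows "ginv f \<cdot> f = \<^bold>1" "f \<cdot> ginv f = \<^bold>1" "ginv (ginv f) = f" "\<^bold>1 \<cdot> f = f" "f \<cdot> \<^bold>1 = f"
  using assms by (simp_all add: Bij.r_inv Bij.l_inv)

lemma G_assoc: "f \<in> G \<Longrightarrow> g \<in> G \<Longrightarrow> k \<in> G \<Longrightarrow> f \<cdot> g \<cdot> k = f \<cdot> (g \<cdot> k)"
  by (simp add: Bij.m_assoc)

lemma G_inv_mult: "f \<in> G \<Longrightarrow> g \<in> G \<Longrightarrow> ginv (f \<cdot> g) = ginv g \<cdot> ginv f"
  by (simp add: Bij.inv_mult_group)

lemma G_left_cancel: "f \<in> G \<Longrightarrow> g \<in> G \<Longrightarrow> k \<in> G \<Longrightarrow> f \<cdot> g = f \<cdot> k \<longleftrightarrow> g = k"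
  by simp

lemma exp_mult_left [simp]:
  "g \<in> G \<Longrightarrow> ep x \<cdot> (ep x' \<cdot> g) = ep (x + x') \<cdot> g"
  "g \<in> G \<Longrightarrow> em y \<cdot> (em y' \<cdot> g) = em (y + y') \<cdot> g"
  by (simp_all add: G_assoc[symmetric] exp_mult)

section \<open>The subgroups \<open>H\<close>, \<open>P^-\<close> and \<open>P^+\<close>\<close>

abbreviation "H \<equiv> H_grp V"

lemma H_G [simp]: "h \<in> H \<Longrightarrow> h \<in> G"
  by (simp add: H_grp_iff)

lemma H_aut: "h \<in> H \<Longrightarrow> h \<in> aut" "h \<in> H \<Longrightarrow> h euler = euler"
  by (simp_all add: H_grp_iff G_aut)

lemma H_closed [simp]: "h \<in> H \<Longrightarrow> k \<in> H \<Longrightarrow> h \<cdot> k \<in> H" "h \<in> H \<Longrightarrow> ginv h \<in> H" "\<^bold>1 \<in> H"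
proof -
  show "\<^bold>1 \<in> H" by (simp add: H_grp_iff)
  show "h \<cdot> k \<in> H" if "h \<in> H" "k \<in> H"
    using that by (simp add: H_grp_iff Bij_G)
  show "ginv h \<in> H" if "h \<in> H"
    using that ginv_apply(2)[OF Bij_G, of h euler] by (simp add: H_grp_iff)
qed

abbreviation "lp f u \<equiv> fst (f (u, 0, 0))"
abbreviation "lm f v \<equiv> snd (snd (f (0, 0, v)))"

lemma H_exp: "h \<in> H \<Longrightarrow> h \<cdot> ep u = ep (lp h u) \<cdot> h" "h \<in> H \<Longrightarrow> h \<cdot> em v = em (lm h v) \<cdot> h"
  using aut_fix_euler_exp H_aut by auto

lemma P_m_cases: "p \<in> P_m V \<longleftrightarrow> (\<exists>v h. h \<in> H \<and> p = em v \<cdot> h)"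
  and P_p_cases: "p \<in> P_p V \<longleftrightarrow> (\<exists>u h. h \<in> H \<and> p = ep u \<cdot> h)"
  by (auto simp: P_m_def P_p_def U_m_def U_p_def set_mult_def)

lemma subgroup_P_m: "subgroup (P_m V) (tkk_bij V)"
proof
  show "P_m V \<subseteq> carrier (tkk_bij V)" by (auto simp: P_m_cases)
  show "\<^bold>1 \<in> P_m V" unfolding P_m_cases
    by (intro exI[of _ 0] exI[of _ "\<^bold>1"]) simp
  show "p \<cdot> p' \<in> P_m V" if p: "p \<in> P_m V" "p' \<in> P_m V" for p p'
  proof -
    obtain v h v' h' where h: "h \<in> H" "h' \<in> H" and p: "p = em v \<cdot> h" "p' = em v' \<cdot> h'"
      using p by (auto simp: P_m_cases)
    \<comment> \<open>\<open>H\<close> normalizes \<open>U^-\<close>, so \<open>h\<close> moves past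
      \<open>em v'\<close>.\<close>
    have "p \<cdot> p' = em v \<cdot> (h \<cdot> em v') \<cdot> h'" using h by (simp add: p G_assoc)
    also have "\<dots> = em (v + lm h v') \<cdot> (h \<cdot> h')" using h by (simp add: H_exp G_assoc)
    finally show ?thesis using h unfolding P_m_cases by (metis H_closed(1))
  qed
  show "ginv p \<in> P_m V" if p: "p \<in> P_m V" for p
  proof -
    obtain v h where h: "h \<in> H" and p: "p = em v \<cdot> h"
      using p by (auto simp: P_m_cases)
    have "ginv p = ginv h \<cdot> em (- v)" using h by (simp add: p G_inv_mult exp_inv)
    also have "\<dots> = em (lm (ginv h) (- v)) \<cdot> ginv h" using h by (simp add: H_exp)
    finally show ?thesis using h unfolding P_m_cases by (metis H_closed(2))
  qed
qed

lemma subgroup_P_p: "subgroup (P_p V) (tkk_bij V)"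
proof
  show "P_p V \<subseteq> carrier (tkk_bij V)" by (auto simp: P_p_cases)
  show "\<^bold>1 \<in> P_p V" unfolding P_p_cases
    by (intro exI[of _ 0] exI[of _ "\<^bold>1"]) simp
  show "p \<cdot> p' \<in> P_p V" if p: "p \<in> P_p V" "p' \<in> P_p V" for p p'
  proof -
    obtain v h v' h' where h: "h \<in> H" "h' \<in> H" and p: "p = ep v \<cdot> h" "p' = ep v' \<cdot> h'"
      using p by (auto simp: P_p_cases)
    have "p \<cdot> p' = ep v \<cdot> (h \<cdot> ep v') \<cdot> h'" using h by (simp add: p G_assoc)
    also have "\<dots> = ep (v + lp h v') \<cdot> (h \<cdot> h')" using h by (simp add: H_exp G_assoc)
    finally show ?thesis using h unfolding P_p_cases by (metis H_closed(1))
  qed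
  show "ginv p \<in> P_p V" if p: "p \<in> P_p V" for p
  proof -
    obtain v h where h: "h \<in> H" and p: "p = ep v \<cdot> h"
      using p by (auto simp: P_p_cases)
    have "ginv p = ginv h \<cdot> ep (- v)" using h by (simp add: p G_inv_mult exp_inv)
    also have "\<dots> = ep (lp (ginv h) (- v)) \<cdot> ginv h" using h by (simp add: H_exp)
    finally show ?thesis using h unfolding P_p_cases by (metis H_closed(2))
  qed
qed

lemma P_inter: "p \<in> P_m V \<Longrightarrow> p \<in> P_p V \<Longrightarrow> p \<in> H"
  by (auto simp: P_m_iff P_p_iff H_grp_iff)

section \<open>Base points and their stabilizers\<close>

abbreviation "op \<equiv> base_p V"
abbreviation "om \<equiv> base_m V"

lemma l_coset_eq_iff:
  assumes "subgroup P (tkk_bij V)" "g \<in> G" "k \<in> G"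
  shows "g \<star> P = k \<star> P \<longleftrightarrow> ginv g \<cdot> k \<in> P"
proof
  assume "g \<star> P = k \<star> P"
  moreover have "k \<in> k \<star> P"
    using assms(1,3) subgroup.one_closed unfolding l_coset_def by force
  ultimately obtain p where p: "p \<in> P" "k = g \<cdot> p" unfolding l_coset_def by auto
  then have "p \<in> carrier (tkk_bij V)" using assms(1) by (simp add: subgroup.mem_carrier)
  then have "ginv g \<cdot> k = p" using assms(2) by (simp add: p(2) Bij.m_assoc[symmetric] Bij.l_inv)
  then show "ginv g \<cdot> k \<in> P" using p by simp
next
  assume a: "ginv g \<cdot> k \<in> P"
  have "k \<star> P = (g \<cdot> (ginv g \<cdot> k)) \<star> P" using assms by simp
  also have "\<dots> = g \<star> ((ginv g \<cdot> k) \<star> P)"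
    using assms by (simp add: Bij.lcos_m_assoc subgroup.subset)
  also have "(ginv g \<cdot> k) \<star> P = P" using assms a by (intro Bij.coset_join3) auto
  finally show "g \<star> P = k \<star> P" by simp
qed

lemma base_eq: "op = P_m V" "om = P_p V"
  unfolding base_p_def base_m_def
  by (rule Bij.lcos_mult_one, simp add: subgroup.subset subgroup_P_m subgroup_P_p)+

lemma base_subset: "op \<subseteq> carrier (tkk_bij V)" "om \<subseteq> carrier (tkk_bij V)"
  by (simp_all add: base_eq subgroup.subset subgroup_P_m subgroup_P_p)

lemma act_act [simp]:
  "g \<in> G \<Longrightarrow> k \<in> G \<Longrightarrow> g \<star> k \<star> op = (g \<cdot> k) \<star> op"
  "g \<in> G \<Longrightarrow> k \<in> G \<Longrightarrow> g \<star> k \<star> om = (g \<cdot> k) \<star> om"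
  by (simp_all add: Bij.lcos_m_assoc base_subset)

lemma act_op_eq: "g \<in> G \<Longrightarrow> k \<in> G \<Longrightarrow> g \<star> op = k \<star> op \<longleftrightarrow> ginv g \<cdot> k \<in> P_m V"
  and act_om_eq: "g \<in> G \<Longrightarrow> k \<in> G \<Longrightarrow> g \<star> om = k \<star> om \<longleftrightarrow> ginv g \<cdot> k \<in> P_p V"
  by (simp_all add: base_eq l_coset_eq_iff subgroup_P_m subgroup_P_p)

lemma act_op_eqE:
  assumes "g \<star> op = k \<star> op" "g \<in> G" "k \<in> G"
  obtains v h where "h \<in> H" "k = g \<cdot> em v \<cdot> h"
proof -
  obtain v h where h: "h \<in> H" "ginv g \<cdot> k = em v \<cdot> h" using assms by (auto simp: act_op_eq P_m_cases)
  then have "k = g \<cdot> em v \<cdot> h" using assms G_cancel(1)[of g k] by (simp add: G_assoc)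
  with h that show ?thesis by blast
qed

lemma act_om_eqE:
  assumes "g \<star> om = k \<star> om" "g \<in> G" "k \<in> G"
  obtains u h where "h \<in> H" "k = g \<cdot> ep u \<cdot> h"
proof -
  obtain v h where h: "h \<in> H" "ginv g \<cdot> k = ep v \<cdot> h" using assms by (auto simp: act_om_eq P_p_cases)
  then have "k = g \<cdot> ep v \<cdot> h" using assms G_cancel(1)[of g k] by (simp add: G_assoc)
  with h that show ?thesis by blast
qed

lemma P_fix:
  "p \<in> P_m V \<Longrightarrow> g \<in> G \<Longrightarrow> (g \<cdot> p) \<star> op = g \<star> op"
  "p \<in> P_p V \<Longrightarrow> g \<in> G \<Longrightarrow> (g \<cdot> p) \<star> om = g \<star> om"
proof -
  show "(g \<cdot> p) \<star> op = g \<star> op" if "p \<in> P_m V" "g \<in> G"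
    using that act_op_eq[of g "g \<cdot> p"] by (auto simp: P_m_iff)
  show "(g \<cdot> p) \<star> om = g \<star> om" if "p \<in> P_p V" "g \<in> G"
    using that act_om_eq[of g "g \<cdot> p"] by (auto simp: P_p_iff)
qed

lemma P_mem [simp]: "h \<in> H \<Longrightarrow> h \<in> P_m V" "h \<in> H \<Longrightarrow> h \<in> P_p V" "em v \<in> P_m V" "ep u \<in> P_p V"
  by (auto simp: P_m_iff P_p_iff H_grp_iff exp_euler)

lemma act_fix [simp]:
  "g \<in> G \<Longrightarrow> (g \<cdot> em v) \<star> op = g \<star> op" "g \<in> G \<Longrightarrow> h \<in> H \<Longrightarrow> (g \<cdot> h) \<star> op = g \<star> op"
  "g \<in> G \<Longrightarrow> (g \<cdot> ep u) \<star> om = g \<star> om" "g \<in> G \<Longrightarrow> h \<in> H \<Longrightarrow> (g \<cdot> h) \<star> om = g \<star> om"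
  by (simp_all add: P_fix)

text \<open>The transition element \<open>exp(u' - u)\<close> moves \<open>E\<close> by
  \<open>u - u'\<close>, so it lies in \<open>P^-\<close> only for \<open>u = u'\<close>; dually for
  \<open>P^+\<close>.\<close>

lemma exp_act_inject:
  "g \<in> G \<Longrightarrow> (g \<cdot> ep u) \<star> op = (g \<cdot> ep u') \<star> op \<longleftrightarrow> u = u'"
  "g \<in> G \<Longrightarrow> (g \<cdot> em v) \<star> om = (g \<cdot> em v') \<star> om \<longleftrightarrow> v = v'"
proof -
  assume g: "g \<in> G"
  have "ginv (g \<cdot> ep u) \<cdot> (g \<cdot> ep u') = ep (u' - u)" using g
    by (simp add: G_inv_mult exp_inv G_assoc exp_mult)
  then show "(g \<cdot> ep u) \<star> op = (g \<cdot> ep u') \<star> op \<longleftrightarrow> u = u'"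
    using g by (auto simp: act_op_eq P_m_iff exp_euler)
  have "ginv (g \<cdot> em v) \<cdot> (g \<cdot> em v') = em (v' - v)" using g
    by (simp add: G_inv_mult exp_inv G_assoc exp_mult)
  then show "(g \<cdot> em v) \<star> om = (g \<cdot> em v') \<star> om \<longleftrightarrow> v = v'"
    using g by (auto simp: act_om_eq P_p_iff exp_euler)
qed

lemma X_p_eq: "X_p V = {g \<star> op | g. g \<in> G}" and X_m_eq: "X_m V = {g \<star> om | g. g \<in> G}"
  by (simp_all add: X_p_def X_m_def base_eq)

text \<open>Another frame \<open>g'\<close> with the same \<open>g'.o^-\<close> is
  \<open>g exp(x) h\<close>. The coordinates then change by the affine map
  \<open>t \<mapsto> x + h t\<close>, which respects combinations with coefficients
  \<open>1 - r\<close> and \<open>r\<close>; so the point described by \<open>THE\<close> is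
  unique.\<close>

lemma aff_p_eq:
  assumes g: "g \<in> G"
  shows "aff_p V r ((g \<cdot> ep u) \<star> op) (g \<star> om) ((g \<cdot> ep w) \<star> op) =
    (g \<cdot> ep (sp (1 - r) u + sp r w)) \<star> op"
  unfolding aff_p_def
proof (rule the_equality)
  show "\<exists>g'\<in>G. \<exists>u' w'. g \<star> om = g' \<star> om \<and> (g \<cdot> ep u) \<star> op = g' \<star> ep u' \<star> op \<and>
      (g \<cdot> ep w) \<star> op = g' \<star> ep w' \<star> op \<and>
      (g \<cdot> ep (sp (1 - r) u + sp r w)) \<star> op = g' \<star> ep (sp (1 - r) u' + sp r w') \<star> op"
    using g by (intro bexI[of _ g] exI[of _ u] exI[of _ w]) auto
next
  fix z
  assume "\<exists>g'\<in>G. \<exists>u' w'. g \<star> om = g' \<star> om \<and> (g \<cdot> ep u) \<star> op = g' \<star> ep u' \<star> op \<and>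
      (g \<cdot> ep w) \<star> op = g' \<star> ep w' \<star> op \<and> z = g' \<star> ep (sp (1 - r) u' + sp r w') \<star> op"
  then obtain g' u' w' where g': "g' \<in> G" and e: "g \<star> om = g' \<star> om"
    and u: "(g \<cdot> ep u) \<star> op = g' \<star> ep u' \<star> op" and w: "(g \<cdot> ep w) \<star> op = g' \<star> ep w' \<star> op"
    and z: "z = g' \<star> ep (sp (1 - r) u' + sp r w') \<star> op" by blast
  obtain x h where h: "h \<in> H" and gh: "g' = g \<cdot> ep x \<cdot> h" using act_om_eqE[OF e g g'] .
  have s: "g' \<star> ep t \<star> op = (g \<cdot> ep (x + lp h t)) \<star> op" for t
  proof -
    have "g' \<star> ep t \<star> op = (g \<cdot> (ep x \<cdot> (h \<cdot> ep t))) \<star> op" using h g by (simp add: gh G_assoc)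
    also have "\<dots> = (g \<cdot> (ep (x + lp h t)) \<cdot> h) \<star> op" using h g by (simp add: H_exp G_assoc)
    also have "\<dots> = (g \<cdot> ep (x + lp h t)) \<star> op" using h g by simp
    finally show ?thesis .
  qed
  have uw: "u = x + lp h u'" "w = x + lp h w'" using u w g unfolding s by (simp_all add: exp_act_inject)
  have "x + lp h (sp (1 - r) u' + sp r w') = sp (1 - r) u + sp r w"
    unfolding aut_component_linear(1)[OF H_aut(1)[OF h]] uw by (simp add: scale_distrib algebra_simps)
  then show "z = (g \<cdot> ep (sp (1 - r) u + sp r w)) \<star> op" unfolding z s by simp
qed

lemma aff_m_eq:
  assumes g: "g \<in> G"
  shows "aff_m V r ((g \<cdot> em u) \<star> om) (g \<star> op) ((g \<cdot> em w) \<star> om) =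
    (g \<cdot> em (sm (1 - r) u + sm r w)) \<star> om"
  unfolding aff_m_def
proof (rule the_equality)
  show "\<exists>g'\<in>G. \<exists>u' w'. g \<star> op = g' \<star> op \<and> (g \<cdot> em u) \<star> om = g' \<star> em u' \<star> om \<and>
      (g \<cdot> em w) \<star> om = g' \<star> em w' \<star> om \<and>
      (g \<cdot> em (sm (1 - r) u + sm r w)) \<star> om = g' \<star> em (sm (1 - r) u' + sm r w') \<star> om"
    using g by (intro bexI[of _ g] exI[of _ u] exI[of _ w]) auto
next
  fix z
  assume "\<exists>g'\<in>G. \<exists>u' w'. g \<star> op = g' \<star> op \<and> (g \<cdot> em u) \<star> om = g' \<star> em u' \<star> om \<and>
      (g \<cdot> em w) \<star> om = g' \<star> em w' \<star> om \<and> z = g' \<star> em (sm (1 - r) u' + sm r w') \<star> om"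
  then obtain g' u' w' where g': "g' \<in> G" and e: "g \<star> op = g' \<star> op"
    and u: "(g \<cdot> em u) \<star> om = g' \<star> em u' \<star> om" and w: "(g \<cdot> em w) \<star> om = g' \<star> em w' \<star> om"
    and z: "z = g' \<star> em (sm (1 - r) u' + sm r w') \<star> om" by blast
  obtain x h where h: "h \<in> H" and gh: "g' = g \<cdot> em x \<cdot> h" using act_op_eqE[OF e g g'] .
  have s: "g' \<star> em t \<star> om = (g \<cdot> em (x + lm h t)) \<star> om" for t
  proof -
    have "g' \<star> em t \<star> om = (g \<cdot> (em x \<cdot> (h \<cdot> em t))) \<star> om" using h g by (simp add: gh G_assoc)
    also have "\<dots> = (g \<cdot> (em (x + lm h t)) \<cdot> h) \<star> om" using h g by (simp add: H_exp G_assoc)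
    also have "\<dots> = (g \<cdot> em (x + lm h t)) \<star> om" using h g by simp
    finally show ?thesis .
  qed
  have uw: "u = x + lm h u'" "w = x + lm h w'" using u w g unfolding s by (simp_all add: exp_act_inject)
  have "x + lm h (sm (1 - r) u' + sm r w') = sm (1 - r) u + sm r w"
    unfolding aut_component_linear(2)[OF H_aut(1)[OF h]] uw by (simp add: scale_distrib algebra_simps)
  then show "z = (g \<cdot> em (sm (1 - r) u + sm r w)) \<star> om" unfolding z s by simp
qed

subsection \<open>Symmetries\<close>

definition rho :: "('v, 'w) tkk \<Rightarrow> ('v, 'w) tkk" where
  "rho = grading_aut V (- 1)"

lemma rho_apply: "X \<in> tkk V \<Longrightarrow> rho X = (- fst X, fst (snd X), - snd (snd X))"
  by (cases X) (simp add: rho_def grading_aut_def)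

lemma rho_closed: "X \<in> tkk V \<Longrightarrow> rho X \<in> tkk V"
  by (cases X) (simp add: rho_apply tkk_iff)

lemma rho_rho: "X \<in> tkk V \<Longrightarrow> rho (rho X) = X"
  by (cases X) (simp add: rho_apply tkk_iff)

lemma rho_aut: "rho \<in> aut"
  unfolding aut_def
proof (intro CollectI conjI ballI allI)
  show "rho \<in> Bij (tkk V)"
  proof -
    have "bij_betw rho (tkk V) (tkk V)"
      by (rule bij_betw_byWitness[where f' = rho]) (auto simp: rho_rho rho_closed)
    then show ?thesis by (simp add: Bij_def rho_def grading_aut_def)
  qed
  fix X Y assume XY: "X \<in> tkk V" "Y \<in> tkk V"
  then show "rho (X + Y) = rho X + rho Y" by (simp add: rho_apply tkk_closed)
  show "rho (tkk_smult V r X) = tkk_smult V r (rho X)" for r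
    using XY by (simp add: rho_apply tkk_closed) (simp add: tkk_smult_def split_beta)
  obtain z A B t z' A' B' t' where X: "X = (z, (A, B), t)" and Y: "Y = (z', (A', B'), t')"
    by (metis prod.exhaust)
  have AB: "(A, B) \<in> tkk0 V" "(A', B') \<in> tkk0 V" using XY by (simp_all add: X Y tkk_iff)
  note d = derivation_pairD[OF derivation_pair_tkk0[OF AB(1)]]
    and d' = derivation_pairD[OF derivation_pair_tkk0[OF AB(2)]]
  have "rho (lie X Y) = (- fst (lie X Y), fst (snd (lie X Y)), - snd (snd (lie X Y)))"
    using XY by (simp add: rho_apply tkk_closed)
  also have "\<dots> = lie (rho X) (rho Y)"
    using XY unfolding X Y by (simp add: rho_apply) (simp add: lie_apply d d')
  finally show "rho (lie X Y) = lie (rho X) (rho Y)" .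
qed

lemma rho_carrier [simp]: "rho \<in> carrier (tkk_bij V)"
  by (simp add: aut_carrier rho_aut)

lemma rho_euler: "rho euler = euler"
  by (simp add: rho_apply)

lemma rho_mul_rho [simp]: "rho \<cdot> rho = \<^bold>1"
proof (rule Bij_eqI)
  show "rho \<cdot> rho \<in> Bij (tkk V)" "\<^bold>1 \<in> Bij (tkk V)"
    using Bij.m_closed[OF rho_carrier rho_carrier] Bij.one_closed by (simp_all add: carrier_Bij)
qed (use autD(1)[OF rho_aut] in \<open>simp add: rho_rho\<close>)

lemma ginv_rho [simp]: "ginv rho = rho"
  by (rule Bij.inv_equality) simp_all

lemma rho_rho_left: "g \<in> carrier (tkk_bij V) \<Longrightarrow> rho \<cdot> (rho \<cdot> g) = g"
  by (simp add: Bij.m_assoc[symmetric])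

text \<open>\<open>rho\<close> is not assumed to lie in \<open>G\<close>, but conjugation by it
  preserves \<open>G\<close>; read in frames, it describes all the symmetries.\<close>

definition tw :: "(('v, 'w) tkk \<Rightarrow> ('v, 'w) tkk) \<Rightarrow> ('v, 'w) tkk \<Rightarrow> ('v, 'w) tkk" where
  "tw g = rho \<cdot> g \<cdot> rho"

lemma tw_mul_carrier:
  "g \<in> carrier (tkk_bij V) \<Longrightarrow> k \<in> carrier (tkk_bij V) \<Longrightarrow> tw (g \<cdot> k) = tw g \<cdot> tw k"
  by (simp add: tw_def Bij.m_assoc rho_rho_left)

lemma tw_inv_carrier: "g \<in> carrier (tkk_bij V) \<Longrightarrow> tw (ginv g) = ginv (tw g)"
  by (simp add: tw_def Bij.inv_mult_group Bij.m_assoc)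

lemma tw_one [simp]: "tw \<^bold>1 = \<^bold>1"
  by (simp add: tw_def)

lemma tw_exp [simp]: "tw (ep u) = ep (- u)" "tw (em v) = em (- v)"
proof -
  have "rho \<cdot> ep u = ep (- u) \<cdot> rho" "rho \<cdot> em v = em (- v) \<cdot> rho"
    using aut_fix_euler_exp(1)[OF rho_aut rho_euler, of u] aut_fix_euler_exp(2)[OF rho_aut rho_euler, of v]
    by (simp_all add: rho_apply)
  then show "tw (ep u) = ep (- u)" "tw (em v) = em (- v)"
    by (simp_all add: tw_def Bij.m_assoc)
qed

lemma tw_G [simp]: assumes "g \<in> G" shows "tw g \<in> G"
  using assms[unfolded elem_grp_def]
proof (induction g rule: generate.induct)
  case (incl g)
  then show ?case by (auto simp: U_p_def U_m_def)
next
  case (inv g)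
  then show ?case by (auto simp: U_p_def U_m_def exp_inv)
next
  case (eng g k)
  then show ?case by (simp add: elem_grp_def[symmetric] tw_mul_carrier)
qed simp

lemma tw_mul [simp]: "g \<in> G \<Longrightarrow> k \<in> G \<Longrightarrow> tw (g \<cdot> k) = tw g \<cdot> tw k"
  by (simp add: tw_mul_carrier)

lemma tw_inv [simp]: "g \<in> G \<Longrightarrow> tw (ginv g) = ginv (tw g)"
  by (simp add: tw_inv_carrier)

lemma tw_tw [simp]: "g \<in> G \<Longrightarrow> tw (tw g) = g"
  by (simp add: tw_def Bij.m_assoc rho_rho_left)

text \<open>\<open>rho\<close> is \<open>1 - 2 (ad E)\<^sup>2\<close>, so it commutes with everything that fixes the Euler element \<open>E\<close>.\<close>

lemma tw_H [simp]: assumes "h \<in> H" shows "tw h = h"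
proof -
  have r: "rho X = X - (lie euler (lie euler X) + lie euler (lie euler X))" if "X \<in> tkk V" for X
    using that tkk_closed(5)[OF euler_tkk that] by (simp add: rho_apply lie_euler prod_eq_iff)
  note h = autD[OF H_aut(1)[OF assms]]
  have "rho \<cdot> h = h \<cdot> rho"
  proof (rule aut_conj)
    show "rho \<in> aut" "h \<in> Bij (tkk V)" "h \<in> Bij (tkk V)" using rho_aut h(1) by auto
    show "rho (h Z) = h (rho Z)" if Z: "Z \<in> tkk V" for Z
      using Z h H_aut(2)[OF assms] aut_diff[OF H_aut(1)[OF assms]]
      by (simp add: r tkk_closed)
  qed
  then show ?thesis using assms by (simp add: tw_def Bij.m_assoc)
qed

lemma tw_P [simp]: "p \<in> P_m V \<Longrightarrow> tw p \<in> P_m V" "p \<in> P_p V \<Longrightarrow> tw p \<in> P_p V"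
  by (auto simp: P_m_cases P_p_cases, blast+)

lemma tw_apply_euler: "g \<in> G \<Longrightarrow> tw g euler = rho (g euler)"
  using autD(1)[OF rho_aut] Bij_G[of g] Bij.m_closed[of rho g]
  by (simp add: tw_def rho_euler carrier_Bij)

text \<open>\<open>tw\<close> is multiplicative and maps \<open>P^-\<close> onto itself, so it maps
  the coset of \<open>k\<close> to that of \<open>tw k\<close>.\<close>

lemma base_dilation_eq:
  assumes "k \<in> G" shows "base_dilation V (- 1) (k \<star> op) = tw k \<star> op"
proof -
  have "base_dilation V (- 1) (k \<star> op) = (\<lambda>p. tw (k \<cdot> p)) ` P_m V"
    unfolding base_dilation_def rho_def[symmetric] base_eq l_coset_def
    by (auto simp: tw_def)
  also have "\<dots> = (\<lambda>p. tw k \<cdot> tw p) ` P_m V"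
    using assms by (intro image_cong) (auto simp: P_m_iff)
  also have "\<dots> = (\<lambda>p. tw k \<cdot> p) ` (tw ` P_m V)" by (simp add: image_image)
  also have "tw ` P_m V = P_m V"
  proof
    show "P_m V \<subseteq> tw ` P_m V"
    proof
      fix p assume "p \<in> P_m V"
      then show "p \<in> tw ` P_m V" by (intro image_eqI[of _ _ "tw p"]) (auto simp: P_m_iff[of p])
    qed
  qed auto
  also have "(\<lambda>p. tw k \<cdot> p) ` P_m V = tw k \<star> op" by (auto simp: base_eq l_coset_def)
  finally show ?thesis .
qed

lemma frame_eqE:
  assumes "g \<in> G" "k \<in> G" "g \<star> op = k \<star> op" "g \<star> om = k \<star> om"
  obtains h where "h \<in> H" "k = g \<cdot> h"
proof -
  have "ginv g \<cdot> k \<in> H" using assms by (auto simp: act_op_eq act_om_eq intro: P_inter)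
  moreover have "k = g \<cdot> (ginv g \<cdot> k)" using assms by simp
  ultimately show ?thesis using that by blast
qed

text \<open>Two frames at the same pair of points differ by some \<open>h\<close> in
  \<open>H\<close>, and \<open>tw h = h\<close>; hence the result does not depend on the
  frame.\<close>

lemma dilation_eq:
  assumes g: "g \<in> G" and k: "k \<in> G"
  shows "dilation V (- 1) (g \<star> op) (g \<star> om) ((g \<cdot> k) \<star> op) = (g \<cdot> tw k) \<star> op"
proof -
  have b: "g' \<star> base_dilation V (- 1) (ginv g' \<star> (g \<cdot> k) \<star> op) = (g' \<cdot> tw (ginv g' \<cdot> (g \<cdot> k))) \<star> op"
    if "g' \<in> G" for g'
    using that g k by (simp add: base_dilation_eq)
  show ?thesis unfolding dilation_def
  proof (rule the_equality)
    show "\<exists>g'\<in>G. g \<star> op = g' \<star> op \<and> g \<star> om = g' \<star> om \<and>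
        (g \<cdot> tw k) \<star> op = g' \<star> base_dilation V (- 1) (ginv g' \<star> (g \<cdot> k) \<star> op)"
      using g k by (intro bexI[of _ g]) (simp_all only: b, simp_all)
  next
    fix z
    assume "\<exists>g'\<in>G. g \<star> op = g' \<star> op \<and> g \<star> om = g' \<star> om \<and>
        z = g' \<star> base_dilation V (- 1) (ginv g' \<star> (g \<cdot> k) \<star> op)"
    then obtain g' where g': "g' \<in> G" "g \<star> op = g' \<star> op" "g \<star> om = g' \<star> om"
      and z: "z = (g' \<cdot> tw (ginv g' \<cdot> (g \<cdot> k))) \<star> op" using b by blast
    obtain h where h: "h \<in> H" "g' = g \<cdot> h" using frame_eqE[OF g g'] .
    have "ginv g' \<cdot> (g \<cdot> k) = ginv h \<cdot> k" using g k h by (simp add: G_inv_mult G_assoc)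
    then have "z = (g \<cdot> tw k) \<star> op" using g k h by (simp add: z G_assoc)
    then show "z = (g \<cdot> tw k) \<star> op" .
  qed
qed

section \<open>Transversality, midpoints and adapted frames\<close>

lemma transversal_iff: "transversal V x a \<longleftrightarrow> (\<exists>g\<in>G. x = g \<star> op \<and> a = g \<star> om)"
  by (simp add: transversal_def)

lemma transversal_om:
  assumes "transversal V x (g \<star> om)" "g \<in> G" obtains u where "x = (g \<cdot> ep u) \<star> op"
proof -
  obtain k where k: "k \<in> G" "x = k \<star> op" "g \<star> om = k \<star> om" using assms by (auto simp: transversal_iff)
  obtain u h where "h \<in> H" "k = g \<cdot> ep u \<cdot> h" using act_om_eqE[OF k(3) assms(2) k(1)] .
  then show ?thesis using that k assms(2) by simp
qed

lemma transversal_op: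
  assumes "transversal V (g \<star> op) a" "g \<in> G" obtains v where "a = (g \<cdot> em v) \<star> om"
proof -
  obtain k where k: "k \<in> G" "a = k \<star> om" "g \<star> op = k \<star> op" using assms by (auto simp: transversal_iff)
  obtain u h where "h \<in> H" "k = g \<cdot> em u \<cdot> h" using act_op_eqE[OF k(3) assms(2) k(1)] .
  then show ?thesis using that k assms(2) by simp
qed

lemma transversal_exp [simp]:
  "g \<in> G \<Longrightarrow> transversal V ((g \<cdot> ep u) \<star> op) (g \<star> om)"
  "g \<in> G \<Longrightarrow> transversal V (g \<star> op) ((g \<cdot> em v) \<star> om)"
  unfolding transversal_iff
  by (rule bexI[of _ "g \<cdot> ep u"], simp, simp) (rule bexI[of _ "g \<cdot> em v"], simp, simp)

lemma transversal_refl [simp]: "g \<in> G \<Longrightarrow> transversal V (g \<star> op) (g \<star> om)"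
  by (auto simp: transversal_iff)

lemma U_set_iff: "x \<in> U_set V a b \<longleftrightarrow> transversal V x a \<and> transversal V x b"
  by (auto simp: U_set_def nbh_p_def jp_geometry_def X_p_eq transversal_iff)

lemma midpt_eq:
  assumes "g \<in> G"
  shows "midpt V ((g \<cdot> em v) \<star> om) ((g \<cdot> em v') \<star> om) (g \<star> op) = (g \<cdot> em (sm half (v + v'))) \<star> om"
proof -
  have "v - sm half v = sm half v"
    using half_add(2)[of v] by (metis add_diff_cancel)
  then show ?thesis using assms by (simp add: midpt_def jp_geometry_def aff_m_eq scale_distrib)
qed

text \<open>A frame at \<open>x\<close> in which the midpoint of \<open>a\<close> and \<open>b\<close> is the origin of \<open>v\<^sub>x\<close>.\<close>

lemma U_set_frame:
  assumes "x \<in> U_set V a b"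
  obtains g t where "g \<in> G" "x = g \<star> op" "a = (g \<cdot> em (- t)) \<star> om" "b = (g \<cdot> em t) \<star> om"
proof -
  obtain k where k: "k \<in> G" "x = k \<star> op" "a = k \<star> om"
    using assms by (auto simp: U_set_iff transversal_iff)
  then have "transversal V (k \<star> op) b" using assms by (simp add: U_set_iff)
  then obtain v where v: "b = (k \<cdot> em v) \<star> om" using k(1) transversal_op by blast
  have "k \<cdot> em (sm half v) \<cdot> em (- sm half v) = k" "k \<cdot> em (sm half v) \<cdot> em (sm half v) = k \<cdot> em v"
    using k by (simp_all add: G_assoc exp_mult half_add)
  then show ?thesis using that[of "k \<cdot> em (sm half v)" "sm half v"] k v by simp
qed

lemma frame_U_set:
  assumes "g \<in> G" "a = (g \<cdot> em (- t)) \<star> om" "b = (g \<cdot> em t) \<star> om"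
  shows "g \<star> op \<in> U_set V a b" "midpt V a b (g \<star> op) = g \<star> om"
  using assms by (simp_all add: U_set_iff midpt_eq)

lemma U_mult_eq:
  assumes "g \<in> G" "a = (g \<cdot> em (- t)) \<star> om" "b = (g \<cdot> em t) \<star> om" "k \<in> G"
  shows "U_mult V a b (g \<star> op) ((g \<cdot> k) \<star> op) = (g \<cdot> tw k) \<star> op"
  using assms by (simp add: U_mult_def frame_U_set(2) dilation_eq)

text \<open>The symmetry at \<open>x\<close> exchanges \<open>a\<close> and \<open>b\<close>,
  because conjugation by \<open>rho\<close> turns \<open>exp(t)\<close> into \<open>exp(-t)\<close>.
  It carries an adapted frame at a second point to a frame with both offsets negated; the two sign
  changes compensate, and the new frame is adapted again.\<close>

lemma U_mult_frame:
  assumes g: "g \<in> G" "a = (g \<cdot> em (- t)) \<star> om" "b = (g \<cdot> em t) \<star> om"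
    and k: "k \<in> G" "a = (g \<cdot> k \<cdot> em (- s)) \<star> om" "b = (g \<cdot> k \<cdot> em s) \<star> om"
  shows "a = (g \<cdot> tw k \<cdot> em (- s)) \<star> om" "b = (g \<cdot> tw k \<cdot> em s) \<star> om"
proof -
  have *: "(g \<cdot> em (- r)) \<star> om = (g \<cdot> tw k \<cdot> em (- s)) \<star> om"
    if "(g \<cdot> em r) \<star> om = (g \<cdot> k \<cdot> em s) \<star> om" for r s
  proof -
    have "ginv (g \<cdot> em r) \<cdot> (g \<cdot> k \<cdot> em s) \<in> P_p V" using that g(1) k(1) act_om_eq by simp
    then have "em (- r) \<cdot> (k \<cdot> em s) \<in> P_p V" using g(1) k(1) by (simp add: G_inv_mult G_assoc exp_inv)
    then have "tw (em (- r) \<cdot> (k \<cdot> em s)) \<in> P_p V" by (rule tw_P)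
    then have "em r \<cdot> (tw k \<cdot> em (- s)) \<in> P_p V" using k(1) by simp
    then show ?thesis using g(1) k(1) act_om_eq[of "g \<cdot> em (- r)" "g \<cdot> tw k \<cdot> em (- s)"]
      by (simp add: G_inv_mult G_assoc exp_inv)
  qed
  show "a = (g \<cdot> tw k \<cdot> em (- s)) \<star> om" "b = (g \<cdot> tw k \<cdot> em s) \<star> om"
    using *[of t s] *[of "- t" "- s"] g k by simp_all
qed

section \<open>The axioms of a symmetric space\<close>

lemma U_set_symmetric_space:
  "symmetric_space (U_set V a b) (U_mult V a b)
     (\<lambda>x. nbh_p (jp_geometry V) (midpt V a b x))
     (\<lambda>x y. Pi_p (jp_geometry V) (- 1) x (midpt V a b x) y)"
  unfolding symmetric_space_def
proof (intro conjI ballI)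
  fix x assume x: "x \<in> U_set V a b"
  obtain g t where g: "g \<in> G" "x = g \<star> op" "a = (g \<cdot> em (- t)) \<star> om" "b = (g \<cdot> em t) \<star> om"
    using U_set_frame[OF x] .
  note mu = U_mult_eq[OF g(1,3,4)]
  have p: "midpt V a b x = g \<star> om" using frame_U_set(2)[OF g(1,3,4)] g(2) by simp
  show "U_mult V a b x x = x" using mu[of "\<^bold>1"] g(1,2) by simp
  show "x \<in> nbh_p (jp_geometry V) (midpt V a b x)"
    unfolding p using g(1) by (auto simp: nbh_p_def jp_geometry_def g(2) X_p_eq)
  show "U_mult V a b x y = Pi_p (jp_geometry V) (- 1) x (midpt V a b x) y"
    if y: "y \<in> nbh_p (jp_geometry V) (midpt V a b x)" for y
  proof -
    obtain u where u: "y = (g \<cdot> ep u) \<star> op"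
      using y g(1) by (auto simp: p nbh_p_def jp_geometry_def elim: transversal_om)
    have "aff_p V (- 1) (g \<star> op) (g \<star> om) y = (g \<cdot> ep (- u)) \<star> op"
      using aff_p_eq[OF g(1), of "- 1" 0 u] g(1) by (simp add: u)
    then show ?thesis using mu[of "ep u"] u g(2) p by (simp add: jp_geometry_def)
  qed
  fix y assume y: "y \<in> U_set V a b"
  obtain k' s where k': "k' \<in> G" "y = k' \<star> op" "a = (k' \<cdot> em (- s)) \<star> om" "b = (k' \<cdot> em s) \<star> om"
    using U_set_frame[OF y] .
  \<comment> \<open>The transition from the frame at \<open>x\<close> to the frame at
    \<open>y\<close>.\<close>
  define k where "k = ginv g \<cdot> k'"
  have k: "k \<in> G" "k' = g \<cdot> k" using g(1) k'(1) by (simp_all add: k_def)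
  have xy: "U_mult V a b x y = (g \<cdot> tw k) \<star> op" using mu[OF k(1)] g(2) k'(2) k(2) by simp
  \<comment> \<open>\<open>g \<cdot> tw k\<close> is an adapted frame at \<open>\<mu>(x, y)\<close>;
    this gives closure and is the frame used for (S3).\<close>
  have f: "a = (g \<cdot> tw k \<cdot> em (- s)) \<star> om" "b = (g \<cdot> tw k \<cdot> em s) \<star> om"
    using U_mult_frame[OF g(1,3,4) k(1)] k' k(2) by auto
  have c: "g \<cdot> tw k \<in> G" using g k by simp
  show "U_mult V a b x y \<in> U_set V a b" unfolding xy using frame_U_set(1)[OF c f] .
  show "U_mult V a b x (U_mult V a b x y) = y"
    unfolding xy using mu[of "tw k"] g(2) k k'(2) by simp
  fix z assume z: "z \<in> U_set V a b"
  obtain n' where n': "n' \<in> G" "z = n' \<star> op" using z by (auto simp: U_set_iff transversal_iff)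
  define n where "n = ginv g \<cdot> n'"
  have n: "n \<in> G" "z = (g \<cdot> n) \<star> op" using g(1) n' by (simp_all add: n_def)
  have xz: "U_mult V a b x z = (g \<cdot> tw n) \<star> op" using mu[OF n(1)] g(2) n(2) by simp
  \<comment> \<open>The point \<open>\<mu>(x, z)\<close>, rewritten in the frame
    \<open>k' = g \<cdot> k\<close> at \<open>y\<close>.\<close>
  have "(g \<cdot> tw n) \<star> op = (k' \<cdot> (ginv k \<cdot> tw n)) \<star> op" using g k n by (simp add: G_assoc)
  then have "U_mult V a b y (U_mult V a b x z) = (k' \<cdot> tw (ginv k \<cdot> tw n)) \<star> op"
    unfolding xz using U_mult_eq[OF k'(1,3,4), of "ginv k \<cdot> tw n"] k n k'(2) by simp
  also have "\<dots> = (g \<cdot> (k \<cdot> (ginv (tw k) \<cdot> n))) \<star> op" using g k n by (simp add: G_assoc)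
  finally have "U_mult V a b x (U_mult V a b y (U_mult V a b x z)) = (g \<cdot> tw (k \<cdot> (ginv (tw k) \<cdot> n))) \<star> op"
    using mu[of "k \<cdot> (ginv (tw k) \<cdot> n)"] g k n by simp
  also have "\<dots> = (g \<cdot> tw k \<cdot> tw (ginv (tw k) \<cdot> n)) \<star> op" using g k n by (simp add: G_assoc)
  \<comment> \<open>\<open>U_mult_eq\<close> read backwards: in the frame
    \<open>g \<cdot> tw k\<close>, this is the symmetry at \<open>\<mu>(x, y)\<close> applied to
    \<open>z\<close>.\<close>
  also have "\<dots> = U_mult V a b ((g \<cdot> tw k) \<star> op) ((g \<cdot> tw k \<cdot> (ginv (tw k) \<cdot> n)) \<star> op)"
    using U_mult_eq[OF c f, of "ginv (tw k) \<cdot> n"] k n by simp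
  also have "(g \<cdot> tw k \<cdot> (ginv (tw k) \<cdot> n)) \<star> op = z" using g k n by (simp add: G_assoc)
  finally show "U_mult V a b x (U_mult V a b y (U_mult V a b x z)) = U_mult V a b (U_mult V a b x y) z"
    unfolding xy .
qed

lemma comm0_0: "X \<in> tkk0 V \<Longrightarrow> comm0 X 0 = 0" "X \<in> tkk0 V \<Longrightarrow> comm0 0 X = 0"
  using comm0_zero[of "fst X" "snd X"] derivation_pair_tkk0[of "fst X" "snd X"] by auto

lemma zero_tkk_eq: "(0::('v, 'w) tkk) = (0, 0, 0)"
  by (simp add: prod_eq_iff)

subsection \<open>Euler elements without component in degree zero\<close>

text \<open>In the Jordan identity the outer terms contain \<open>T(u, v, u)\<close>, and the middle
  one is, by \<open>Tp_shift\<close>, the left side again. So the eigenvalue 1/2 of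
  \<open>D(u, v)\<close> on \<open>u\<close> passes to all \<open>T(u, t, u)\<close>.\<close>

lemma half_eigen_quadratic:
  assumes "Tp u v u + Tp u v u = u"
  shows "Tp u v (Tp u t u) + Tp u v (Tp u t u) = Tp u t u"
proof -
  let ?X = "Tp u v (Tp u t u)"
  have "?X = Tp (Tp u v u) t u - ?X + Tp u t (Tp u v u)"
    using Tp_jordan[of u v u t u] Tp_shift[of u v t] by simp
  then have "?X + ?X = Tp (Tp u v u) t u + Tp u t (Tp u v u)" by (simp add: algebra_simps)
  also have "\<dots> = Tp (Tp u v u + Tp u v u) t u" by (simp add: T_add Tp_sym[of u t "Tp u v u"])
  finally show ?thesis using assms by simp
qed

lemma half_eigen_quadratic_m:
  assumes "Tm v u v + Tm v u v = v"
  shows "Tm v u (Tm v t v) + Tm v u (Tm v t v) = Tm v t v"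
proof -
  let ?X = "Tm v u (Tm v t v)"
  have "?X = Tm (Tm v u v) t v - ?X + Tm v t (Tm v u v)"
    using Tm_jordan[of v u v t v] Tm_shift[of v u t] by simp
  then have "?X + ?X = Tm (Tm v u v) t v + Tm v t (Tm v u v)" by (simp add: algebra_simps)
  also have "\<dots> = Tm (Tm v u v + Tm v u v) t v" by (simp add: T_add Tm_sym[of v t "Tm v u v"])
  finally show ?thesis using assms by simp
qed

text \<open>Put \<open>p' = (1 - 2 D(u, v)) p\<close>. Since \<open>1 - 2 D(u, v)\<close> kills
  \<open>T(u, t, u)\<close>, \<open>p'\<close> has eigenvalue 1 under \<open>D(u, v)\<close>. Then
  \<open>T(v, p', v)\<close> has both eigenvalues 1 and 1/2 under \<open>T(v, u, -)\<close> and
  vanishes, so the Jordan identity for \<open>T(p', v, T(u, v, u))\<close> becomes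
  \<open>p'/2 = 2 p'\<close>, whence \<open>3 p' = 0\<close>.\<close>

lemma half_eigen_p:
  assumes u: "Tp u v u + Tp u v u = u" and v: "Tm v u v + Tm v u v = v"
    and p: "p = Tp p v u - Tp u t u"
  shows "p - (Tp u v p + Tp u v p) = 0"
proof -
  define p' where "p' = p - (Tp u v p + Tp u v p)"
  have F: "Tp u v p = Tp u v (Tp u v p) - Tp u v (Tp u t u)"
    by (subst p) (simp add: T_diff Tp_sym[of p v u])
  have "p' = (Tp u v p - Tp u t u) - (Tp u v (Tp u v p) - Tp u v (Tp u t u) + (Tp u v (Tp u v p) - Tp u v (Tp u t u)))"
    unfolding p'_def using F p Tp_sym[of p v u] by simp
  also have "\<dots> = Tp u v p' - (Tp u t u - (Tp u v (Tp u t u) + Tp u v (Tp u t u)))"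
    by (simp add: p'_def T_diff T_add algebra_simps)
  finally have p': "p' = Tp u v p'" by (simp add: half_eigen_quadratic[OF u])
  have m: "Tm v p' v = 0"
  proof -
    have "Tm v u (Tm v p' v) = Tm v p' v" using Tm_shift[of v u p'] p' by simp
    then show ?thesis using half_eigen_quadratic_m[OF v, of p'] by simp
  qed
  have "Tp p' v (Tp u v u) = p' + p'"
    using Tp_jordan[of p' v u v u] m p' Tp_sym[of p' v u] by simp
  then have "(p' + p') + (p' + p') = Tp p' v (Tp u v u + Tp u v u)" by (simp add: T_add)
  also have "\<dots> = p'" using u p' Tp_sym[of p' v u] by simp
  finally have "p' + p' + p' = 0" by (simp add: algebra_simps)
  then show ?thesis unfolding p'_def[symmetric] by (rule triple_eq_0)
qed

lemma half_eigen_m: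
  assumes u: "Tp u v u + Tp u v u = u" and v: "Tm v u v + Tm v u v = v"
    and p: "p = Tm p u v - Tm v t v"
  shows "p - (Tm v u p + Tm v u p) = 0"
proof -
  define p' where "p' = p - (Tm v u p + Tm v u p)"
  have F: "Tm v u p = Tm v u (Tm v u p) - Tm v u (Tm v t v)"
    by (subst p) (simp add: T_diff Tm_sym[of p u v])
  have "p' = (Tm v u p - Tm v t v) - (Tm v u (Tm v u p) - Tm v u (Tm v t v) + (Tm v u (Tm v u p) - Tm v u (Tm v t v)))"
    unfolding p'_def using F p Tm_sym[of p u v] by simp
  also have "\<dots> = Tm v u p' - (Tm v t v - (Tm v u (Tm v t v) + Tm v u (Tm v t v)))"
    by (simp add: p'_def T_diff T_add algebra_simps)
  finally have p': "p' = Tm v u p'" by (simp add: half_eigen_quadratic_m[OF v])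
  have m: "Tp u p' u = 0"
  proof -
    have "Tp u v (Tp u p' u) = Tp u p' u" using Tp_shift[of u v p'] p' by simp
    then show ?thesis using half_eigen_quadratic[OF u, of p'] by simp
  qed
  have "Tm p' u (Tm v u v) = p' + p'"
    using Tm_jordan[of p' u v u v] m p' Tm_sym[of p' u v] by simp
  then have "(p' + p') + (p' + p') = Tm p' u (Tm v u v + Tm v u v)" by (simp add: T_add)
  also have "\<dots> = p'" using v p' Tm_sym[of p' u v] by simp
  finally have "p' + p' + p' = 0" by (simp add: algebra_simps)
  then show ?thesis unfolding p'_def[symmetric] by (rule triple_eq_0)
qed

lemma lie_off_diagonal:
  "AB \<in> tkk0 V \<Longrightarrow>
    lie (u, 0, v) (p, AB, t) = (- fst AB u, inner_D V u t - inner_D V p v, - snd AB v)"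
  by (simp add: lie_def comm0_0)

text \<open>With \<open>C = E - 2 D(u, v)\<close> one shows that \<open>C\<close> commutes with \<open>u + v = g E\<close> and annihilates
  its eigenspaces \<open>g (g\<^sub>\<plusminus>\<^sub>1)\<close>; since \<open>g\<^sub>0\<close> acts faithfully on \<open>g\<^sub>\<plusminus>\<^sub>1\<close>, \<open>C = 0\<close>.\<close>

lemma euler_conjugate_off_diagonal:
  assumes g: "g \<in> aut" and e: "g euler = (u, 0, v)"
  shows "inner_D V u v + inner_D V u v = euler0"
proof -
  note a = autD[OF g]
  let ?E = "(u, 0, v)" and ?N = "inner_D V u v + inner_D V u v"
  define C where "C = euler0 - ?N"
  have N: "?N \<in> tkk0 V" by (simp add: tkk0_closed)
  have C0: "C \<in> tkk0 V" unfolding C_def by (rule tkk0_closed(3)[OF tkk0_closed(6) N])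
  then have C: "(fst C, snd C) \<in> tkk0 V" by simp
  note dC = derivation_pair_tkk0[OF C]
  note dC' = derivation_pairD[OF dC]
  have i: "ginv g Y \<in> tkk V" "g (ginv g Y) = Y" if "Y \<in> tkk V" for Y
    using autD(2)[OF aut_ginv[OF g]] ginv_apply[OF a(1)] that by auto
  have inj: "X = Y" if "g X = g Y" "X \<in> tkk V" "Y \<in> tkk V" for X Y
    using ginv_apply(2)[OF a(1)] that by metis
  \<comment> \<open>\<open>ad E\<close> has only the eigenvalues 1, 0, -1, so
    \<open>(ad E)^3 = ad E\<close>; \<open>g\<close> transports this to
    \<open>u + v\<close>.\<close>
  have cube: "lie ?E (lie ?E (lie ?E X)) = lie ?E X" if X: "X \<in> tkk V" for X
  proof -
    let ?Y = "ginv g X"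
    have s: "g (lie euler Z) = lie ?E (g Z)" if "Z \<in> tkk V" for Z
      using a(5)[OF euler_tkk that] e by simp
    have "lie ?E (lie ?E (lie ?E (g ?Y))) = g (lie euler (lie euler (lie euler ?Y)))"
      using i[OF X] by (simp only: s tkk_closed euler_tkk)
    also have "lie euler (lie euler (lie euler ?Y)) = lie euler ?Y"
      using i[OF X] by (simp add: lie_euler tkk_iff tkk0_closed)
    finally show ?thesis using i[OF X] s by simp
  qed
  \<comment> \<open>Applied to \<open>E\<close>, the cubic identity yields
    \<open>2 T(u, v, u) = u\<close> and \<open>2 T(v, u, v) = v\<close>.\<close>
  have e1: "lie ?E euler = (- u, 0, v)" by (simp add: lie_off_diagonal tkk0_closed)
  have e2: "lie ?E (- u, 0, v) = (0, ?N, 0)"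
    using lie_off_diagonal[OF tkk0_closed(1), of u v "- u" v] by simp
  have e3: "lie ?E (0, ?N, 0) = (- fst ?N u, 0, - snd ?N v)"
    using lie_off_diagonal[OF N, of u v 0 0] by simp
  have uv: "Tp u v u + Tp u v u = u" "Tm v u v + Tm v u v = v"
  proof -
    have "fst ?N u = u" "- snd ?N v = v"
      using cube[OF euler_tkk] unfolding e1 e2 e3 by (simp_all only: prod.inject neg_equal_iff_equal)
    then show "Tp u v u + Tp u v u = u" "Tm v u v + Tm v u v = v" by (simp_all add: inner_D_def)
  qed
  have fC: "fst C z = z - (Tp u v z + Tp u v z)" "snd C t = - (t - (Tm v u t + Tm v u t))" for z t
    by (simp_all add: C_def inner_D_def)
  have Cuv: "fst C u = 0" "snd C v = 0" using uv by (simp_all add: fC)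
  \<comment> \<open>\<open>(p, (A, B), t)\<close> is an eigenvector of \<open>ad(u + v)\<close> for
    1 or -1. Eliminating \<open>A u\<close> and \<open>B v\<close> gives the same equations for
    \<open>p\<close> and \<open>t\<close> in both cases; only the formula for \<open>(A, B)\<close>
    changes sign.\<close>
  have kill: "lie (0, C, 0) (p, (A, B), t) = 0"
    if X: "(A, B) \<in> tkk0 V" and p: "p = Tp p v u - Tp u t u" and t: "t = Tm t u v - Tm v p v"
      and AB: "(A, B) = inner_D V u t - inner_D V p v \<or> (A, B) = inner_D V p v - inner_D V u t" for p A B t
  proof -
    have Cpt: "fst C p = 0" "snd C t = 0"
      using half_eigen_p[OF uv p] half_eigen_m[OF uv t] by (simp_all add: fC)
    have "comm0 C (inner_D V u t) = 0" "comm0 C (inner_D V p v) = 0"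
      using comm0_inner_D[OF dC] Cuv Cpt by simp_all
    then have "comm0 C (A, B) = 0"
      using AB by (auto simp: comm0_linear(2)[OF C0])
    then show ?thesis using Cpt by (simp add: lie_def zero_tkk_eq derivation_pairD[OF derivation_pair_tkk0[OF X]])
  qed
  have Ct: "(0, C, 0) \<in> tkk V" using C by (simp add: tkk_iff)
  \<comment> \<open>Pulled back by \<open>g\<close>, the eigenspaces of \<open>ad(u + v)\<close>
    become \<open>g_1\<close> and \<open>g_-1\<close>, on which \<open>g_0\<close> acts
    faithfully.\<close>
  let ?c = "ginv g (0, C, 0)"
  note c = i[OF Ct]
  have k0: "lie ?c Y = 0" if Y: "Y \<in> grade_p V \<or> Y \<in> grade_m V" for Y
  proof -
    have Yt: "Y \<in> tkk V" using Y by (auto simp: grade_iff)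
    obtain p A B t where gY: "g Y = (p, (A, B), t)" by (metis prod.exhaust)
    have AB: "(A, B) \<in> tkk0 V" using a(2)[OF Yt] by (simp add: gY tkk_iff)
    have "lie ?E (g Y) = g (lie euler Y)" using a(5)[OF euler_tkk Yt] e by simp
    then have "lie ?E (g Y) = g Y \<or> lie ?E (g Y) = - g Y"
      using Y aut_minus[OF g Yt] by (auto simp: grade_iff)
    then have "lie (0, C, 0) (g Y) = 0"
    proof
      assume "lie ?E (g Y) = g Y"
      then have *: "- A u = p" "(A, B) = inner_D V u t - inner_D V p v" "- B v = t"
        unfolding gY lie_off_diagonal[OF AB] by simp_all
      then have "A u = Tp u t u - Tp p v u" "B v = - Tm t u v + Tm v p v"
        by (simp_all add: inner_D_def fun_eq_iff)
      then show ?thesis unfolding gY by (intro kill[OF AB]) (use * in auto)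
    next
      assume "lie ?E (g Y) = - g Y"
      then have *: "A u = p" "- (A, B) = inner_D V u t - inner_D V p v" "B v = t"
        unfolding gY lie_off_diagonal[OF AB] by simp_all
      then have **: "(A, B) = inner_D V p v - inner_D V u t" by (metis minus_diff_eq minus_minus)
      then have "A u = Tp p v u - Tp u t u" "B v = - Tm v p v + Tm t u v"
        by (simp_all add: inner_D_def fun_eq_iff)
      then show ?thesis unfolding gY by (intro kill[OF AB]) (use * ** in auto)
    qed
    then have "g (lie ?c Y) = g 0" using a(5)[OF c(1) Yt] c(2) aut_zero[OF g] by simp
    from inj[OF this] show ?thesis using c(1) Yt by (simp add: tkk_closed)
  qed
  \<comment> \<open>\<open>C u = 0\<close> and \<open>C v = 0\<close> say that \<open>C\<close>
    commutes with \<open>u + v\<close>; so \<open>?c\<close> commutes with \<open>E\<close> and lies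
    in \<open>g_0\<close>.\<close>
  have "g (lie euler ?c) = lie ?E (0, C, 0)" using a(5)[OF euler_tkk c(1)] c(2) e by simp
  also have "\<dots> = g 0"
    using lie_off_diagonal[OF C0, of u v 0 0] Cuv aut_zero[OF g] by (simp add: zero_tkk_eq)
  finally have "lie euler ?c = 0" using inj[of "lie euler ?c" 0] c(1) by (simp add: tkk_closed)
  then have "?c \<in> grade_0 V" using c(1) by (simp add: grade_iff)
  then obtain A B where cAB: "?c = (0, (A, B), 0)" by (auto simp: grade_0_def)
  have "A z = 0" for z using k0[of "(z, 0, 0)"] by (simp add: cAB lie_def zero_tkk_eq)
  moreover have "B t = 0" for t using k0[of "(0, 0, t)"] by (simp add: cAB lie_def zero_tkk_eq)
  ultimately have "?c = 0" by (simp add: cAB zero_tkk_eq fun_eq_iff zero_prod_def)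
  then have "(0, C, 0) = (0::('v, 'w) tkk)" using c(2) aut_zero[OF g] by simp
  then have "C = 0" by (simp add: zero_tkk_eq)
  then show ?thesis by (simp add: C_def)
qed

subsection \<open>Invertible elements and Weyl elements\<close>

text \<open>\<open>D(x, y) = 2 E\<close>; for the pair of a Jordan algebra this says \<open>y = x\<^sup>-\<^sup>1\<close>.\<close>

definition inverse_pair :: "'v \<Rightarrow> 'w \<Rightarrow> bool" where
  "inverse_pair x y \<longleftrightarrow> (\<forall>z. Tp x y z = z + z) \<and> (\<forall>t. Tm y x t = t + t)"

lemma inverse_pairD: "inverse_pair x y \<Longrightarrow> Tp x y z = z + z" "inverse_pair x y \<Longrightarrow> Tm y x t = t + t"
  by (simp_all add: inverse_pair_def)

lemma inverse_pair_iff: "inverse_pair x y \<longleftrightarrow> inner_D V x y = euler0 + euler0"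
proof
  assume "inner_D V x y = euler0 + euler0"
  then have "Tp x y z = z + z" "- Tm y x t = - t - t" for z t
    by (simp_all add: inner_D_def fun_eq_iff)
  moreover have "(- a = - t - t) = (a = t + t)" for a t :: 'w by (metis minus_add_distrib minus_equation_iff uminus_add_conv_diff add.commute diff_conv_add_uminus)
  ultimately show "inverse_pair x y" by (simp add: inverse_pair_def)
qed (simp add: inverse_pair_def inner_D_def fun_eq_iff)

lemma inverse_pair_minus: "inverse_pair x y \<Longrightarrow> inverse_pair (- x) (- y)"
  by (simp add: inverse_pair_def)

lemma inverse_pair_double: "inverse_pair x y \<Longrightarrow> inverse_pair (x + x) (sm half y)"
  by (simp add: inverse_pair_def T_add half_add double_half)

abbreviation "Qp x t \<equiv> sp half (Tp x t x)"

text \<open>The inverse is the quadratic map of \<open>y\<close>: as \<open>D(x, y)\<close> acts by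
  2, the Jordan identity for \<open>T(p, y, T(x, y, x))\<close> reduces to
  \<open>T(x, T(y, p, y), x) = 4 p\<close>.\<close>

lemma inverse_pair_bij: assumes "inverse_pair x y" shows "bij (Qp x)"
proof (rule o_bij)
  note T = inverse_pairD[OF assms]
  show "Qp x \<circ> (\<lambda>p. sm half (Tm y p y)) = id"
  proof
    fix p
    have "Tp x (Tm y p y) x = (p + p) + (p + p)"
      using Tp_jordan[of p y x y x] T Tp_sym[of p y x] by (simp add: T_add)
    then show "(Qp x \<circ> (\<lambda>p. sm half (Tm y p y))) p = id p"
      by (simp add: scale_simps(7)[symmetric] double_half del: scale_simps(7))
  qed
  show "(\<lambda>p. sm half (Tm y p y)) \<circ> Qp x = id"
  proof
    fix p
    have "Tm y (Tp x p x) y = (p + p) + (p + p)"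
      using Tm_jordan[of p x y x y] T Tm_sym[of p x y] by (simp add: T_add)
    then show "((\<lambda>p. sm half (Tm y p y)) \<circ> Qp x) p = id p"
      by (simp add: scale_simps(8)[symmetric] double_half del: scale_simps(8))
  qed
qed

text \<open>From \<open>T(x, y, x) = 2 x\<close>, the Jordan identity and \<open>Tp_shift\<close>,
  \<open>T(x, y, -)\<close> is 2 on the image of \<open>Q(x)\<close>, which is everything;
  injectivity of \<open>Q(x)\<close> carries this over to \<open>V^-\<close>.\<close>

lemma inverse_pair_of_bij:
  assumes b: "bij (Qp x)" and y: "Qp x y = x" shows "inverse_pair x y"
proof -
  have xy: "Tp x y x = x + x" using half_add(1)[of "Tp x y x"] y by simp
  have X: "Tp x y (Tp x t x) = Tp x t x + Tp x t x" for t
  proof -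
    have "Tp x y (Tp x t x) + Tp x y (Tp x t x) = (Tp x t x + Tp x t x) + (Tp x t x + Tp x t x)"
      using Tp_jordan[of x y x t x] Tp_shift[of x y t] xy by (simp add: T_add algebra_simps)
    then show ?thesis by (rule double_inject)
  qed
  have "Tp x y z = z + z" for z
  proof -
    obtain t where "z = Qp x t" using surjD[OF bij_is_surj[OF b], of z] by blast
    then show ?thesis by (simp add: X scale_distrib)
  qed
  moreover have "Tm y x t = t + t" for t
  proof -
    have "Qp x (Tm y x t) = Qp x (t + t)"
      using Tp_shift[of x y t] X[of t] by (simp add: T_add)
    then show ?thesis using b by (simp add: bij_def inj_def)
  qed
  ultimately show ?thesis by (simp add: inverse_pair_def)
qed

lemma inverse_pair_Qp: "inverse_pair x y \<Longrightarrow> Qp x y = x"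
  by (simp add: inverse_pairD double_half)

section \<open>Elements of \<open>G\<close> reversing the grading\<close>

definition swap :: "(('v, 'w) tkk \<Rightarrow> ('v, 'w) tkk) set" where
  "swap = {w \<in> G. w euler = - euler}"

lemma swapD: "w \<in> swap \<Longrightarrow> w \<in> G" "w \<in> swap \<Longrightarrow> w \<in> aut" "w \<in> swap \<Longrightarrow> w euler = - euler"
  by (auto simp: swap_def G_aut)

lemma swap_mul: assumes "w \<in> swap" "w' \<in> swap" shows "w \<cdot> w' \<in> H"
proof -
  have "(w \<cdot> w') euler = w (- euler)"
    unfolding swapD(3)[OF assms(2), symmetric] using assms swapD(1) by (simp add: Bij_G)
  also have "\<dots> = euler" using aut_minus[OF swapD(2)[OF assms(1)] euler_tkk] swapD(3)[OF assms(1)] by simp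
  finally show ?thesis using assms swapD(1) by (simp add: H_grp_iff)
qed

lemma swap_inv: assumes "w \<in> swap" shows "ginv w \<in> swap"
proof -
  have "w (- euler) = euler" using aut_minus[OF swapD(2)[OF assms] euler_tkk] swapD(3)[OF assms] by simp
  then have "ginv w euler = - euler"
    using ginv_apply(2)[OF Bij_G[OF swapD(1)[OF assms]], of "- euler"] tkk_closed(3)[OF euler_tkk] by simp
  then show ?thesis using assms by (simp add: swap_def)
qed

lemma swap_H: "w \<in> swap \<Longrightarrow> h \<in> H \<Longrightarrow> h \<cdot> w \<in> swap"
  using H_aut[of h] aut_minus[of h euler] by (simp add: swap_def Bij_G)

text \<open>Two elements of \<open>swap\<close> differ by a factor in \<open>H\<close>, which fixes
  both base points. So a given grading reversal can be replaced by a Weyl element fitted to the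
  point at hand.\<close>

lemma swap_act:
  assumes "w \<in> swap" "w' \<in> swap" "g \<in> G"
  shows "(g \<cdot> w) \<star> op = (g \<cdot> w') \<star> op" "(g \<cdot> w) \<star> om = (g \<cdot> w') \<star> om"
proof -
  have h: "ginv w \<cdot> w' \<in> H" using assms swap_mul swap_inv by blast
  have "g \<cdot> w' = g \<cdot> w \<cdot> (ginv w \<cdot> w')" using assms swapD by (simp add: G_assoc)
  then show "(g \<cdot> w) \<star> op = (g \<cdot> w') \<star> op" "(g \<cdot> w) \<star> om = (g \<cdot> w') \<star> om"
    using h assms swapD by (metis act_fix G_closed(1))+
qed

lemma swap_exp:
  "w \<in> swap \<Longrightarrow> w \<cdot> ep u = em (snd (snd (w (u, 0, 0)))) \<cdot> w"
  "w \<in> swap \<Longrightarrow> w \<cdot> em v = ep (fst (w (0, 0, v))) \<cdot> w"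
  using aut_swap_euler_exp swapD by auto

text \<open>Conjugation by \<open>w\<close> turns exponentials of one sign into those of the other
  and preserves \<open>H\<close>.\<close>

lemma swap_P:
  assumes "w \<in> swap"
  shows "p \<in> P_m V \<Longrightarrow> ginv w \<cdot> (p \<cdot> w) \<in> P_p V" "p \<in> P_p V \<Longrightarrow> ginv w \<cdot> (p \<cdot> w) \<in> P_m V"
proof -
  note w = swapD(1)[OF assms] and w' = swap_inv[OF assms]
  have h: "ginv w \<cdot> (h \<cdot> w) \<in> H" if "h \<in> H" for h
    using that assms w' swap_H swap_mul by blast
  have *: "ginv w \<cdot> (e \<cdot> h \<cdot> w) = ginv w \<cdot> e \<cdot> (h \<cdot> w)" if "e \<in> G" "h \<in> H" for e h
    using that w by (simp add: G_assoc)
  show "ginv w \<cdot> (p \<cdot> w) \<in> P_p V" if "p \<in> P_m V"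
  proof -
    obtain v k where k: "k \<in> H" "p = em v \<cdot> k" using \<open>p \<in> P_m V\<close> by (auto simp: P_m_cases)
    have "ginv w \<cdot> (p \<cdot> w) = ginv w \<cdot> em v \<cdot> (k \<cdot> w)" unfolding k(2) using k(1) by (simp add: *)
    also have "\<dots> = ep (fst (ginv w (0, 0, v))) \<cdot> (ginv w \<cdot> (k \<cdot> w))"
      unfolding swap_exp(2)[OF w'] using k w by (simp add: G_assoc)
    finally have "ginv w \<cdot> (p \<cdot> w) = ep (fst (ginv w (0, 0, v))) \<cdot> (ginv w \<cdot> (k \<cdot> w))" .
    then show ?thesis using h[OF k(1)] unfolding P_p_cases by blast
  qed
  show "ginv w \<cdot> (p \<cdot> w) \<in> P_m V" if "p \<in> P_p V"
  proof -
    obtain v k where k: "k \<in> H" "p = ep v \<cdot> k" using \<open>p \<in> P_p V\<close> by (auto simp: P_p_cases)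
    have "ginv w \<cdot> (p \<cdot> w) = ginv w \<cdot> ep v \<cdot> (k \<cdot> w)" unfolding k(2) using k(1) by (simp add: *)
    also have "\<dots> = em (snd (snd (ginv w (v, 0, 0)))) \<cdot> (ginv w \<cdot> (k \<cdot> w))"
      unfolding swap_exp(1)[OF w'] using k w by (simp add: G_assoc)
    finally have "ginv w \<cdot> (p \<cdot> w) = em (snd (snd (ginv w (v, 0, 0)))) \<cdot> (ginv w \<cdot> (k \<cdot> w))" .
    then show ?thesis using h[OF k(1)] unfolding P_m_cases by blast
  qed
qed

definition weyl :: "'v \<Rightarrow> 'w \<Rightarrow> ('v, 'w) tkk \<Rightarrow> ('v, 'w) tkk" where
  "weyl x y = ep x \<cdot> (em (- y) \<cdot> ep x)"

text \<open>\<open>E\<close> moves to \<open>E - x\<close>, then to \<open>- E - x\<close>, then to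
  \<open>- E\<close>; the middle step uses \<open>D(x, y) = 2 E\<close> and
  \<open>T(y, x, y) = 2 y\<close>.\<close>

lemma weyl_swap: assumes "inverse_pair x y" shows "weyl x y \<in> swap"
proof -
  note T = inverse_pairD[OF assms] and D = assms[unfolded inverse_pair_iff]
  have n: "- euler0 \<in> tkk0 V" using tkk0_closed(4)[OF tkk0_closed(6)] .
  have s: "euler0 - (euler0 + euler0) = - euler0" by (rule diff_eq_eq[THEN iffD2]) (simp add: fun_eq_iff)
  have "em (- y) (- x, euler0, 0) = (- x, euler0 - inner_D V x y, - y + sm half (Tm y x y))"
    by (simp add: exp_apply(2)[OF tkk0_closed(6)] del: diff_Pair)
  also have "\<dots> = (- x, - euler0, 0)" by (simp only: D s T double_half) simp
  finally have "weyl x y euler = ep x (- x, - euler0, 0)"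
    by (simp add: weyl_def Bij_G exp_euler)
  also have "\<dots> = - euler" using exp_apply(1)[OF n] by simp
  finally show ?thesis by (simp add: swap_def weyl_def)
qed

text \<open>The dual chain \<open>E\<close>, \<open>E + y\<close>, \<open>- E + y\<close>,
  \<open>- E\<close>. This form absorbs \<open>exp(-x')\<close> in
  \<open>U_mult_inverse_pair\<close>.\<close>

lemma weyl_swap': assumes "inverse_pair x y" shows "em y \<cdot> (ep (- x) \<cdot> em y) \<in> swap"
proof -
  note T = inverse_pairD[OF assms] and D = assms[unfolded inverse_pair_iff]
  have n: "- euler0 \<in> tkk0 V" using tkk0_closed(4)[OF tkk0_closed(6)] .
  have s: "euler0 - (euler0 + euler0) = - euler0" by (rule diff_eq_eq[THEN iffD2]) (simp add: fun_eq_iff)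
  have "ep (- x) (0, euler0, y) = (x - sp half (Tp x y x), euler0 - inner_D V x y, y)"
    by (simp add: exp_apply(1)[OF tkk0_closed(6)] del: diff_Pair)
  also have "\<dots> = (0, - euler0, y)" by (simp only: D s T double_half) simp
  finally have "(em y \<cdot> (ep (- x) \<cdot> em y)) euler = em y (0, - euler0, y)"
    by (simp add: Bij_G exp_euler)
  also have "\<dots> = - euler" using exp_apply(2)[OF n] by simp
  finally show ?thesis by (simp add: swap_def)
qed

text \<open>All three exponents change sign, and the word is a palindrome.\<close>

lemma tw_weyl: "tw (weyl x y) = ginv (weyl x y)"
  by (simp add: weyl_def G_inv_mult exp_inv G_assoc)

text \<open>Compare the \<open>g\<^sub>-\<^sub>1\<close>-components of \<open>w\<^sup>-\<^sup>1 exp(u) = exp(y) exp(v) h\<close> on \<open>g\<^sub>-\<^sub>1\<close>: the left-hand side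
  gives \<open>- w\<^sup>-\<^sup>1 Q(u)\<close> and the right-hand side \<open>h\<close>.\<close>

lemma transversal_swap_bij:
  assumes f: "f \<in> G" and w: "w \<in> swap" and t: "transversal V ((f \<cdot> ep u) \<star> op) ((f \<cdot> w) \<star> om)"
  shows "bij (Qp u)"
proof -
  have wG: "w \<in> G" using swapD(1)[OF w] .
  obtain y where y: "(f \<cdot> ep u) \<star> op = (f \<cdot> w \<cdot> ep y) \<star> op"
    using transversal_om[OF t] f wG by auto
  obtain v h where h: "h \<in> H" and e: "f \<cdot> ep u = f \<cdot> w \<cdot> ep y \<cdot> em v \<cdot> h"
    using act_op_eqE[OF y[symmetric]] f wG by (metis G_closed(1) exp_G(1))
  from e have "f \<cdot> ep u = f \<cdot> (w \<cdot> (ep y \<cdot> (em v \<cdot> h)))" using f wG h by (simp add: G_assoc)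
  then have "ep u = w \<cdot> (ep y \<cdot> (em v \<cdot> h))"
    using f wG h G_left_cancel[of f "ep u" "w \<cdot> (ep y \<cdot> (em v \<cdot> h))"] by simp
  then have e': "ginv w \<cdot> ep u = ep y \<cdot> (em v \<cdot> h)" using wG h by simp
  note w' = swap_inv[OF w]
  note a' = autD[OF swapD(2)[OF w']] and sg = aut_swap_euler_grade[OF swapD(2)[OF w'] swapD(3)[OF w']]
  note hb = Bij_G[OF H_G[OF h]] and hb' = Bij_G[OF H_G[OF H_closed(2)[OF h]]]
  have hm: "k (0, 0, s) = (0, 0, lm k s)" if "k \<in> H" for k s
    using aut_fix_euler_grade(2)[OF H_aut[OF that], of "(0, 0, s)"] by (simp add: grade_p_iff)
  have key: "lm h s = snd (snd (ginv w (- Qp u s, 0, 0)))" for s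
  proof -
    have R: "(ep y \<cdot> (em v \<cdot> h)) (0, 0, s) = ep y (em v (0, 0, lm h s))"
      unfolding hm[OF h, of s, symmetric] using h hb by (simp add: Bij_G)
    have em: "em v (0, 0, s') = (0, 0, s')" for s' using exp_apply(2)[OF tkk0_closed(1)] by simp
    have D: "(0, inner_D V u s, 0) \<in> grade_0 V" by (simp add: grade_0_def tkk0_closed)
    then have D': "(0, inner_D V u s, 0) \<in> tkk V" by (simp add: grade_iff)
    have "(ginv w \<cdot> ep u) (0, 0, s) = ginv w (ep u (0, 0, s))" using wG by (simp add: Bij_G)
    \<comment> \<open>Of the three homogeneous parts of \<open>exp(u) s\<close>, only the one in
      \<open>g_1\<close> is sent into \<open>g_-1\<close> by the grading reversal.\<close>
    also have "ep u (0, 0, s) = (- Qp u s, 0, 0) + ((0, inner_D V u s, 0) + (0, 0, s))"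
      using exp_apply(1)[OF tkk0_closed(1)] by simp
    also have "ginv w \<dots> = ginv w (- Qp u s, 0, 0) + (ginv w (0, inner_D V u s, 0) + ginv w (0, 0, s))"
      unfolding a'(3)[OF grade_tkk(1) tkk_closed(1)[OF D' grade_tkk(2)]] a'(3)[OF D' grade_tkk(2)] ..
    finally have "snd (snd ((ginv w \<cdot> ep u) (0, 0, s))) =
        snd (snd (ginv w (- Qp u s, 0, 0))) + (snd (snd (ginv w (0, inner_D V u s, 0))) + snd (snd (ginv w (0, 0, s))))"
      by simp
    moreover have "snd (snd (ginv w (0, inner_D V u s, 0))) = 0"
      using sg(3)[OF D] by (auto simp: grade_0_def)
    moreover have "snd (snd (ginv w (0, 0, s))) = 0"
      using sg(2)[of "(0, 0, s)"] by (auto simp: grade_p_def)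
    moreover have "snd (snd ((ep y \<cdot> (em v \<cdot> h)) (0, 0, s))) = lm h s"
      unfolding R em using exp_apply(1)[OF tkk0_closed(1)] by simp
    ultimately show ?thesis unfolding e' by simp
  qed
  have wp: "ginv w (z, 0, 0) = (0, 0, snd (snd (ginv w (z, 0, 0))))" for z
    using sg(1)[of "(z, 0, 0)"] by (simp add: grade_p_iff)
  show ?thesis
  proof (rule bijI)
    show "inj (Qp u)"
    proof (rule injI)
      fix s s' assume "Qp u s = Qp u s'"
      then have "lm h s = lm h s'" unfolding key by simp
      then have "(0, 0, lm h s) = (0::'v, 0::('v \<Rightarrow> 'v) \<times> ('w \<Rightarrow> 'w), lm h s')" by simp
      then have "h (0, 0, s) = h (0, 0, s')" unfolding hm[OF h, symmetric] .
      then have "ginv h (h (0, 0, s)) = ginv h (h (0, 0, s'))" by (rule arg_cong)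
      then show "s = s'" unfolding ginv_apply(2)[OF hb grade_tkk(2)] by simp
    qed
    show "surj (Qp u)"
    proof (rule surjI)
      fix z
      define r where "r = snd (snd (ginv w (- z, 0, 0)))"
      define s where "s = lm (ginv h) r"
      have "h (0, 0, s) = (0, 0, r)"
        unfolding s_def hm[OF H_closed(2)[OF h], symmetric] by (rule ginv_apply(1)[OF hb]) simp
      then have "lm h s = r" by simp
      then have "(0, 0, snd (snd (ginv w (- Qp u s, 0, 0)))) =
          (0::'v, 0::('v \<Rightarrow> 'v) \<times> ('w \<Rightarrow> 'w), snd (snd (ginv w (- z, 0, 0))))"
        unfolding key[symmetric] r_def by simp
      then have "ginv w (- Qp u s, 0, 0) = ginv w (- z, 0, 0)" unfolding wp[symmetric] .
      then have "w (ginv w (- Qp u s, 0, 0)) = w (ginv w (- z, 0, 0))" by (rule arg_cong)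
      then have "Qp u s = z" unfolding ginv_apply(1)[OF Bij_G[OF wG] grade_tkk(1)] by simp
      then show "Qp u (lm (ginv h) (snd (snd (ginv w (- z, 0, 0))))) = z" by (simp add: s_def r_def)
    qed
  qed
qed

text \<open>The other components need no computation: a grading reversal sends \<open>g_-1\<close>
  into \<open>g_1\<close>, so they vanish, and this forces \<open>s = 0\<close> and
  \<open>N = 0\<close> in the remaining one.\<close>

lemma weyl_apply:
  assumes "inverse_pair x y" shows "weyl x y (0, 0, t) = (- Qp x t, 0, 0)"
proof -
  define N where "N = inner_D V x t - inner_D V (- Qp x t) (- y)"
  define s where "s = snd (snd (em (- y) (- Qp x t, inner_D V x t, t)))"
  have N: "N \<in> tkk0 V" unfolding N_def by (rule tkk0_closed(3)[OF tkk0_closed(7) tkk0_closed(7)])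
  have 1: "ep x (0, 0, t) = (- Qp x t, inner_D V x t, t)"
    using exp_apply(1)[OF tkk0_closed(1)] by simp
  have 2: "em (- y) (- Qp x t, inner_D V x t, t) = (- Qp x t, N, s)"
    unfolding N_def s_def exp_apply(2)[OF tkk0_closed(7)] by (simp only: fst_conv snd_conv)
  have 3: "ep x (- Qp x t, N, s) = (- Qp x t - fst N x - Qp x s, N + inner_D V x s, s)"
    by (rule exp_apply(1)[OF N])
  have w: "weyl x y (0, 0, t) = (- Qp x t - fst N x - Qp x s, N + inner_D V x s, s)"
    unfolding 3[symmetric] 2[symmetric] 1[symmetric] by (simp add: weyl_def Bij_G exp_closed)
  have "weyl x y (0, 0, t) \<in> grade_p V"
    by (rule aut_swap_euler_grade(2)[OF swapD(2)[OF weyl_swap[OF assms]] swapD(3)[OF weyl_swap[OF assms]]]) simp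
  then have s: "s = 0" and "N = 0" unfolding w by (auto simp: grade_p_def)
  then show ?thesis using w by simp
qed

end

section \<open>The polarity defined by a Weyl element\<close>

text \<open>In the coordinates given by \<open>f\<close>, the points \<open>a\<close> and
  \<open>b\<close> play the roles of infinity and zero. The assumption on \<open>tw w\<close> makes
  \<open>k \<mapsto> tw k \<cdot> w\<close> an involution; Weyl elements satisfy it by
  \<open>tw_weyl\<close>.\<close>

locale jordan_pair_swap = jordan_pair_space V
  for V :: "('k::comm_ring_1, 'v::ab_group_add, 'w::ab_group_add) jpair" +
  fixes f w :: "('v, 'w) tkk \<Rightarrow> ('v, 'w) tkk"
  assumes f: "f \<in> G" and w: "w \<in> swap" and tw_w: "tw w = ginv w"
begin

abbreviation "a \<equiv> f \<star> om"
abbreviation "b \<equiv> (f \<cdot> w) \<star> om"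

lemma wG [simp]: "w \<in> G"
  using swapD(1)[OF w] .

lemma fG [simp]: "f \<in> G"
  by (rule f)

text \<open>Replacing \<open>w\<close> by the Weyl element of \<open>u\<close> shows that, in the
  chart at \<open>f exp(u).o^+\<close> with origin \<open>a\<close>, the point \<open>b\<close> has
  coordinate \<open>-y\<close>.\<close>

lemma b_weyl: assumes "inverse_pair u y" shows "b = (f \<cdot> ep u \<cdot> em (- y)) \<star> om"
proof -
  have "b = (f \<cdot> weyl u y) \<star> om" using swap_act(2)[OF w weyl_swap[OF assms]] by simp
  also have "f \<cdot> weyl u y = f \<cdot> ep u \<cdot> em (- y) \<cdot> ep u" by (simp add: weyl_def G_assoc)
  also have "\<dots> \<star> om = (f \<cdot> ep u \<cdot> em (- y)) \<star> om" by simp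
  finally show ?thesis .
qed

text \<open>Transversality to \<open>b\<close> makes \<open>Q(u)\<close> bijective by
  \<open>transversal_swap_bij\<close>, and the preimage of \<open>u\<close> is its inverse.
  Conversely \<open>b_weyl\<close> exhibits \<open>b\<close> in the chart at the point.\<close>

lemma U_set_inverse_pair:
  "x \<in> U_set V a b \<longleftrightarrow> (\<exists>u y. inverse_pair u y \<and> x = (f \<cdot> ep u) \<star> op)"
proof
  assume x: "x \<in> U_set V a b"
  then obtain u where u: "x = (f \<cdot> ep u) \<star> op" by (auto simp: U_set_iff elim: transversal_om)
  then have "bij (Qp u)" using x transversal_swap_bij[OF f w] by (simp add: U_set_iff)
  then obtain y where "Qp u y = u" using surjD[OF bij_is_surj, of "Qp u" u] by metis
  then show "\<exists>u y. inverse_pair u y \<and> x = (f \<cdot> ep u) \<star> op"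
    using inverse_pair_of_bij \<open>bij (Qp u)\<close> u by blast
next
  assume "\<exists>u y. inverse_pair u y \<and> x = (f \<cdot> ep u) \<star> op"
  then obtain u y where uy: "inverse_pair u y" "x = (f \<cdot> ep u) \<star> op" by blast
  show "x \<in> U_set V a b" unfolding U_set_iff uy(2) b_weyl[OF uy(1)] by simp
qed

lemma midpt_inverse_pair:
  assumes "inverse_pair u y"
  shows "midpt V a b ((f \<cdot> ep u) \<star> op) = (f \<cdot> ep u \<cdot> em (- sm half y)) \<star> om"
  using midpt_eq[of "f \<cdot> ep u" 0 "- y"] by (simp add: b_weyl[OF assms])

text \<open>In the coordinates given by \<open>f\<close>, this is \<open>z \<mapsto> -z\<close> followed by right multiplication by \<open>w\<close>.\<close>

definition q :: "('v, 'w) point \<Rightarrow> ('v, 'w) point" where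
  "q z = (SOME c. \<exists>k\<in>G. z = (f \<cdot> k) \<star> op \<and> c = (f \<cdot> (tw k \<cdot> w)) \<star> om)"

lemma tw_w_cancel [simp]: "g \<in> G \<Longrightarrow> tw w \<cdot> (w \<cdot> g) = g" "tw w \<cdot> w = \<^bold>1"
  by (simp_all add: tw_w)

text \<open>With \<open>p = k^-1 k'\<close>, the left side asks for \<open>w^-1 (tw p) w\<close> in
  \<open>P^+\<close>, the right side for \<open>p\<close> in \<open>P^-\<close>; \<open>tw\<close>
  preserves both subgroups and \<open>w\<close> exchanges them. The first part makes
  \<open>q\<close> well defined and injective; the second is its dual.\<close>

lemma q_inject:
  assumes "k \<in> G" "k' \<in> G"
  shows "(f \<cdot> (tw k \<cdot> w)) \<star> om = (f \<cdot> (tw k' \<cdot> w)) \<star> om \<longleftrightarrow> (f \<cdot> k) \<star> op = (f \<cdot> k') \<star> op"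
    "(f \<cdot> (tw k \<cdot> w)) \<star> op = (f \<cdot> (tw k' \<cdot> w)) \<star> op \<longleftrightarrow> (f \<cdot> k) \<star> om = (f \<cdot> k') \<star> om"
proof -
  let ?p = "ginv k \<cdot> k'"
  have p: "?p \<in> G" using assms by simp
  have 1: "ginv (f \<cdot> (tw k \<cdot> w)) \<cdot> (f \<cdot> (tw k' \<cdot> w)) = ginv w \<cdot> (tw ?p \<cdot> w)"
    "ginv (f \<cdot> k) \<cdot> (f \<cdot> k') = ?p"
    using assms by (simp_all add: G_inv_mult G_assoc)
  have c: "ginv (ginv w) \<cdot> (ginv w \<cdot> (tw ?p \<cdot> w) \<cdot> ginv w) = tw ?p"
    using p by (simp add: G_assoc)
  note sw = swap_P[OF w, of "tw ?p"] swap_P[OF swap_inv[OF w], of "ginv w \<cdot> (tw ?p \<cdot> w)", unfolded c]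
  have t: "tw ?p \<in> P_m V \<longleftrightarrow> ?p \<in> P_m V" "tw ?p \<in> P_p V \<longleftrightarrow> ?p \<in> P_p V"
    using tw_P[of ?p] tw_P[of "tw ?p", unfolded tw_tw[OF p]] by blast+
  have 2: "ginv w \<cdot> (tw ?p \<cdot> w) \<in> P_p V \<longleftrightarrow> ?p \<in> P_m V" "ginv w \<cdot> (tw ?p \<cdot> w) \<in> P_m V \<longleftrightarrow> ?p \<in> P_p V"
    using sw unfolding t[symmetric] by blast+
  show "(f \<cdot> (tw k \<cdot> w)) \<star> om = (f \<cdot> (tw k' \<cdot> w)) \<star> om \<longleftrightarrow> (f \<cdot> k) \<star> op = (f \<cdot> k') \<star> op"
    using assms 2 act_om_eq[of "f \<cdot> (tw k \<cdot> w)" "f \<cdot> (tw k' \<cdot> w)", unfolded 1(1)]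
      act_op_eq[of "f \<cdot> k" "f \<cdot> k'", unfolded 1(2)] by auto
  show "(f \<cdot> (tw k \<cdot> w)) \<star> op = (f \<cdot> (tw k' \<cdot> w)) \<star> op \<longleftrightarrow> (f \<cdot> k) \<star> om = (f \<cdot> k') \<star> om"
    using assms 2 act_op_eq[of "f \<cdot> (tw k \<cdot> w)" "f \<cdot> (tw k' \<cdot> w)", unfolded 1(1)]
      act_om_eq[of "f \<cdot> k" "f \<cdot> k'", unfolded 1(2)] by auto
qed

lemma q_eq: assumes "k \<in> G" shows "q ((f \<cdot> k) \<star> op) = (f \<cdot> (tw k \<cdot> w)) \<star> om"
  unfolding q_def
proof (rule some_equality)
  show "\<exists>k'\<in>G. (f \<cdot> k) \<star> op = (f \<cdot> k') \<star> op \<and> (f \<cdot> (tw k \<cdot> w)) \<star> om = (f \<cdot> (tw k' \<cdot> w)) \<star> om"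
    using assms by blast
qed (use assms q_inject(1) in blast)

lemma G_frame: "K \<in> G \<Longrightarrow> \<exists>k\<in>G. K = f \<cdot> k"
  by (rule bexI[of _ "ginv f \<cdot> K"]) simp_all

lemma X_p_frame: "X_p V = {(f \<cdot> k) \<star> op | k. k \<in> G}" and X_m_frame: "X_m V = {(f \<cdot> k) \<star> om | k. k \<in> G}"
  using G_frame by (fastforce simp: X_p_eq X_m_eq)+

lemma q_surj: "k \<in> G \<Longrightarrow> q ((f \<cdot> (tw k \<cdot> w)) \<star> op) = (f \<cdot> k) \<star> om"
  using q_eq[of "tw k \<cdot> w"] by (simp add: G_assoc)

lemma q_bij: "bij_betw q (X_p V) (X_m V)"
proof (rule bij_betw_imageI)
  show "inj_on q (X_p V)" by (auto simp: inj_on_def X_p_frame q_eq q_inject)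
  show "q ` X_p V = X_m V"
  proof
    show "q ` X_p V \<subseteq> X_m V" by (force simp: X_p_frame X_m_frame q_eq)
    show "X_m V \<subseteq> q ` X_p V"
    proof
      fix c assume "c \<in> X_m V"
      then obtain k where k: "k \<in> G" "c = (f \<cdot> k) \<star> om" by (auto simp: X_m_frame)
      have "(f \<cdot> (tw k \<cdot> w)) \<star> op \<in> X_p V" using k(1) by (auto simp: X_p_eq)
      then show "c \<in> q ` X_p V" using q_surj[OF k(1)] k(2) by (metis imageI)
    qed
  qed
qed

lemma q_inv_eq: assumes "k \<in> G"
  shows "inv_into (X_p V) q ((f \<cdot> k) \<star> om) = (f \<cdot> (tw k \<cdot> w)) \<star> op"
proof (rule inv_into_f_eq)
  show "inj_on q (X_p V)" using q_bij by (simp add: bij_betw_def)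
  show "(f \<cdot> (tw k \<cdot> w)) \<star> op \<in> X_p V" using assms by (auto simp: X_p_eq)
qed (rule q_surj[OF assms])

lemma q_transversal:
  assumes "x \<in> X_p V" "c \<in> X_m V"
  shows "transversal V x c \<longleftrightarrow> transversal V (inv_into (X_p V) q c) (q x)"
proof
  assume "transversal V x c"
  then obtain k where k: "k \<in> G" "x = (f \<cdot> k) \<star> op" "c = (f \<cdot> k) \<star> om"
    using G_frame by (auto simp: transversal_iff)
  show "transversal V (inv_into (X_p V) q c) (q x)"
    unfolding k(2,3) q_eq[OF k(1)] q_inv_eq[OF k(1)] using k(1) by simp
next
  assume "transversal V (inv_into (X_p V) q c) (q x)"
  then obtain k where k: "k \<in> G" "inv_into (X_p V) q c = (f \<cdot> k) \<star> op" "q x = (f \<cdot> k) \<star> om"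
    using G_frame by (metis transversal_iff)
  have "c = q ((f \<cdot> k) \<star> op)"
    using k(2) assms(2) q_bij by (metis bij_betw_inv_into_right)
  moreover have "x = inv_into (X_p V) q ((f \<cdot> k) \<star> om)"
    using k(3) assms(1) q_bij by (metis bij_betw_inv_into_left)
  ultimately show "transversal V x c" using k(1) by (simp add: q_eq q_inv_eq)
qed

lemma exp_swap:
  "ep u \<cdot> w = w \<cdot> em (snd (snd (ginv w (u, 0, 0))))" "em v \<cdot> w = w \<cdot> ep (fst (ginv w (0, 0, v)))"
proof -
  have "w \<cdot> (ginv w \<cdot> ep u) \<cdot> w = w \<cdot> (em (snd (snd (ginv w (u, 0, 0)))) \<cdot> ginv w) \<cdot> w"
    "w \<cdot> (ginv w \<cdot> em v) \<cdot> w = w \<cdot> (ep (fst (ginv w (0, 0, v))) \<cdot> ginv w) \<cdot> w"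
    using swap_exp[OF swap_inv[OF w]] by simp_all
  then show "ep u \<cdot> w = w \<cdot> em (snd (snd (ginv w (u, 0, 0))))"
    "em v \<cdot> w = w \<cdot> ep (fst (ginv w (0, 0, v)))"
    by (simp_all add: G_assoc)
qed

text \<open>In the charts at \<open>f k\<close> and \<open>f (tw k) w\<close>, \<open>q\<close> and
  its inverse are the linear maps \<open>- w^-1\<close>; hence they preserve affine combinations
  (\<open>q_Pi_p\<close>, \<open>q_Pi_m\<close>).\<close>

lemma q_exp:
  assumes "k \<in> G"
  shows "q ((f \<cdot> k \<cdot> ep u) \<star> op) = (f \<cdot> (tw k \<cdot> w) \<cdot> em (snd (snd (ginv w (- u, 0, 0))))) \<star> om"
    "inv_into (X_p V) q ((f \<cdot> k \<cdot> em v) \<star> om) = (f \<cdot> (tw k \<cdot> w) \<cdot> ep (fst (ginv w (0, 0, - v)))) \<star> op"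
  using assms q_eq[of "k \<cdot> ep u"] q_inv_eq[of "k \<cdot> em v"]
  by (simp_all add: G_assoc exp_swap)

lemma q_Pi_p:
  assumes "transversal V x c" "transversal V y c"
  shows "q (aff_p V r x c y) = aff_m V r (q x) (inv_into (X_p V) q c) (q y)"
proof -
  obtain k where k: "k \<in> G" "c = (f \<cdot> k) \<star> om"
    using assms(1) G_frame by (auto simp: transversal_iff)
  obtain u u' where u: "x = (f \<cdot> k \<cdot> ep u) \<star> op" "y = (f \<cdot> k \<cdot> ep u') \<star> op"
    using assms k transversal_om[of _ "f \<cdot> k"] by (metis G_closed(1) fG)
  have l: "- (sp (1 - r) u + sp r u') = sp (1 - r) (- u) + sp r (- u')" by simp
  show ?thesis
    unfolding k(2) u using k(1)
    by (simp only: aff_p_eq aff_m_eq q_exp q_inv_eq G_closed tw_G fG wG l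
        aut_component_linear(3)[OF swapD(2)[OF swap_inv[OF w]]])
qed

lemma q_Pi_m:
  assumes "transversal V x c" "transversal V x d"
  shows "inv_into (X_p V) q (aff_m V r c x d) =
    aff_p V r (inv_into (X_p V) q c) (q x) (inv_into (X_p V) q d)"
proof -
  obtain k where k: "k \<in> G" "x = (f \<cdot> k) \<star> op"
    using assms(1) G_frame by (auto simp: transversal_iff)
  obtain u u' where u: "c = (f \<cdot> k \<cdot> em u) \<star> om" "d = (f \<cdot> k \<cdot> em u') \<star> om"
    using assms k transversal_op[of "f \<cdot> k"] by (metis G_closed(1) fG)
  have l: "- (sm (1 - r) u + sm r u') = sm (1 - r) (- u) + sm r (- u')" by simp
  show ?thesis
    unfolding k(2) u using k(1)
    by (simp only: aff_p_eq aff_m_eq q_exp q_eq G_closed tw_G fG wG l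
        aut_component_linear(4)[OF swapD(2)[OF swap_inv[OF w]]])
qed

text \<open>\<open>q\<close> sends \<open>f exp(u).o^+\<close> to \<open>f exp(-u) w.o^-\<close>.
  With \<open>w\<close> replaced by the Weyl element of \<open>2u\<close>, whose inverse is
  \<open>y/2\<close>, the product \<open>exp(-u) exp(2u)\<close> becomes \<open>exp(u)\<close>, and
  the next factor \<open>exp(-y/2)\<close> leads to the midpoint.\<close>

lemma q_midpt:
  assumes "x \<in> U_set V a b" shows "q x = midpt V a b x"
proof -
  obtain u y where uy: "inverse_pair u y" and x: "x = (f \<cdot> ep u) \<star> op"
    using assms U_set_inverse_pair by blast
  let ?w = "weyl (u + u) (sm half y)"
  have "q x = (f \<cdot> ep (- u) \<cdot> w) \<star> om" using q_eq[of "ep u"] by (simp add: x G_assoc)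
  also have "\<dots> = (f \<cdot> ep (- u) \<cdot> ?w) \<star> om"
    using swap_act(2)[OF w weyl_swap[OF inverse_pair_double[OF uy]]] by simp
  also have "f \<cdot> ep (- u) \<cdot> ?w = f \<cdot> ep u \<cdot> em (- sm half y) \<cdot> ep (u + u)"
    by (simp add: weyl_def G_assoc)
  also have "\<dots> \<star> om = midpt V a b x" by (simp add: x midpt_inverse_pair[OF uy])
  finally show ?thesis .
qed

lemma U_set_transversal_q: "x \<in> U_set V a b \<Longrightarrow> transversal V x (q x)"
proof -
  assume x: "x \<in> U_set V a b"
  obtain g t where "g \<in> G" "x = g \<star> op" "a = (g \<cdot> em (- t)) \<star> om" "b = (g \<cdot> em t) \<star> om"
    using U_set_frame[OF x] .
  then show ?thesis using frame_U_set(2)[of g a t b] q_midpt[OF x] by simp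
qed

lemma q_polarity:
  assumes "U_set V a b \<noteq> {}" shows "polarity (jp_geometry V) q"
proof -
  obtain x where "x \<in> U_set V a b" using assms by blast
  then have x: "x \<in> X_p V" "transversal V x (q x)"
    using U_set_transversal_q by (auto simp: X_p_eq U_set_iff transversal_iff)
  show ?thesis
    unfolding polarity_def geometry_iso_def nbh_p_def nbh_m_def jp_geometry_def dual_geometry_def
      geometry.simps mem_Collect_eq Ball_def Bex_def
    using q_bij bij_betw_inv_into[OF q_bij] q_Pi_p q_Pi_m q_transversal x by (intro conjI allI impI) blast+
qed

section \<open>Points transversal to their image under the polarity\<close>

lemma polar_set_subset:
  assumes z: "z \<in> X_p V" and t: "transversal V z (q z)"
  shows "z \<in> U_set V a b"
proof -
  obtain K where K: "K \<in> G" and zK: "z = (f \<cdot> K) \<star> op" and qz: "q z = (f \<cdot> K) \<star> om"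
    using t G_frame by (metis transversal_iff)
  have "(f \<cdot> K) \<star> om = (f \<cdot> (tw K \<cdot> w)) \<star> om" using qz unfolding zK q_eq[OF K] by simp
  moreover have "z = inv_into (X_p V) q (q z)" using bij_betw_inv_into_left[OF q_bij z] by simp
  then have "(f \<cdot> K) \<star> op = (f \<cdot> (tw K \<cdot> w)) \<star> op" unfolding qz q_inv_eq[OF K] using zK by simp
  \<comment> \<open>\<open>K\<close> and \<open>(tw K) w\<close> are both frames for
    \<open>(z, q(z))\<close>, relative to \<open>f\<close>, so they differ by an element of
    \<open>H\<close> and agree up to the sign of \<open>w E\<close> at \<open>E\<close>.\<close>
  ultimately obtain h where h: "h \<in> H" "f \<cdot> (tw K \<cdot> w) = f \<cdot> K \<cdot> h"
    using frame_eqE[of "f \<cdot> K" "f \<cdot> (tw K \<cdot> w)"] K by auto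
  then have "f \<cdot> (tw K \<cdot> w) = f \<cdot> (K \<cdot> h)" using K by (simp add: G_assoc)
  then have eq: "tw K \<cdot> w = K \<cdot> h" using K h G_left_cancel[of f "tw K \<cdot> w" "K \<cdot> h"] by simp
  obtain u N v where KE: "K euler = (u, N, v)" by (metis prod.exhaust)
  have KEt: "(u, N, v) \<in> tkk V" using autD(2)[OF G_aut[OF K] euler_tkk] KE by simp
  \<comment> \<open>At \<open>E\<close> the element \<open>(tw K) w\<close> has the value
    \<open>- rho (K E)\<close>, which is \<open>K E\<close> with the sign of its
    \<open>g_0\<close>-part changed.\<close>
  have "(tw K \<cdot> w) euler = tw K (- euler)"
    unfolding swapD(3)[OF w, symmetric] using K by (simp add: Bij_G)
  also have "\<dots> = - rho (u, N, v)"
    using aut_minus[OF G_aut[OF tw_G[OF K]] euler_tkk] tw_apply_euler[OF K] KE by simp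
  also have "\<dots> = (u, - N, v)" using rho_apply[OF KEt] by simp
  finally have "(u, - N, v) = (u, N, v)"
    using eq K h H_aut(2)[OF h(1)] by (simp add: Bij_G KE)
  then have "N = 0"
  proof -
    assume "(u, - N, v) = (u, N, v)"
    then have "- N = N" by simp
    then have "N + N = 0" using add.left_inverse[of N] by simp
    then have "fst N z + fst N z = 0" "snd N t + snd N t = 0" for z t
      by (metis fst_add fst_zero plus_fun_apply zero_fun_apply, metis snd_add snd_zero plus_fun_apply zero_fun_apply)
    then show "N = 0" by (simp add: prod_eq_iff fun_eq_iff)
  qed
  with KE have KE: "K euler = (u, 0, v)" by simp
  have D: "inner_D V u v + inner_D V u v = euler0"
    by (rule euler_conjugate_off_diagonal[OF G_aut[OF K] KE])
  \<comment> \<open>\<open>D(-2u, -2v) = 4 D(u, v) = 2 E\<close>. The sign is the one for which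
    \<open>exp(x) exp(v) E = u + v\<close>.\<close>
  define x y where "x = - (u + u)" and "y = - (v + v)"
  have xy: "inverse_pair x y"
  proof -
    have "inner_D V x y = (inner_D V u v + inner_D V u v) + (inner_D V u v + inner_D V u v)"
      by (simp add: x_def y_def inner_D_add algebra_simps)
    then show ?thesis unfolding D inverse_pair_iff .
  qed
  have xv: "inner_D V x v = - euler0" unfolding x_def D[symmetric] by (simp add: inner_D_add)
  have Tu: "Tp u v u + Tp u v u = u"
    using arg_cong[OF D, of "\<lambda>N. fst N u"] by (simp add: inner_D_def)
  have "Tp x v x = (Tp u v u + Tp u v u) + (Tp u v u + Tp u v u)" by (simp add: x_def T_diff algebra_simps)
  then have Q: "Qp x v = u" unfolding Tu by (simp add: double_half)
  \<comment> \<open>\<open>exp(x) exp(v)\<close> takes \<open>E\<close> to \<open>K E\<close>, so it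
    differs from \<open>K\<close> by an element of \<open>H\<close>; as \<open>exp(v)\<close> fixes
    \<open>o^+\<close>, the point \<open>z\<close> is \<open>f exp(x).o^+\<close>.\<close>
  have "(ep x \<cdot> em v) euler = ep x (0, euler0, v)" by (simp add: Bij_G exp_euler)
  also have "\<dots> = (0 - fst euler0 x - Qp x v, euler0 + inner_D V x v, v)"
    by (rule exp_apply(1)[OF tkk0_closed(6)])
  also have "\<dots> = (u, 0, v)" unfolding Q xv by (simp only: add.right_inverse) (simp add: x_def)
  finally have g: "(ep x \<cdot> em v) euler = K euler" using KE by simp
  have "(ginv K \<cdot> (ep x \<cdot> em v)) euler = ginv K ((ep x \<cdot> em v) euler)"
    by (rule mul_apply) (simp_all add: Bij_G K)
  also have "\<dots> = euler" unfolding g by (rule ginv_apply(2)[OF Bij_G[OF K] euler_tkk])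
  finally have H: "ginv K \<cdot> (ep x \<cdot> em v) \<in> H" unfolding H_grp_iff using K by auto
  have "z = (f \<cdot> K \<cdot> (ginv K \<cdot> (ep x \<cdot> em v))) \<star> op" using zK H K by simp
  also have "f \<cdot> K \<cdot> (ginv K \<cdot> (ep x \<cdot> em v)) = f \<cdot> ep x \<cdot> em v" using K by (simp add: G_assoc)
  also have "\<dots> \<star> op = (f \<cdot> ep x) \<star> op" by simp
  finally show ?thesis using xy U_set_inverse_pair by blast
qed

lemma polar_set_eq: "polar_set V q = U_set V a b"
proof -
  have "U_set V a b \<subseteq> X_p V" by (auto simp: U_set_iff X_p_eq transversal_iff)
  then show ?thesis using polar_set_subset U_set_transversal_q by (auto simp: polar_set_def)
qed

text \<open>The symmetry at \<open>x\<close> is \<open>x' \<mapsto> w.(-x')\<close> with the Weyl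
  element \<open>w\<close> of \<open>x\<close>. Moreover
  \<open>exp(-x').o^+ = exp(-y') v.o^+\<close> for a grading reversal \<open>v\<close>, and
  \<open>w\<close> turns \<open>exp(-y')\<close> into \<open>exp(Q(x) y')\<close>.\<close>

lemma U_mult_inverse_pair:
  assumes "inverse_pair x y" "inverse_pair x' y'"
  shows "U_mult V a b ((f \<cdot> ep x) \<star> op) ((f \<cdot> ep x') \<star> op) = (f \<cdot> ep (Qp x y')) \<star> op"
proof -
  \<comment> \<open>\<open>?g\<close> is the adapted frame at \<open>x\<close>: with
    \<open>a\<close> at 0 and \<open>b\<close> at \<open>-y\<close>, the midpoint is
    \<open>-y/2\<close>. The element \<open>?k\<close> leads from it to
    \<open>f \<cdot> ep x'\<close>.\<close>
  let ?g = "f \<cdot> ep x \<cdot> em (- sm half y)" and ?w = "weyl x y"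
    and ?v = "em y' \<cdot> (ep (- x') \<cdot> em y')" and ?k = "em (sm half y) \<cdot> (ep (- x) \<cdot> ep x')"
  note ws = weyl_swap[OF assms(1)] and wG = swapD(1)[OF weyl_swap[OF assms(1)]]
  have ga: "a = (?g \<cdot> em (- (- sm half y))) \<star> om" by (simp add: G_assoc exp_mult)
  have "?g \<cdot> em (- sm half y) = f \<cdot> ep x \<cdot> em (- y)"
    using half_add(2)[of y] by (simp add: G_assoc exp_mult) (metis minus_add_distrib uminus_add_conv_diff diff_conv_add_uminus)
  then have gb: "b = (?g \<cdot> em (- sm half y)) \<star> om" by (simp add: b_weyl[OF assms(1)])
  have "?g \<cdot> ?k = f \<cdot> ep x'" by (simp add: G_assoc)
  then have "U_mult V a b ((f \<cdot> ep x) \<star> op) ((f \<cdot> ep x') \<star> op) = U_mult V a b (?g \<star> op) ((?g \<cdot> ?k) \<star> op)"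
    by simp
  also have "\<dots> = (?g \<cdot> tw ?k) \<star> op" by (rule U_mult_eq[OF _ ga gb]) simp_all
  also have "?g \<cdot> tw ?k = f \<cdot> (?w \<cdot> ep (- x'))"
    using half_add(2)[of y] by (simp add: G_assoc weyl_def exp_mult) (metis minus_add_distrib uminus_add_conv_diff diff_conv_add_uminus)
  also have "\<dots> \<star> op = (f \<cdot> (?w \<cdot> ep (- x')) \<cdot> em y') \<star> op" using wG by simp
  also have "f \<cdot> (?w \<cdot> ep (- x')) \<cdot> em y' = f \<cdot> (?w \<cdot> em (- y')) \<cdot> ?v" using wG by (simp add: G_assoc)
  \<comment> \<open>Grading reversals all send \<open>o^+\<close> to the same point, so
    \<open>?v\<close> may be replaced by \<open>?w\<close>; then \<open>?w \<cdot> ?w\<close> falls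
    into \<open>H\<close>.\<close>
  also have "\<dots> \<star> op = (f \<cdot> (?w \<cdot> em (- y')) \<cdot> ?w) \<star> op"
    using wG by (intro swap_act(1)[OF weyl_swap'[OF assms(2)] ws]) simp
  also have "?w \<cdot> em (- y') = ep (Qp x y') \<cdot> ?w"
    unfolding swap_exp(2)[OF ws] weyl_apply[OF assms(1)] by simp
  also have "f \<cdot> (ep (Qp x y') \<cdot> ?w) \<cdot> ?w = f \<cdot> ep (Qp x y') \<cdot> (?w \<cdot> ?w)" using wG by (simp add: G_assoc)
  also have "\<dots> \<star> op = (f \<cdot> ep (Qp x y')) \<star> op" using swap_mul[OF ws ws] by simp
  finally show ?thesis .
qed

end

section \<open>Jordan algebras\<close>

locale jordan_algebra =
  fixes s :: "'k::comm_ring_1 \<Rightarrow> 'j::ab_group_add \<Rightarrow> 'j" and m :: "'j \<Rightarrow> 'j \<Rightarrow> 'j" (infixl "\<bullet>" 70)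
  assumes alg: "unital_jordan_algebra s m" and two: "(2::'k) dvd 1"
begin

lemma module_s: "module s"
  using alg by (simp add: unital_jordan_algebra_def)

lemma m_hom: "module_hom s s (\<lambda>x. x \<bullet> y)" "module_hom s s (\<lambda>y. x \<bullet> y)"
  using alg by (simp_all add: unital_jordan_algebra_def)

lemma m_simps [simp]:
  "(x + x') \<bullet> y = x \<bullet> y + x' \<bullet> y" "x \<bullet> (y + y') = x \<bullet> y + x \<bullet> y'"
  "(x - x') \<bullet> y = x \<bullet> y - x' \<bullet> y" "x \<bullet> (y - y') = x \<bullet> y - x \<bullet> y'"
  "s r x \<bullet> y = s r (x \<bullet> y)" "x \<bullet> s r y = s r (x \<bullet> y)"
  using module_hom.add[OF m_hom(1)] module_hom.add[OF m_hom(2)]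
    module_hom.diff[OF m_hom(1)] module_hom.diff[OF m_hom(2)]
    module_hom.scale[OF m_hom(1)] module_hom.scale[OF m_hom(2)] by auto

lemma m_comm: "x \<bullet> y = y \<bullet> x"
  using alg unfolding unital_jordan_algebra_def by blast

lemma jordan: "x \<bullet> ((x \<bullet> x) \<bullet> y) = (x \<bullet> x) \<bullet> (x \<bullet> y)"
  using alg unfolding unital_jordan_algebra_def by blast

lemma s_simps [simp]:
  "s r (x + y) = s r x + s r y" "s r (x - y) = s r x - s r y" "s r (s r' x) = s (r * r') x" "s 1 x = x"
  by (simp_all add: module.scale_right_distrib[OF module_s] module.scale_right_diff_distrib[OF module_s]
      module.scale_scale[OF module_s] module.scale_one[OF module_s])

lemma s_two: "s 2 x = x + x"
  using module.scale_left_distrib[OF module_s, of 1 1 x] by simp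

lemma double_inj: assumes "(x::'j) + x = 0" shows "x = 0"
proof -
  have "s 2 x = 0" using assms by (simp add: s_two)
  then have "s (unit_inv 2) (s 2 x) = 0" by (simp add: module.scale_zero_right[OF module_s])
  then show ?thesis using unit_inv_mult[OF two] by (simp add: mult.commute)
qed

text \<open>Inclusion-exclusion over the cubic map \<open>F\<close> extracts its trilinear part, in
  which every term occurs twice; hence the division by 2.\<close>

lemma jordan_linear:
  "(x \<bullet> y) \<bullet> (z \<bullet> w) + (y \<bullet> z) \<bullet> (x \<bullet> w) + (z \<bullet> x) \<bullet> (y \<bullet> w) =
   z \<bullet> ((x \<bullet> y) \<bullet> w) + x \<bullet> ((y \<bullet> z) \<bullet> w) + y \<bullet> ((z \<bullet> x) \<bullet> w)"
proof -
  define F where "F x = (x \<bullet> x) \<bullet> (x \<bullet> w) - x \<bullet> ((x \<bullet> x) \<bullet> w)" for x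
  define L where "L = (x \<bullet> y) \<bullet> (z \<bullet> w) + (y \<bullet> z) \<bullet> (x \<bullet> w) + (z \<bullet> x) \<bullet> (y \<bullet> w) -
   (z \<bullet> ((x \<bullet> y) \<bullet> w) + x \<bullet> ((y \<bullet> z) \<bullet> w) + y \<bullet> ((z \<bullet> x) \<bullet> w))"
  have F: "F x = 0" for x by (simp add: F_def jordan)
  have "L + L = F (x + y + z) - F (x + y) - F (y + z) - F (z + x) + F x + F y + F z"
    unfolding L_def F_def
    by (simp add: m_comm algebra_simps)
  then have "L + L = 0" by (simp add: F)
  then have "L = 0" by (rule double_inj)
  then show ?thesis by (simp add: L_def)
qed

text \<open>The left side of \<open>jordan_linear\<close> is symmetric in \<open>z\<close> and
  \<open>w\<close>. The resulting symmetry of the right side is the derivation property of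
  \<open>[L(z), L(w)]\<close>, \<open>L\<close> denoting multiplication.\<close>

lemma commutator_derivation:
  "z \<bullet> (w \<bullet> (x \<bullet> y)) - w \<bullet> (z \<bullet> (x \<bullet> y)) =
   (z \<bullet> (w \<bullet> x) - w \<bullet> (z \<bullet> x)) \<bullet> y + x \<bullet> (z \<bullet> (w \<bullet> y) - w \<bullet> (z \<bullet> y))"
proof -
  have "z \<bullet> ((x \<bullet> y) \<bullet> w) + x \<bullet> ((y \<bullet> z) \<bullet> w) + y \<bullet> ((z \<bullet> x) \<bullet> w) =
      w \<bullet> ((x \<bullet> y) \<bullet> z) + x \<bullet> ((y \<bullet> w) \<bullet> z) + y \<bullet> ((w \<bullet> x) \<bullet> z)"
    unfolding jordan_linear[symmetric] by (simp add: m_comm algebra_simps)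
  then show ?thesis by (simp add: m_comm algebra_simps)
qed

text \<open>Half of \<open>jordan_triple\<close>, which keeps factors of 2 out of the
  computations.\<close>

definition t :: "'j \<Rightarrow> 'j \<Rightarrow> 'j \<Rightarrow> 'j" where
  "t x y z = (x \<bullet> y) \<bullet> z + x \<bullet> (y \<bullet> z) - y \<bullet> (x \<bullet> z)"

lemma t_linear:
  "t (x + x') y z = t x y z + t x' y z" "t x (y + y') z = t x y z + t x y' z"
  "t x y (z + z') = t x y z + t x y z'"
  "t (x - x') y z = t x y z - t x' y z" "t x (y - y') z = t x y z - t x y' z"
  "t x y (z - z') = t x y z - t x y z'"
  "t (s r x) y z = s r (t x y z)" "t x (s r y) z = s r (t x y z)" "t x y (s r z) = s r (t x y z)"
  by (simp_all add: t_def algebra_simps)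

lemma t_sym: "t x y z = t z y x"
  by (simp add: t_def m_comm algebra_simps)

lemma t_derivation:
  assumes add: "\<And>x y. d (x + y) = d x + d y" "\<And>x y. d (x - y) = d x - d y"
    and der: "\<And>x y. d (x \<bullet> y) = d x \<bullet> y + x \<bullet> d y"
  shows "d (t x y z) = t (d x) y z + t x (d y) z + t x y (d z)"
  by (simp add: t_def add der algebra_simps)

text \<open>The derivation property of \<open>[L(y), L(x)]\<close> accounts for the commutator
  terms, the linearized Jordan identity for the rest. In pair language,
  \<open>(L(a), - L(a))\<close> is a derivation pair.\<close>

lemma t_mult: "a \<bullet> t x y z = t (a \<bullet> x) y z - t x (a \<bullet> y) z + t x y (a \<bullet> z)"
proof -
  have 1: "z \<bullet> (y \<bullet> (x \<bullet> a) - x \<bullet> (y \<bullet> a)) =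
      y \<bullet> (x \<bullet> (a \<bullet> z)) - x \<bullet> (y \<bullet> (a \<bullet> z)) - a \<bullet> (y \<bullet> (x \<bullet> z) - x \<bullet> (y \<bullet> z))"
    unfolding commutator_derivation[of y x a z] add_diff_cancel_right' by (rule m_comm)
  have 2: "a \<bullet> ((x \<bullet> y) \<bullet> z) =
      (a \<bullet> x) \<bullet> (y \<bullet> z) + (x \<bullet> y) \<bullet> (a \<bullet> z) + (y \<bullet> a) \<bullet> (x \<bullet> z) - y \<bullet> ((a \<bullet> x) \<bullet> z) - x \<bullet> ((y \<bullet> a) \<bullet> z)"
    unfolding jordan_linear[of a x y z] by simp
  have "a \<bullet> t x y z = a \<bullet> ((x \<bullet> y) \<bullet> z) + a \<bullet> (x \<bullet> (y \<bullet> z)) - a \<bullet> (y \<bullet> (x \<bullet> z))"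
    by (simp add: t_def)
  also have "\<dots> = t (a \<bullet> x) y z - t x (a \<bullet> y) z + t x y (a \<bullet> z)"
    unfolding 2 using 1 unfolding t_def by (simp add: m_comm algebra_simps)
  finally show ?thesis .
qed

text \<open>\<open>t(u, v, -)\<close> is \<open>L(uv) + [L(u), L(v)]\<close>, and
  \<open>t(v, u, -)\<close> has the opposite commutator. The commutator is a derivation and
  \<open>L(uv)\<close> obeys \<open>t_mult\<close>; the two contributions add up.\<close>

lemma t_jordan: "t u v (t x y z) = t (t u v x) y z - t x (t v u y) z + t x y (t u v z)"
proof -
  define d where "d x = u \<bullet> (v \<bullet> x) - v \<bullet> (u \<bullet> x)" for x
  have d: "d (t x y z) = t (d x) y z + t x (d y) z + t x y (d z)"
  proof (rule t_derivation)
    show "d (x + y) = d x + d y" "d (x - y) = d x - d y" for x y by (simp_all add: d_def algebra_simps)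
    show "d (x \<bullet> y) = d x \<bullet> y + x \<bullet> d y" for x y unfolding d_def by (rule commutator_derivation)
  qed
  have uv: "t u v x = (u \<bullet> v) \<bullet> x + d x" "t v u x = (u \<bullet> v) \<bullet> x - d x" for x
    by (simp_all add: t_def d_def m_comm[of v u])
  show ?thesis unfolding uv t_linear d t_mult by (simp add: algebra_simps)
qed

lemma jordan_triple_t: "jordan_triple s m x y z = s 2 (t x y z)"
  by (simp add: jordan_triple_def t_def)

lemma jordan_pair_algebra: "jordan_pair (algebra_jpair s m)"
proof -
  have h: "module_hom s s (\<lambda>x. jordan_triple s m x y z)" "module_hom s s (\<lambda>y. jordan_triple s m x y z)"
    "module_hom s s (\<lambda>z. jordan_triple s m x y z)" for x y z
    unfolding jordan_triple_t
    by (intro module_hom.intro module_s module_hom_axioms.intro; simp add: t_linear mult.commute)+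
  then have "trilinear s s (jordan_triple s m)" by (simp add: trilinear_def)
  moreover have "jordan_triple s m u v (jordan_triple s m x y z) =
      jordan_triple s m (jordan_triple s m u v x) y z - jordan_triple s m x (jordan_triple s m v u y) z
      + jordan_triple s m x y (jordan_triple s m u v z)" for u v x y z
    unfolding jordan_triple_t t_linear by (subst t_jordan) simp
  moreover have "jordan_triple s m x y z = jordan_triple s m z y x" for x y z
    unfolding jordan_triple_t using t_sym by simp
  ultimately show ?thesis
    unfolding jordan_pair_def algebra_jpair_def jpair.simps using module_s by blast
qed

section \<open>Invertible elements of the Jordan algebra\<close>

lemma U_op_t: "U_op s m x y = t x y x"
  by (simp add: U_op_def t_def s_two m_comm)

lemma half_jordan_triple: "s (unit_inv 2) (jordan_triple s m x y x) = U_op s m x y"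
proof -
  have "unit_inv 2 * 2 = (1::'k)" using unit_inv_mult[OF two] by (simp add: mult.commute)
  then show ?thesis by (simp add: jordan_triple_t U_op_t)
qed

lemma J_units_iff: "x \<in> J_units s m \<longleftrightarrow> bij (U_op s m x)"
proof -
  have "module_hom s s (U_op s m x)"
    unfolding U_op_t[abs_def]
    by (intro module_hom.intro module_s module_hom_axioms.intro; simp add: t_linear)
  then show ?thesis by (simp add: J_units_def)
qed

lemma U_op_J_inv: "x \<in> J_units s m \<Longrightarrow> U_op s m x (J_inv s m x) = x"
  unfolding J_inv_def J_units_iff by (rule f_inv_into_f) (simp add: bij_is_surj)

context
  assumes three: "(3::'k) dvd 1"
begin

interpretation W: jordan_pair_space "algebra_jpair s m"
  using jordan_pair_algebra two three by unfold_locales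

text \<open>The quadratic map \<open>Q(x)\<close> of the pair is \<open>U_op\<close>, so bijectivity
  of \<open>Q(x)\<close> and \<open>Q(x) y = x\<close> are the definitions of unit and
  inverse.\<close>

lemma inverse_pair_algebra:
  "W.inverse_pair x y \<longleftrightarrow> x \<in> J_units s m \<and> y = J_inv s m x"
proof -
  have Q: "W.Qp x y = U_op s m x y" for x y
    using half_jordan_triple by (simp add: algebra_jpair_def)
  show ?thesis
  proof
    assume xy: "W.inverse_pair x y"
    then have x: "x \<in> J_units s m" using W.inverse_pair_bij[OF xy] Q by (simp add: J_units_iff)
    have "U_op s m x y = U_op s m x (J_inv s m x)"
      using W.inverse_pair_Qp[OF xy] Q U_op_J_inv[OF x] by simp
    then show "x \<in> J_units s m \<and> y = J_inv s m x"
      using x by (simp add: J_units_iff bij_def inj_def)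
  next
    assume "x \<in> J_units s m \<and> y = J_inv s m x"
    then show "W.inverse_pair x y"
      using W.inverse_pair_of_bij[of x y] Q U_op_J_inv by (simp add: J_units_iff)
  qed
qed

lemma invertible_position_polar:
  assumes ne: "U_set (algebra_jpair s m) a b \<noteq> {}" and pos: "invertible_position s m a b"
  shows "(\<exists>q. bij_betw q (X_p (algebra_jpair s m)) (X_m (algebra_jpair s m)) \<and>
      (\<forall>x \<in> U_set (algebra_jpair s m) a b. q x = midpt (algebra_jpair s m) a b x) \<and>
      polarity (jp_geometry (algebra_jpair s m)) q \<and>
      polar_set (algebra_jpair s m) q = U_set (algebra_jpair s m) a b \<and>
      (\<forall>x \<in> U_set (algebra_jpair s m) a b. \<forall>y \<in> U_set (algebra_jpair s m) a b.
         polar_mult (algebra_jpair s m) q x y = U_mult (algebra_jpair s m) a b x y)) \<and>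
    mult_isomorphic (U_set (algebra_jpair s m) a b) (U_mult (algebra_jpair s m) a b)
      (J_units s m) (J_mult s m)"
proof -
  obtain g c where g: "g \<in> W.G" and c: "c \<in> J_units s m" and a: "a = W.act g W.om"
    and b: "b = W.act g (W.act (W.em c) W.om)"
    using pos unfolding invertible_position_def Let_def by blast
  define d where "d = J_inv s m c"
  have cd: "W.inverse_pair c d" using c by (simp add: inverse_pair_algebra d_def)
  \<comment> \<open>Both triple products of this pair coincide, so an inverse pair may be
    reversed.\<close>
  then have "W.inverse_pair d c" unfolding W.inverse_pair_def by (simp add: algebra_jpair_def)
  then have dc: "W.inverse_pair (- d) (- c)" by (rule W.inverse_pair_minus)
  \<comment> \<open>\<open>exp(d)\<close> fixes \<open>o^-\<close>, so \<open>f\<close> still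
    represents \<open>a\<close>. It cancels the first factor of
    \<open>w = exp(-d) exp(c) exp(-d)\<close>, and \<open>f w = g exp(c) exp(-d)\<close> represents
    \<open>b\<close>.\<close>
  define f where "f = W.mul g (W.ep d)"
  define w where "w = W.weyl (- d) (- c)"
  interpret S: jordan_pair_swap "algebra_jpair s m" f w
    using g W.weyl_swap[OF dc] W.tw_weyl by unfold_locales (simp_all add: f_def w_def)
  have a': "a = S.a" using g by (simp add: a f_def)
  have "W.mul f w = W.mul (W.mul g (W.em c)) (W.ep (- d))"
    using g by (simp add: f_def w_def W.weyl_def W.G_assoc)
  then have b': "b = S.b" using g by (simp add: b)
  have "\<forall>x \<in> U_set (algebra_jpair s m) a b. S.q x = midpt (algebra_jpair s m) a b x"
    using S.q_midpt by (simp add: a' b')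
  then have pm: "\<forall>x \<in> U_set (algebra_jpair s m) a b. \<forall>y \<in> U_set (algebra_jpair s m) a b.
         polar_mult (algebra_jpair s m) S.q x y = U_mult (algebra_jpair s m) a b x y"
    by (simp add: polar_mult_def U_mult_def)
  \<comment> \<open>The chart of \<open>v_a\<close> given by \<open>f\<close>; it maps
    \<open>J_units s m\<close> onto the set, and its inverse is the isomorphism.\<close>
  define \<phi> where "\<phi> u = W.act (W.mul f (W.ep u)) W.op" for u
  have inj: "inj \<phi>" by (rule injI) (simp add: \<phi>_def W.exp_act_inject)
  have U: "U_set (algebra_jpair s m) a b = \<phi> ` J_units s m"
    unfolding a' b' using S.U_set_inverse_pair by (auto simp: inverse_pair_algebra \<phi>_def)
  have mu: "U_mult (algebra_jpair s m) a b (\<phi> x) (\<phi> y) = \<phi> (J_mult s m x y)"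
    if "x \<in> J_units s m" "y \<in> J_units s m" for x y
  proof -
    have "U_mult (algebra_jpair s m) a b (\<phi> x) (\<phi> y) = \<phi> (W.Qp x (J_inv s m y))"
      unfolding a' b' \<phi>_def
      using that by (intro S.U_mult_inverse_pair) (simp_all add: inverse_pair_algebra)
    then show ?thesis using half_jordan_triple by (simp add: algebra_jpair_def J_mult_def)
  qed
  have "bij_betw (inv_into UNIV \<phi>) (\<phi> ` J_units s m) (J_units s m)"
    by (rule bij_betw_byWitness[where f' = \<phi>]) (auto simp: inj inv_f_f f_inv_into_f)
  moreover have "\<forall>x\<in>\<phi> ` J_units s m. \<forall>y\<in>\<phi> ` J_units s m.
      inv_into UNIV \<phi> (U_mult (algebra_jpair s m) a b x y) = J_mult s m (inv_into UNIV \<phi> x) (inv_into UNIV \<phi> y)"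
    by (auto simp: mu inv_f_f[OF inj])
  ultimately have "mult_isomorphic (U_set (algebra_jpair s m) a b) (U_mult (algebra_jpair s m) a b)
      (J_units s m) (J_mult s m)"
    unfolding mult_isomorphic_def U by blast
  then show ?thesis
    using S.q_bij S.q_midpt S.q_polarity S.polar_set_eq pm ne unfolding a' b' by blast
qed

end

end

theorem theorem3p1:
  fixes V :: "('k::comm_ring_1, 'v::ab_group_add, 'w::ab_group_add) jpair"
    and s :: "'k \<Rightarrow> 'j::ab_group_add \<Rightarrow> 'j"
    and m :: "'j \<Rightarrow> 'j \<Rightarrow> 'j"
  assumes "(2::'k) dvd 1" and "(3::'k) dvd 1"
  shows
    "(jordan_pair V \<longrightarrow>
       (\<forall>a \<in> X_m V. \<forall>b \<in> X_m V. U_set V a b \<noteq> {} \<longrightarrow>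
          symmetric_space (U_set V a b) (U_mult V a b)
            (\<lambda>x. nbh_p (jp_geometry V) (midpt V a b x))
            (\<lambda>x y. Pi_p (jp_geometry V) (- 1) x (midpt V a b x) y)))
     \<and>
     (unital_jordan_algebra s m \<longrightarrow>
       (let W = algebra_jpair s m in
        \<forall>a \<in> X_m W. \<forall>b \<in> X_m W.
          U_set W a b \<noteq> {} \<and> invertible_position s m a b \<longrightarrow>
          (\<exists>q. bij_betw q (X_p W) (X_m W) \<and>
               (\<forall>x \<in> U_set W a b. q x = midpt W a b x) \<and>
               polarity (jp_geometry W) q \<and>
               polar_set W q = U_set W a b \<and>
               (\<forall>x \<in> U_set W a b. \<forall>y \<in> U_set W a b. polar_mult W q x y = U_mult W a b x y)) \<and>
          mult_isomorphic (U_set W a b) (U_mult W a b) (J_units s m) (J_mult s m)))"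
proof (intro conjI impI)
  assume "jordan_pair V"
  then interpret jordan_pair_space V using assms by unfold_locales
  show "\<forall>a \<in> X_m V. \<forall>b \<in> X_m V. U_set V a b \<noteq> {} \<longrightarrow>
      symmetric_space (U_set V a b) (U_mult V a b)
        (\<lambda>x. nbh_p (jp_geometry V) (midpt V a b x))
        (\<lambda>x y. Pi_p (jp_geometry V) (- 1) x (midpt V a b x) y)"
    using U_set_symmetric_space by blast
next
  assume "unital_jordan_algebra s m"
  then interpret jordan_algebra s m using assms by unfold_locales
  show "let W = algebra_jpair s m in
        \<forall>a \<in> X_m W. \<forall>b \<in> X_m W.
          U_set W a b \<noteq> {} \<and> invertible_position s m a b \<longrightarrow>
          (\<exists>q. bij_betw q (X_p W) (X_m W) \<and>
               (\<forall>x \<in> U_set W a b. q x = midpt W a b x) \<and>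
               polarity (jp_geometry W) q \<and>
               polar_set W q = U_set W a b \<and>
               (\<forall>x \<in> U_set W a b. \<forall>y \<in> U_set W a b. polar_mult W q x y = U_mult W a b x y)) \<and>
          mult_isomorphic (U_set W a b) (U_mult W a b) (J_units s m) (J_mult s m)"
    unfolding Let_def
    by (intro ballI impI, elim conjE) (rule invertible_position_polar[OF assms(2)])
qed

end
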